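(* Every group in $\mathcal K$ has the algebraic eigenvalue property.
   Context: $\mathcal K$ is the smallest class of (discrete) groups containing all free groups and all amenable groups and closed under taking extensions with amenable quotient (if $1\to N\to G\to Q\to1$ is exact with $N\in\mathcal K$ and $Q$ amenable, then $G\in\mathcal K$) and under taking directed unions. $\overline{\mathbb{Q}}$ is the field of algebraic numbers in $\mathbb C$. A discrete group $G$ has the algebraic eigenvalue property if for every $d\ge1$ and every matrix $A\in M_d(\overline{\mathbb{Q}}G)$ over the group algebra, the eigenvalues of $A$, acting on $l^2(G)^d$ by left multiplication (convolution), are algebraic numbers. (Operators without eigenvalues satisfy this vacuously.) *)

theory Defs
  imports
    "HOL-Analysis.Analysis"
    "HOL-Algebra.Coset"
    "HOL-Computational_Algebra.Polynomial"
begin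

section \<open>Free groups\<close>

text \<open>
  A word over S is a list of letters (s, e) with s in S, where (s, True) stands for s and
  (s, False) for its formal inverse. A group is free on S if each of its elements is the
  value of exactly one reduced word over S.
\<close>

definition words_over :: "'a set \<Rightarrow> ('a \<times> bool) list set" where
  "words_over S = lists (S \<times> UNIV)"

definition reduced_word :: "('a \<times> bool) list \<Rightarrow> bool" where
  "reduced_word w \<longleftrightarrow> successively (\<lambda>x y. \<not> (fst x = fst y \<and> snd x \<noteq> snd y)) w"

definition word_value :: "('a, 'b) monoid_scheme \<Rightarrow> ('a \<times> bool) list \<Rightarrow> 'a" where
  "word_value G w =
     foldr (\<lambda>(s, e) x. (if e then s else inv\<^bsub>G\<^esub> s) \<otimes>\<^bsub>G\<^esub> x) w \<one>\<^bsub>G\<^esub>"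

definition free_basis :: "('a, 'b) monoid_scheme \<Rightarrow> 'a set \<Rightarrow> bool" where
  "free_basis G S \<longleftrightarrow> S \<subseteq> carrier G \<and>
     bij_betw (word_value G) {w \<in> words_over S. reduced_word w} (carrier G)"

definition free_group :: "('a, 'b) monoid_scheme \<Rightarrow> bool" where
  "free_group G \<longleftrightarrow> group G \<and> (\<exists>S. free_basis G S)"


section \<open>Amenable groups\<close>

text \<open>
  Bounded functions on G are represented by functions on the whole type that are bounded on
  the carrier. An invariant mean depends only on the values on the carrier: by linearity and
  the last condition, functions that agree on the carrier have the same mean.
\<close>

definition bounded_fun :: "('a, 'b) monoid_scheme \<Rightarrow> ('a \<Rightarrow> real) set" where
  "bounded_fun G = {f. bounded (f ` carrier G)}"

definition invariant_mean :: "('a, 'b) monoid_scheme \<Rightarrow> (('a \<Rightarrow> real) \<Rightarrow> real) \<Rightarrow> bool" where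
  "invariant_mean G m \<longleftrightarrow>
     (\<forall>f\<in>bounded_fun G. \<forall>g\<in>bounded_fun G. m (\<lambda>x. f x + g x) = m f + m g) \<and>
     (\<forall>c. \<forall>f\<in>bounded_fun G. m (\<lambda>x. c * f x) = c * m f) \<and>
     (\<forall>g\<in>carrier G. \<forall>f\<in>bounded_fun G. m (\<lambda>x. f (inv\<^bsub>G\<^esub> g \<otimes>\<^bsub>G\<^esub> x)) = m f) \<and>
     m (\<lambda>_. 1) = 1 \<and>
     (\<forall>f\<in>bounded_fun G. (INF x\<in>carrier G. f x) \<le> m f \<and> m f \<le> (SUP x\<in>carrier G. f x))"

definition amenable :: "('a, 'b) monoid_scheme \<Rightarrow> bool" where
  "amenable G \<longleftrightarrow> group G \<and> (\<exists>m. invariant_mean G m)"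


section \<open>The class K\<close>

text \<open>
  The closure conditions are stated for normal subgroups and for directed families of
  subgroups of the given group, so that all groups occurring in a derivation live on one type.
  Up to isomorphism, under which the free and the amenable groups are closed, every extension
  with kernel N and quotient Q is one of the form N, G, G Mod N with N normal in G, and every
  directed union is the union of a directed family of subgroups.
\<close>

definition directed_union_of :: "('a, 'b) monoid_scheme \<Rightarrow> 'a set set \<Rightarrow> bool" where
  "directed_union_of G \<H> \<longleftrightarrow> \<H> \<noteq> {} \<and> (\<forall>H\<in>\<H>. subgroup H G) \<and>
     (\<forall>H1\<in>\<H>. \<forall>H2\<in>\<H>. \<exists>H3\<in>\<H>. H1 \<subseteq> H3 \<and> H2 \<subseteq> H3) \<and> \<Union>\<H> = carrier G"

inductive class_K :: "('a, 'b) monoid_scheme \<Rightarrow> bool" where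
  free: "free_group G \<Longrightarrow> class_K G"
| amenable: "amenable G \<Longrightarrow> class_K G"
| extension: "\<lbrakk>N \<lhd> G; class_K (G\<lparr>carrier := N\<rparr>); amenable (G Mod N)\<rbrakk> \<Longrightarrow> class_K G"
| directed_union:
    "\<lbrakk>group G; directed_union_of G \<H>; \<And>H. H \<in> \<H> \<Longrightarrow> class_K (G\<lparr>carrier := H\<rparr>)\<rbrakk>
       \<Longrightarrow> class_K G"


section \<open>The algebraic eigenvalue property\<close>

definition group_algebra :: "complex set \<Rightarrow> ('a, 'b) monoid_scheme \<Rightarrow> ('a \<Rightarrow> complex) set" where
  "group_algebra F G =
     {a. (\<forall>g. a g \<in> F) \<and> finite {g. a g \<noteq> 0} \<and> {g. a g \<noteq> 0} \<subseteq> carrier G}"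

definition algebraic_numbers :: "complex set" where
  "algebraic_numbers = {z. algebraic z}"

definition l2 :: "('a, 'b) monoid_scheme \<Rightarrow> ('a \<Rightarrow> complex) set" where
  "l2 G = {u. (\<lambda>g. (cmod (u g))\<^sup>2) summable_on carrier G \<and> (\<forall>g. g \<notin> carrier G \<longrightarrow> u g = 0)}"

text \<open>
  Elements of the d-fold sum of l2 G are indexed by 0, ..., d - 1 and extended by zero to all
  indices, so that a vector vanishes iff it is the zero function.
\<close>

definition l2_vec :: "('a, 'b) monoid_scheme \<Rightarrow> nat \<Rightarrow> (nat \<Rightarrow> 'a \<Rightarrow> complex) set" where
  "l2_vec G d = {v. (\<forall>i<d. v i \<in> l2 G) \<and> (\<forall>i\<ge>d. v i = (\<lambda>_. 0))}"

definition convolution ::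
  "('a, 'b) monoid_scheme \<Rightarrow> ('a \<Rightarrow> complex) \<Rightarrow> ('a \<Rightarrow> complex) \<Rightarrow> 'a \<Rightarrow> complex" where
  "convolution G a u g =
     (if g \<in> carrier G then \<Sum>h | a h \<noteq> 0. a h * u (inv\<^bsub>G\<^esub> h \<otimes>\<^bsub>G\<^esub> g) else 0)"

definition left_mult ::
  "('a, 'b) monoid_scheme \<Rightarrow> nat \<Rightarrow> (nat \<Rightarrow> nat \<Rightarrow> 'a \<Rightarrow> complex) \<Rightarrow>
     (nat \<Rightarrow> 'a \<Rightarrow> complex) \<Rightarrow> nat \<Rightarrow> 'a \<Rightarrow> complex" where
  "left_mult G d A v i g = (if i < d then \<Sum>j<d. convolution G (A i j) (v j) g else 0)"

definition is_eigenvalue ::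
  "('a, 'b) monoid_scheme \<Rightarrow> nat \<Rightarrow> (nat \<Rightarrow> nat \<Rightarrow> 'a \<Rightarrow> complex) \<Rightarrow> complex \<Rightarrow> bool" where
  "is_eigenvalue G d A c \<longleftrightarrow>
     (\<exists>v\<in>l2_vec G d. v \<noteq> (\<lambda>_ _. 0) \<and> left_mult G d A v = (\<lambda>i g. c * v i g))"

definition algebraic_eigenvalue_property :: "('a, 'b) monoid_scheme \<Rightarrow> bool" where
  "algebraic_eigenvalue_property G \<longleftrightarrow>
     (\<forall>d\<ge>1. \<forall>A. (\<forall>i<d. \<forall>j<d. A i j \<in> group_algebra algebraic_numbers G) \<longrightarrow>
        (\<forall>c. is_eigenvalue G d A c \<longrightarrow> algebraic c))"

end

theory Submission
  imports
    Defs
    "HOL-Complex_Analysis.Complex_Analysis"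
    "HOL-Combinatorics.Permutations"
    "Jordan_Normal_Form.Char_Poly"
begin

text \<open>
  The idea is to replace the operator \<open>A - c\<close> on \<open>l\<^sup>2(G)\<^sup>d\<close> by finite integer matrices, in which a
  transcendental \<open>c\<close> cannot be an approximate eigenvalue on a positive proportion of the space.

  Every group in the class is sofic: finite parts of its multiplication table are modelled by
  maps of finite sets, up to a small proportion of bad points (\<open>sofic_of_class_K\<close>). A free group
  acts on finite sets by permutations that separate finitely many reduced words. An amenable
  group has Folner sets, since otherwise Hall's theorem would give a doubling of the group, which
  an invariant mean excludes. Models of a kernel and Folner sets of a quotient combine to models
  of an extension (\<open>sofic_extension\<close>), and a directed union only needs models of its members.

  The coefficients may be taken to be integers. Finitely many algebraic numbers, multiplied by a
  common integer \<open>D \<noteq> 0\<close>, preserve a finitely generated subgroup of the complex numbers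
  (\<open>algebraic_numbers_preserve_lattice\<close>). Each coefficient is replaced by its integer matrix on
  the generators; the generators form a common eigenvector of these matrices, so tensoring with
  it turns an eigenvector for \<open>c\<close> into one for \<open>D c\<close>.

  Let \<open>A\<close> be an integer matrix over the group ring, \<open>(A - c) v = 0\<close> with \<open>v \<noteq> 0\<close>, and put
  \<open>T = (A - c)\<^sup>* (A - c)\<close>. For each \<open>\<kappa>\<close>, the operator \<open>(1 - T / \<kappa>)\<^sup>m\<close> fixes \<open>v\<close>, so by Cauchy-Schwarz
  it maps a suitable unit vector to a vector whose norm is bounded below independently of \<open>m\<close>
  (\<open>group_damp_lower_bound\<close>). This vector depends only on a ball in the group, so every good
  point of a finite model sees the same norm. The models thus satisfy a lower bound, independent
  of \<open>m\<close>, for the trace of \<open>(1 - T / \<kappa>)\<^sup>2\<^sup>m\<close> in proportion to the dimension.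

  For a transcendental \<open>c\<close> this contradicts \<open>transcendental_trace_decay\<close>: among integer matrices
  \<open>A\<close> of bounded norm and of any size, the proportion of singular values of \<open>A - c\<close> below
  \<open>\<epsilon>\<close> is small when \<open>\<epsilon>\<close> is small (\<open>few_small_singular_values\<close>). The reason is integrality. By the
  pigeonhole principle there are integer polynomials \<open>p\<close> for which \<open>|p(c)|\<close> is below any given
  negative power of a bound \<open>\<Phi>\<close> for the norm of \<open>p(A)\<close>. Where \<open>A - c\<close> is very small, \<open>p(A)\<close>
  is about as small as \<open>p(c)\<close>. But the product of the nonzero singular values of the integer matrix
  \<open>p(A)\<close> is at least 1, and all of them are at most \<open>\<Phi>\<close>, so only a small proportion can be that
  small. It remains to control the kernel of \<open>p(A)\<close>. The bound \<open>\<Phi>\<close> is chosen to be multiplicative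
  in \<open>p\<close>, which allows passing to prime polynomials; kernels for different primes are
  independent, so among many primes one has a kernel of small dimension.
\<close>

section \<open>Integer polynomials with small values at a transcendental number\<close>


lemma of_int_poly_const: "of_int_poly [:a:] = [:of_int a:]"
  by (rule poly_eqI) (auto simp: coeff_map_poly coeff_pCons split: nat.splits)

text \<open>
  A bound for the norm of \<open>p(A)\<close> when \<open>A\<close> has norm at most \<open>R\<close>, obtained from the linear factors of
  \<open>p\<close>. Unlike a norm of the coefficients it is multiplicative in \<open>p\<close>, so it can be followed
  through a prime factorisation.
\<close>

definition root_weight :: "real \<Rightarrow> complex poly \<Rightarrow> real" where
  "root_weight R p = cmod (lead_coeff p) * (\<Prod>r\<in>#proots p. R + cmod r)"

lemma root_weight_mult:
  "p \<noteq> 0 \<Longrightarrow> q \<noteq> 0 \<Longrightarrow> root_weight R (p * q) = root_weight R p * root_weight R q"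
  by (simp add: root_weight_def proots_mult lead_coeff_mult norm_mult)

lemma prod_mset_ge_power:
  fixes f :: "'a \<Rightarrow> real"
  assumes "\<And>x. f x \<ge> b" "b \<ge> 0"
  shows "(\<Prod>x\<in>#M. f x) \<ge> b ^ size M"
  by (induction M) (use assms in \<open>auto intro!: mult_mono elim: order_trans\<close>)

lemma root_weight_int_ge:
  fixes p :: "int poly"
  assumes "p \<noteq> 0" "R \<ge> 0"
  shows "root_weight R (of_int_poly p) \<ge> R ^ degree p"
proof -
  let ?p = "of_int_poly p :: complex poly"
  have "(1::real) \<le> cmod (lead_coeff ?p)"
  proof -
    have "1 \<le> \<bar>lead_coeff p\<bar>" using assms by (simp add: int_one_le_iff_zero_less)
    hence "1 \<le> real_of_int \<bar>lead_coeff p\<bar>" by linarith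
    thus ?thesis by simp
  qed
  moreover have "(\<Prod>r\<in>#proots ?p. R + cmod r) \<ge> R ^ size (proots ?p)"
    by (rule prod_mset_ge_power) (use assms in auto)
  moreover have "R ^ size (proots ?p) \<ge> 0" using assms by simp
  ultimately have "1 * R ^ size (proots ?p) \<le> root_weight R ?p"
    unfolding root_weight_def by (intro mult_mono) auto
  thus ?thesis by (simp add: size_proots_complex)
qed

text \<open>
  On the unit circle this factor has the same absolute value as \<open>z - r\<close>, but its value at 0 has
  absolute value \<open>max 1 |r|\<close>.
\<close>

definition reflected_factor :: "complex \<Rightarrow> complex poly" where
  "reflected_factor r = (if cmod r > 1 then [:- r, 1:] else [:1, - cnj r:])"

lemma cmod_reflected_factor:
  assumes "cmod z = 1"
  shows "cmod (poly (reflected_factor r) z) = cmod (z - r)"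
proof (cases "cmod r > 1")
  case False
  have "1 - cnj r * z = z * cnj (z - r)"
    using assms complex_norm_square[of z] by (simp add: algebra_simps)
  hence "cmod (1 - cnj r * z) = cmod (z - r)"
    using assms by (metis complex_mod_cnj mult_1 norm_mult)
  thus ?thesis using False by (simp add: reflected_factor_def algebra_simps)
qed (simp add: reflected_factor_def algebra_simps)

text \<open>
  Landau's inequality. The left side is the Mahler measure of \<open>p\<close>; it is the absolute value at 0 of
  the polynomial with reflected factors, and the maximum principle compares this with the
  values on the unit circle.
\<close>

lemma mahler_measure_le_length:
  fixes p :: "complex poly"
  assumes "p \<noteq> 0"
  shows "cmod (lead_coeff p) * (\<Prod>r\<in>#proots p. max 1 (cmod r)) \<le> (\<Sum>k\<le>degree p. cmod (coeff p k))"
proof -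
  define F where "F = Polynomial.smult (lead_coeff p) (\<Prod>r\<in>#proots p. reflected_factor r)"
  have norm_F: "cmod (poly F z) = cmod (poly p z)" if "cmod z = 1" for z
  proof -
    have "cmod (poly (\<Prod>r\<in>#M. reflected_factor r) z) = cmod (poly (\<Prod>r\<in>#M. [:- r, 1:]) z)" for M
    proof (induction M)
      case (add x M)
      have "poly (\<Prod>r\<in>#add_mset x M. [:- r, 1:]) z = (z - x) * poly (\<Prod>r\<in>#M. [:- r, 1:]) z"
        by (simp add: algebra_simps)
      thus ?case using add by (simp add: norm_mult cmod_reflected_factor that)
    qed auto
    thus ?thesis
      unfolding F_def
      by (subst (2) complex_poly_decompose_multiset[of p, symmetric]) (simp add: norm_mult)
  qed
  have F0: "cmod (poly F 0) = cmod (lead_coeff p) * (\<Prod>r\<in>#proots p. max 1 (cmod r))"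
  proof -
    have "cmod (poly (\<Prod>r\<in>#M. reflected_factor r) 0) = (\<Prod>r\<in>#M. max 1 (cmod r))" for M
      by (induction M) (auto simp: norm_mult reflected_factor_def)
    thus ?thesis by (simp add: F_def norm_mult)
  qed
  have "cmod (poly F 0) \<le> (\<Sum>k\<le>degree p. cmod (coeff p k))"
  proof (rule maximum_modulus_frontier[of "poly F" "cball 0 1"])
    show "poly F holomorphic_on interior (cball 0 1)" by (intro holomorphic_intros)
    show "continuous_on (closure (cball 0 1)) (poly F)" by (intro continuous_intros)
  next
    fix z :: complex assume "z \<in> frontier (cball 0 1)"
    hence z: "cmod z = 1" by (simp add: frontier_cball)
    have "cmod (poly p z) \<le> (\<Sum>k\<le>degree p. cmod (coeff p k * z ^ k))"
      unfolding poly_altdef by (rule norm_sum)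
    thus "cmod (poly F z) \<le> (\<Sum>k\<le>degree p. cmod (coeff p k))"
      using z by (simp add: norm_F norm_mult norm_power)
  qed auto
  thus ?thesis using F0 by simp
qed

lemma root_weight_le:
  assumes "p \<noteq> 0" "R \<ge> 0"
  shows "root_weight R p \<le> (R + 1) ^ degree p * (\<Sum>k\<le>degree p. cmod (coeff p k))"
proof -
  have step: "R + cmod r \<le> (R + 1) * max 1 (cmod r)" for r
  proof -
    have "R * 1 \<le> R * max 1 (cmod r)" using assms by (intro mult_left_mono) auto
    thus ?thesis by (simp add: algebra_simps)
  qed
  have nonneg: "(\<Prod>r\<in>#M. R + cmod r) \<ge> 0" for M
    by (induction M) (use assms in auto)
  have "(\<Prod>r\<in>#M. R + cmod r) \<le> (R + 1) ^ size M * (\<Prod>r\<in>#M. max 1 (cmod r))" for M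
  proof (induction M)
    case (add x M)
    have "(R + cmod x) * (\<Prod>r\<in>#M. R + cmod r)
        \<le> ((R + 1) * max 1 (cmod x)) * ((R + 1) ^ size M * (\<Prod>r\<in>#M. max 1 (cmod r)))"
      by (intro mult_mono add step) (use assms nonneg in auto)
    thus ?case by (simp add: algebra_simps)
  qed auto
  hence "root_weight R p
      \<le> cmod (lead_coeff p) * ((R + 1) ^ degree p * (\<Prod>r\<in>#proots p. max 1 (cmod r)))"
    unfolding root_weight_def size_proots_complex[of p, symmetric] by (intro mult_left_mono) auto
  also have "\<dots> = (R + 1) ^ degree p * (cmod (lead_coeff p) * (\<Prod>r\<in>#proots p. max 1 (cmod r)))"
    by simp
  also have "\<dots> \<le> (R + 1) ^ degree p * (\<Sum>k\<le>degree p. cmod (coeff p k))"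
    by (intro mult_left_mono mahler_measure_le_length) (use assms in auto)
  finally show ?thesis .
qed

text \<open>
  The \<open>(H + 1)\<^sup>2\<^sup>s\<close> polynomials with \<open>2 s\<close> coefficients between 0 and \<open>H\<close> take values in a square
  whose side is proportional to \<open>H\<close>. Cut the square into about \<open>H\<^sup>s \<times> H\<^sup>s\<close> cells; two of the
  polynomials have values in the same cell, and \<open>q\<close> is their difference.
\<close>

lemma exists_small_value_pigeonhole:
  fixes c :: complex and s H :: nat
  assumes s: "s \<ge> 2" and H: "H \<ge> 1"
  obtains q :: "int poly" where "q \<noteq> 0" "degree q < 2 * s" "\<And>k. \<bar>coeff q k\<bar> \<le> int H"
    "cmod (poly (of_int_poly q) c) * H ^ s \<le> 8 * s * H * (max 1 (cmod c)) ^ (2 * s)"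
proof -
  define R where "R = max 1 (cmod c)"
  have R: "R \<ge> 1" by (simp add: R_def)
  define D where "D = 2 * real s * H * R ^ (2 * s)"
  have D: "D > 0" using s H R by (simp add: D_def)
  define P where "P = FuncSet.PiE (lessThan (2 * s)) (\<lambda>_. {0..int H})"
  define pol where "pol f = (\<Sum>i<2 * s. monom (f i) i)" for f :: "nat \<Rightarrow> int"
  have coeff_pol: "coeff (pol f) k = (if k < 2 * s then f k else 0)" for f k
    by (simp add: pol_def coeff_sum)
  define val where "val f = poly (of_int_poly (pol f)) c" for f
  have val_bound: "cmod (val f) \<le> D" if "f \<in> P" for f
  proof -
    have val_f: "val f = (\<Sum>i<2 * s. of_int (f i) * c ^ i)"
      by (simp add: val_def pol_def of_int_poly_hom.hom_sum poly_sum poly_monom map_poly_monom)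
    have "cmod (val f) \<le> (\<Sum>i<2 * s. cmod (of_int (f i) * c ^ i))"
      unfolding val_f by (rule norm_sum)
    also have "(\<Sum>i<2 * s. cmod (of_int (f i) * c ^ i)) \<le> (\<Sum>i<2 * s. real H * R ^ (2 * s))"
    proof (rule sum_mono)
      fix i assume i: "i \<in> {..<2 * s}"
      have "f i \<in> {0..int H}" using that i unfolding P_def by (rule PiE_mem)
      hence "0 \<le> f i" "f i \<le> int H" by auto
      hence "\<bar>real_of_int (f i)\<bar> \<le> real H" by linarith
      hence "cmod (of_int (f i)) \<le> real H" by simp
      moreover have "cmod c ^ i \<le> R ^ (2 * s)"
      proof -
        have "cmod c ^ i \<le> R ^ i" by (intro power_mono) (auto simp: R_def)
        also have "\<dots> \<le> R ^ (2 * s)" using i R by (intro power_increasing) auto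
        finally show ?thesis .
      qed
      ultimately show "cmod (of_int (f i) * c ^ i) \<le> real H * R ^ (2 * s)"
        unfolding norm_mult norm_power by (intro mult_mono) auto
    qed
    finally show ?thesis by (simp add: D_def)
  qed
  define cell where "cell x = \<lfloor>(x + D) / (2 * D) * H ^ s\<rfloor>" for x :: real
  have cell_range: "cell x \<in> {0..int (H ^ s)}" if "\<bar>x\<bar> \<le> D" for x
  proof -
    have 1: "0 \<le> (x + D) / (2 * D)" "(x + D) / (2 * D) \<le> 1" using that D by auto
    hence "0 \<le> (x + D) / (2 * D) * real (H ^ s)" by (intro mult_nonneg_nonneg) auto
    moreover have "(x + D) / (2 * D) * real (H ^ s) \<le> 1 * real (H ^ s)" using 1 by (intro mult_right_mono) auto
    ultimately have "0 \<le> cell x" "cell x \<le> \<lfloor>real (H ^ s)\<rfloor>"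
      unfolding cell_def zero_le_floor by (blast, intro floor_mono) linarith
    thus ?thesis by (simp only: floor_of_nat atLeastAtMost_iff)
  qed
  have floor_eq: "\<bar>a - b\<bar> < 1" if "\<lfloor>a\<rfloor> = \<lfloor>b\<rfloor>" for a b :: real
    using that by linarith
  have cell_eq: "\<bar>x - y\<bar> * H ^ s \<le> 2 * D" if "cell x = cell y" for x y
  proof -
    have "\<bar>(x + D) / (2 * D) * H ^ s - (y + D) / (2 * D) * H ^ s\<bar> < 1"
      using that unfolding cell_def by (rule floor_eq)
    also have "(x + D) / (2 * D) * H ^ s - (y + D) / (2 * D) * H ^ s = (x - y) * H ^ s / (2 * D)"
      by (simp add: add_divide_distrib diff_divide_distrib left_diff_distrib distrib_right)
    finally have "\<bar>x - y\<bar> * H ^ s / (2 * D) < 1" using D by (simp add: abs_mult)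
    thus ?thesis using D by (simp add: pos_divide_less_eq)
  qed
  define cells where "cells f = (cell (Re (val f)), cell (Im (val f)))" for f
  have sub: "cells ` P \<subseteq> {0..int (H ^ s)} \<times> {0..int (H ^ s)}"
  proof (rule image_subsetI)
    fix f assume "f \<in> P"
    hence "\<bar>Re (val f)\<bar> \<le> D" "\<bar>Im (val f)\<bar> \<le> D"
      using val_bound abs_Re_le_cmod[of "val f"] abs_Im_le_cmod[of "val f"] by force+
    thus "cells f \<in> {0..int (H ^ s)} \<times> {0..int (H ^ s)}"
      unfolding cells_def using cell_range by blast
  qed
  have cardP: "card P = (H + 1) ^ (2 * s)" by (simp add: P_def card_PiE nat_add_distrib)
  have "card (cells ` P) \<le> (H ^ s + 1) ^ 2"
    using card_mono[OF _ sub]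
    by (simp add: card_cartesian_product power2_eq_square nat_add_distrib nat_power_eq)
  also have "\<dots> < ((H + 1) ^ s) ^ 2"
  proof -
    obtain t where t: "s = Suc t" "t \<ge> 1" using s by (cases s) auto
    \<comment> \<open>The index of a cell ranges over \<open>H\<^sup>s + 1\<close> values, the right border included;
      this is less than \<open>(H + 1)\<^sup>s\<close> only because \<open>s \<ge> 2\<close>.\<close>
    have "H ^ s + 1 \<le> H ^ s + H ^ t" using H by simp
    also have "\<dots> = (H + 1) * H ^ t" by (simp add: t)
    also have "\<dots> < (H + 1) * (H + 1) ^ t" using t by (intro mult_strict_left_mono power_strict_mono) auto
    finally show ?thesis by (intro power_strict_mono) (auto simp: t)
  qed
  finally have "card (cells ` P) < card P" by (simp add: cardP power_mult[symmetric] mult.commute)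
  hence "\<not> inj_on cells P" by (rule pigeonhole)
  then obtain f g where fg: "f \<in> P" "g \<in> P" "f \<noteq> g" "cells f = cells g" by (auto simp: inj_on_def)
  define q where "q = pol f - pol g"
  show ?thesis
  proof (rule that[of q])
    obtain i where i: "i < 2 * s" "f i \<noteq> g i"
      using fg PiE_ext[of f "{..<2 * s}" "\<lambda>_. {0..int H}" g] unfolding P_def by blast
    show "q \<noteq> 0"
    proof
      assume "q = 0"
      hence "coeff q i = 0" by simp
      thus False using i by (simp add: q_def coeff_pol)
    qed
    show "degree q < 2 * s"
    proof -
      have "degree q \<le> 2 * s - 1" by (rule degree_le) (auto simp: q_def coeff_pol)
      thus ?thesis using s by linarith
    qed
    show "\<bar>coeff q k\<bar> \<le> int H" for k
    proof (cases "k < 2 * s")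
      case True
      hence "f k \<in> {0..int H}" "g k \<in> {0..int H}"
        using fg(1,2) PiE_mem[of _ "{..<2 * s}" "\<lambda>_. {0..int H}" k] unfolding P_def by blast+
      thus ?thesis using True by (auto simp: q_def coeff_pol)
    qed (auto simp: q_def coeff_pol)
    have v: "poly (of_int_poly q) c = val f - val g"
      by (simp add: q_def val_def of_int_poly_hom.hom_minus)
    have "cmod (val f - val g) \<le> \<bar>Re (val f) - Re (val g)\<bar> + \<bar>Im (val f) - Im (val g)\<bar>"
      using cmod_le[of "val f - val g"] by simp
    hence "cmod (val f - val g) * H ^ s
        \<le> (\<bar>Re (val f) - Re (val g)\<bar> + \<bar>Im (val f) - Im (val g)\<bar>) * H ^ s"
      by (intro mult_right_mono) auto
    also have "\<dots> \<le> 2 * D + 2 * D"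
    proof -
      have "cell (Re (val f)) = cell (Re (val g))" "cell (Im (val f)) = cell (Im (val g))"
        using fg(4) by (auto simp: cells_def)
      from cell_eq[OF this(1)] cell_eq[OF this(2)] show ?thesis
        unfolding distrib_right by (rule add_mono)
    qed
    finally show "cmod (poly (of_int_poly q) c) * H ^ s \<le> 8 * s * H * (max 1 (cmod c)) ^ (2 * s)"
      by (simp add: v D_def R_def mult_ac)
  qed
qed

text \<open>
  With \<open>s = T + 2\<close> the value is of order \<open>H\<close> to the power \<open>- T - 1\<close> and the root weight is of order
  \<open>H\<close>, so that the product is of order \<open>1 / H\<close> when \<open>s\<close> is fixed and \<open>H\<close> grows.
\<close>

lemma exists_small_value:
  fixes c :: complex
  assumes R: "R \<ge> 0"
  obtains q :: "int poly" where "q \<noteq> 0"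
    "cmod (poly (of_int_poly q) c) * root_weight R (of_int_poly q) ^ T < 1"
proof -
  define s where "s = T + 2"
  define C1 where "C1 = 8 * s * (max 1 (cmod c)) ^ (2 * s)"
  define C2 where "C2 = (R + 1) ^ (2 * s) * (2 * s)"
  have C1: "C1 \<ge> 0" and C2: "C2 \<ge> 0" using R by (auto simp: C1_def C2_def)
  obtain H :: nat where H: "real H > C1 * C2 ^ T" "H \<ge> 1"
    using reals_Archimedean2[of "max 1 (C1 * C2 ^ T)"] by force
  obtain q where q: "q \<noteq> 0" "degree q < 2 * s" "\<And>k. \<bar>coeff q k\<bar> \<le> int H"
    "cmod (poly (of_int_poly q) c) * H ^ s \<le> 8 * s * H * (max 1 (cmod c)) ^ (2 * s)"
    using exists_small_value_pigeonhole[of s H c] H(2) by (auto simp: s_def)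
  let ?q = "of_int_poly q :: complex poly"
  define y where "y = cmod (poly ?q c)"
  have "y * H ^ (T + 1) * H \<le> C1 * H"
    using q(4) by (simp add: y_def C1_def s_def mult_ac)
  hence y: "y * H ^ (T + 1) \<le> C1" using H(2) by (simp add: mult_ac)
  have y0: "y \<ge> 0" by (simp add: y_def)
  have w0: "root_weight R ?q \<ge> 0"
    using root_weight_int_ge[OF q(1) R] R by (meson order_trans zero_le_power)
  have "root_weight R ?q \<le> (R + 1) ^ degree ?q * (\<Sum>k\<le>degree ?q. cmod (coeff ?q k))"
    by (rule root_weight_le) (use q R in auto)
  also have "\<dots> \<le> (R + 1) ^ (2 * s) * (2 * s * H)"
  proof (intro mult_mono)
    show "(R + 1) ^ degree ?q \<le> (R + 1) ^ (2 * s)" using q(2) R by (intro power_increasing) auto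
    have "cmod (coeff ?q k) \<le> real H" for k
    proof -
      have "\<bar>real_of_int (coeff q k)\<bar> \<le> real H" using q(3)[of k] by linarith
      thus ?thesis by simp
    qed
    hence "(\<Sum>k\<le>degree ?q. cmod (coeff ?q k)) \<le> (\<Sum>k\<le>degree ?q. real H)" by (intro sum_mono)
    also have "\<dots> \<le> 2 * s * H"
    proof -
      have "Suc (degree q) * H \<le> (2 * s) * H" using q(2) by (intro mult_right_mono) auto
      hence "real (Suc (degree q) * H) \<le> real (2 * s * H)" by linarith
      thus ?thesis by (simp add: algebra_simps)
    qed
    finally show "(\<Sum>k\<le>degree ?q. cmod (coeff ?q k)) \<le> 2 * s * H" by simp
  qed (use R in \<open>auto intro: sum_nonneg\<close>)
  finally have "root_weight R ?q \<le> C2 * H" by (simp add: C2_def)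
  hence "root_weight R ?q ^ T \<le> (C2 * H) ^ T" using w0 by (intro power_mono)
  hence "y * root_weight R ?q ^ T \<le> y * (C2 * H) ^ T" using y0 by (rule mult_left_mono)
  also have "\<dots> * H = (y * H ^ (T + 1)) * C2 ^ T" by (simp add: power_mult_distrib algebra_simps)
  also have "\<dots> \<le> C1 * C2 ^ T" using y C2 by (intro mult_right_mono) auto
  also have "\<dots> < 1 * real H" using H by simp
  finally have "y * root_weight R ?q ^ T < 1" using H(2) by (simp add: mult_less_cancel_right mult_right_mono)
  thus ?thesis using that q(1) by (simp add: y_def)
qed

text \<open>
  The ideal generated by \<open>p\<close> and \<open>q\<close> need not be principal. Take an element \<open>h\<close> of least degree in it.
  Pseudo-division shows that \<open>h\<close> divides nonzero integer multiples of \<open>p\<close> and of \<open>q\<close>; a prime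
  factor of \<open>h\<close> of positive degree would therefore be equal to both, so \<open>h\<close> is constant.
\<close>

lemma prime_int_poly_bezout:
  fixes p q :: "int poly"
  assumes p: "prime p" and q: "prime q" and "p \<noteq> q"
  obtains u v :: "int poly" and r :: int where "u * p + v * q = [:r:]" "r \<noteq> 0"
proof -
  define I where "I = {h. h \<noteq> 0 \<and> (\<exists>u v. h = u * p + v * q)}"
  have pI: "p \<in> I"
  proof -
    have "p \<noteq> 0" "p = 1 * p + 0 * q" using p by auto
    thus ?thesis unfolding I_def by blast
  qed
  define h where "h = arg_min degree (\<lambda>h. h \<in> I)"
  have h: "h \<in> I" "\<And>g. g \<in> I \<Longrightarrow> degree h \<le> degree g"
    using arg_min_nat_lemma[of "\<lambda>h. h \<in> I" p degree] pI by (auto simp: h_def)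
  obtain u v where uv: "h = u * p + v * q" and h0: "h \<noteq> 0" using h(1) by (auto simp: I_def)
  have dvd: "\<exists>a. a \<noteq> 0 \<and> h dvd Polynomial.smult a f" if f: "\<exists>x y. f = x * p + y * q" for f
  proof -
    obtain s r where sr: "pseudo_divmod f h = (s, r)" by fastforce
    define a where "a = coeff h (degree h) ^ (Suc (degree f) - degree h)"
    have eq: "Polynomial.smult a f = h * s + r" and deg: "r = 0 \<or> degree r < degree h"
      using pseudo_divmod[OF h0 sr] by (auto simp: a_def)
    obtain x y where xy: "f = x * p + y * q" using f by blast
    have "r = Polynomial.smult a f - h * s" using eq by simp
    also have "\<dots> = (Polynomial.smult a x - u * s) * p + (Polynomial.smult a y - v * s) * q"
      unfolding xy uv by (simp add: algebra_simps smult_add_right)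
    finally have "r \<noteq> 0 \<Longrightarrow> r \<in> I" by (auto simp: I_def)
    hence "r = 0" using deg h(2) by force
    thus ?thesis using eq h0 by (intro exI[of _ a]) (auto simp: a_def)
  qed
  have "degree h = 0"
  proof (rule ccontr)
    assume "degree h \<noteq> 0"
    have "\<exists>g. prime g \<and> g dvd x \<and> degree g \<noteq> 0" if "x \<noteq> 0" "degree x \<noteq> 0" for x :: "int poly"
      using that
    proof (induction x rule: prime_divisors_induct)
      case (unit x)
      thus ?case by (auto simp: is_unit_poly_iff)
    next
      case (factor g x)
      show ?case
      proof (cases "degree g = 0")
        case True
        have "x \<noteq> 0" "g \<noteq> 0" using factor by auto
        hence "degree x \<noteq> 0" using factor True by (simp add: degree_mult_eq)
        then obtain g' where "prime g'" "g' dvd x" "degree g' \<noteq> 0" using factor \<open>x \<noteq> 0\<close> by blast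
        thus ?thesis by (intro exI[of _ g']) auto
      next
        case False
        thus ?thesis using factor by auto
      qed
    qed auto
    then obtain g where g: "prime g" "g dvd h" "degree g \<noteq> 0" using h0 \<open>degree h \<noteq> 0\<close> by blast
    have "g = f" if f: "prime f" "\<exists>x y. f = x * p + y * q" for f
    proof -
      obtain a where a: "a \<noteq> 0" "h dvd Polynomial.smult a f" using dvd f(2) by blast
      hence "g dvd [:a:] * f" using g(2) by (auto intro: dvd_trans)
      hence "g dvd [:a:] \<or> g dvd f" using g(1) by (simp add: prime_dvd_mult_iff del: mult_pCons_left)
      moreover have "\<not> g dvd [:a:]" using g(3) a(1) dvd_imp_degree_le[of g "[:a:]"] by auto
      ultimately show ?thesis using primes_dvd_imp_eq g(1) f(1) by blast
    qed
    moreover have "\<exists>x y. p = x * p + y * q" by (rule exI[of _ 1], rule exI[of _ 0]) simp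
    moreover have "\<exists>x y. q = x * p + y * q" by (rule exI[of _ 0], rule exI[of _ 1]) simp
    ultimately have "g = p" "g = q" using p q by blast+
    thus False using assms by simp
  qed
  then obtain r where "h = [:r:]" by (metis degree_eq_zeroE)
  thus ?thesis using that[of u v r] uv h0 by auto
qed

definition good_prime :: "complex \<Rightarrow> real \<Rightarrow> nat \<Rightarrow> int poly \<Rightarrow> bool" where
  "good_prime c R T p \<longleftrightarrow> prime p \<and>
     cmod (poly (of_int_poly p) c) * root_weight R (of_int_poly p) ^ T < 1"

lemma poly_of_int_poly_nonzero:
  assumes "\<not> algebraic c" "p \<noteq> 0"
  shows "poly (of_int_poly p) c \<noteq> (0::complex)"
  using algebraicI[of "of_int_poly p" c] assms by auto

text \<open>
  The absolute value at \<open>c\<close> and the root weight are both multiplicative. If their combination were at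
  least 1 for all primes it would be at least 1 for all nonzero polynomials, contrary to
  \<open>exists_small_value\<close>.
\<close>

lemma exists_good_prime:
  assumes "R \<ge> 1"
  shows "\<exists>p. good_prime c R T p"
proof (rule ccontr)
  assume contra: "\<nexists>p. good_prime c R T p"
  define val where "val p = cmod (poly (of_int_poly p) c) * root_weight R (of_int_poly p) ^ T" for p :: "int poly"
  have const: "val [:a:] \<ge> 1" if "a \<noteq> 0" for a :: int
  proof -
    have "1 \<le> \<bar>a\<bar>" using that by linarith
    hence "1 \<le> cmod (of_int a)" by (simp flip: of_int_abs)
    hence "1 * 1 \<le> cmod (of_int a) * cmod (of_int a) ^ T" by (intro mult_mono one_le_power) auto
    thus ?thesis by (simp add: val_def root_weight_def of_int_poly_const)
  qed
  have "val x \<ge> 1" if "x \<noteq> 0" for x :: "int poly"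
    using that
  proof (induction x rule: prime_divisors_induct)
    case (unit x)
    then obtain a where "x = [:a:]" by (auto simp: is_unit_poly_iff)
    thus ?case using unit const[of a] by auto
  next
    case (factor p x)
    hence "val p \<ge> 1" using contra by (auto simp: good_prime_def val_def not_less)
    moreover have "val x \<ge> 1" using factor by auto
    moreover have "val (p * x) = val p * val x"
      using factor by (simp add: val_def of_int_poly_hom.hom_mult root_weight_mult norm_mult power_mult_distrib)
    ultimately show ?case using mult_mono[of 1 "val p" 1 "val x"] by simp
  qed auto
  moreover obtain q where "q \<noteq> 0" "val q < 1"
    using exists_small_value[of R c T] assms unfolding val_def by force
  ultimately show False by force
qed

lemma good_prime_degree:
  assumes "good_prime c R T p"
  shows "degree p \<noteq> 0"
proof
  assume "degree p = 0"
  then obtain a where a: "p = [:a:]" by (metis degree_eq_zeroE)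
  moreover have "p \<noteq> 0" using assms by (auto simp: good_prime_def)
  ultimately have "1 \<le> \<bar>a\<bar>" by auto
  hence "1 \<le> cmod (of_int a)" by (simp flip: of_int_abs)
  hence "1 * 1 \<le> cmod (of_int a) * cmod (of_int a) ^ T" by (intro mult_mono one_le_power) auto
  thus False using assms a by (simp add: good_prime_def root_weight_def of_int_poly_const)
qed

lemma good_prime_weight:
  assumes "good_prime c R T p" "R \<ge> 1"
  shows "root_weight R (of_int_poly p) \<ge> R"
proof -
  have "p \<noteq> 0" using assms by (auto simp: good_prime_def)
  hence "root_weight R (of_int_poly p) \<ge> R ^ degree p" using root_weight_int_ge assms by force
  moreover have "R ^ degree p \<ge> R ^ 1"
    using good_prime_degree[OF assms(1)] assms by (intro power_increasing) auto
  ultimately show ?thesis by simp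
qed

lemma good_prime_mono:
  assumes "good_prime c R T' p" "T \<le> T'" "R \<ge> 1"
  shows "good_prime c R T p"
proof -
  have "cmod (poly (of_int_poly p) c) * root_weight R (of_int_poly p) ^ T
     \<le> cmod (poly (of_int_poly p) c) * root_weight R (of_int_poly p) ^ T'"
    using good_prime_weight[OF assms(1,3)] assms by (intro mult_left_mono power_increasing) auto
  thus ?thesis using assms by (auto simp: good_prime_def)
qed

text \<open>
  The value \<open>p(c)\<close> is a fixed nonzero number because \<open>c\<close> is transcendental, while the powers of the
  root weight grow.
\<close>

lemma good_prime_eventually_not:
  assumes "\<not> algebraic c" "R > 1" "prime p"
  shows "\<exists>T0. \<forall>T\<ge>T0. \<not> good_prime c R T p"
proof (cases "\<exists>T. good_prime c R T p")
  case True
  hence w: "root_weight R (of_int_poly p) > 1" using good_prime_weight assms by force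
  have pos: "cmod (poly (of_int_poly p) c) > 0" using poly_of_int_poly_nonzero assms by auto
  obtain T0 where T0: "1 / cmod (poly (of_int_poly p) c) < root_weight R (of_int_poly p) ^ T0"
    using real_arch_pow[OF w] by blast
  have "\<not> good_prime c R T0 p" using T0 pos by (auto simp: good_prime_def field_simps)
  thus ?thesis using good_prime_mono assms by (meson less_imp_le)
qed auto

text \<open>
  A prime that is good for a large enough exponent differs from any finitely many given primes.
\<close>

lemma many_good_primes:
  assumes c: "\<not> algebraic c" and R: "R > 1"
  obtains P where "finite P" "card P = m" "\<forall>p\<in>P. good_prime c R T p"
proof -
  have "\<exists>P. finite P \<and> card P = m \<and> (\<forall>p\<in>P. good_prime c R T p)"
  proof (induction m)
    case (Suc m)
    then obtain P where P: "finite P" "card P = m" "\<forall>p\<in>P. good_prime c R T p" by blast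
    have "\<forall>p\<in>P. \<exists>T0. \<forall>T\<ge>T0. \<not> good_prime c R T p"
      using P good_prime_eventually_not[OF c R] by (auto simp: good_prime_def)
    then obtain t where t: "\<forall>p\<in>P. \<forall>T\<ge>t p. \<not> good_prime c R T p" by metis
    define T' where "T' = T + sum t P"
    obtain p where p: "good_prime c R T' p" using exists_good_prime R by (metis less_imp_le)
    have "p \<notin> P"
    proof
      assume "p \<in> P"
      hence "t p \<le> T'" using member_le_sum[of p P t] P by (simp add: T'_def)
      thus False using t p \<open>p \<in> P\<close> by blast
    qed
    moreover have "good_prime c R T p" using good_prime_mono[OF p] R by (simp add: T'_def)
    ultimately show ?case using P by (intro exI[of _ "insert p P"]) auto
  qed auto
  thus ?thesis using that by blast
qed

section \<open>Linear algebra over a finite index set\<close>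


lemma homogeneous_system_nontrivial:
  fixes f :: "'l \<Rightarrow> 'j \<Rightarrow> complex"
  assumes "finite J" "finite L" "card J < card L"
  shows "\<exists>x. (\<exists>l\<in>L. x l \<noteq> 0) \<and> (\<forall>j\<in>J. (\<Sum>l\<in>L. x l * f l j) = 0)"
  using assms
proof (induction J arbitrary: L f rule: finite_induct)
  case empty
  then obtain l where "l \<in> L" by fastforce
  thus ?case by (intro exI[of _ "\<lambda>_. 1"]) auto
next
  case (insert j J)
  show ?case
  proof (cases "\<forall>l\<in>L. f l j = 0")
    case True
    obtain x where "\<exists>l\<in>L. x l \<noteq> 0" "\<forall>j\<in>J. (\<Sum>l\<in>L. x l * f l j) = 0"
      using insert.IH[of L f] insert.prems insert.hyps by auto
    thus ?thesis using True by (intro exI[of _ x]) auto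
  next
    case False
    then obtain l0 where l0: "l0 \<in> L" "f l0 j \<noteq> 0" by blast
    define L' where "L' = L - {l0}"
    have L': "finite L'" "L = insert l0 L'" "l0 \<notin> L'" using insert.prems l0 by (auto simp: L'_def)
    define g where "g l i = f l i - f l j / f l0 j * f l0 i" for l i
    have "card J < card L'" using insert L' by auto
    then obtain x where x: "\<exists>l\<in>L'. x l \<noteq> 0" "\<forall>i\<in>J. (\<Sum>l\<in>L'. x l * g l i) = 0"
      using insert.IH[of L' g] L' by blast
    define t where "t = - (\<Sum>l\<in>L'. x l * f l j) / f l0 j"
    define y where "y = x(l0 := t)"
    have y: "(\<Sum>l\<in>L. y l * f l i) = t * f l0 i + (\<Sum>l\<in>L'. x l * f l i)" for i
    proof -
      have "(\<Sum>l\<in>L'. y l * f l i) = (\<Sum>l\<in>L'. x l * f l i)"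
        using L' by (intro sum.cong) (auto simp: y_def)
      thus ?thesis using L' by (simp add: y_def)
    qed
    have "(\<Sum>l\<in>L. y l * f l i) = 0" if i: "i \<in> insert j J" for i
    proof (cases "i = j")
      case True
      thus ?thesis using l0 by (simp add: y t_def)
    next
      case False
      have "0 = (\<Sum>l\<in>L'. x l * g l i)" using x i False by auto
      also have "\<dots> = (\<Sum>l\<in>L'. x l * f l i) - (\<Sum>l\<in>L'. x l * f l j * (f l0 i / f l0 j))"
        by (simp add: g_def algebra_simps sum_subtractf)
      also have "\<dots> = (\<Sum>l\<in>L'. x l * f l i) + t * f l0 i"
        unfolding sum_distrib_right[symmetric] by (simp add: t_def)
      finally show ?thesis by (simp add: y add.commute)
    qed
    moreover have "\<exists>l\<in>L. y l \<noteq> 0" using x(1) L' by (auto simp: y_def)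
    ultimately show ?thesis by (intro exI[of _ y]) auto
  qed
qed

text \<open>
  Vectors indexed by a finite set \<open>J\<close> are functions on the whole type that vanish outside \<open>J\<close>. This
  allows the index set to be chosen inside a proof, as is needed for the finite models of a group.
\<close>

definition mat_app :: "'j set \<Rightarrow> ('j \<Rightarrow> 'j \<Rightarrow> complex) \<Rightarrow> ('j \<Rightarrow> complex) \<Rightarrow> 'j \<Rightarrow> complex" where
  "mat_app J A u = (\<lambda>i. if i \<in> J then \<Sum>j\<in>J. A i j * u j else 0)"

definition inner_on :: "'j set \<Rightarrow> ('j \<Rightarrow> complex) \<Rightarrow> ('j \<Rightarrow> complex) \<Rightarrow> complex" where
  "inner_on J u v = (\<Sum>i\<in>J. u i * cnj (v i))"

definition norm_on :: "'j set \<Rightarrow> ('j \<Rightarrow> complex) \<Rightarrow> real" where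
  "norm_on J u = L2_set (\<lambda>i. cmod (u i)) J"

definition vecs_on :: "'j set \<Rightarrow> ('j \<Rightarrow> complex) set" where
  "vecs_on J = {u. \<forall>i. i \<notin> J \<longrightarrow> u i = 0}"

definition linear_op :: "(('j \<Rightarrow> complex) \<Rightarrow> 'j \<Rightarrow> complex) \<Rightarrow> bool" where
  "linear_op F \<longleftrightarrow> (\<forall>a b u v. F (\<lambda>i. a * u i + b * v i) = (\<lambda>i. a * F u i + b * F v i))"

definition conj_transpose :: "('j \<Rightarrow> 'j \<Rightarrow> complex) \<Rightarrow> 'j \<Rightarrow> 'j \<Rightarrow> complex" where
  "conj_transpose M i j = cnj (M j i)"

text \<open>
  The matrix \<open>M\<^sup>* M\<close>, whose eigenvalues are the squares of the singular values of \<open>M\<close>.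
\<close>

definition gram :: "'j set \<Rightarrow> ('j \<Rightarrow> 'j \<Rightarrow> complex) \<Rightarrow> 'j \<Rightarrow> 'j \<Rightarrow> complex" where
  "gram J M i j = (\<Sum>k\<in>J. cnj (M k i) * M k j)"

lemma linear_opD: "linear_op F \<Longrightarrow> F (\<lambda>i. a * u i + b * v i) = (\<lambda>i. a * F u i + b * F v i)"
  by (simp add: linear_op_def)

lemma linear_op_zero: "linear_op F \<Longrightarrow> F (\<lambda>i. 0) = (\<lambda>i. 0)"
  using linear_opD[of F 0 "\<lambda>_. 0" 0 "\<lambda>_. 0"] by simp

lemma linear_op_scale: "linear_op F \<Longrightarrow> F (\<lambda>i. a * u i) = (\<lambda>i. a * F u i)"
  using linear_opD[of F a u 0 u] by simp

lemma linear_op_add: "linear_op F \<Longrightarrow> F (\<lambda>i. u i + v i) = (\<lambda>i. F u i + F v i)"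
  using linear_opD[of F 1 u 1 v] by simp

lemma linear_op_sum:
  assumes "linear_op F" "finite L"
  shows "F (\<lambda>i. \<Sum>l\<in>L. x l * w l i) = (\<lambda>i. \<Sum>l\<in>L. x l * F (w l) i)"
  using assms(2)
proof (induction L rule: finite_induct)
  case (insert l L)
  thus ?case using linear_opD[OF assms(1), of "x l" "w l" 1 "\<lambda>i. \<Sum>l\<in>L. x l * w l i"] by simp
qed (simp add: linear_op_zero assms)

lemma linear_op_mat_app: "linear_op (mat_app J A)"
  unfolding linear_op_def mat_app_def
  by (auto simp: fun_eq_iff sum.distrib sum_distrib_left algebra_simps)

lemma mat_app_in_vecs: "mat_app J A u \<in> vecs_on J"
  by (simp add: mat_app_def vecs_on_def)

lemma mat_app_conj_transpose: "finite J \<Longrightarrow> inner_on J (mat_app J A u) v = inner_on J u (mat_app J (conj_transpose A) v)"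
proof -
  have "inner_on J (mat_app J A u) v = (\<Sum>i\<in>J. \<Sum>j\<in>J. A i j * u j * cnj (v i))"
    by (simp add: inner_on_def mat_app_def sum_distrib_right)
  also have "\<dots> = (\<Sum>j\<in>J. \<Sum>i\<in>J. A i j * u j * cnj (v i))" by (rule sum.swap)
  finally show ?thesis by (simp add: inner_on_def mat_app_def sum_distrib_left conj_transpose_def mult_ac)
qed

lemma mat_app_gram:
  "mat_app J (conj_transpose M) (mat_app J M u) = mat_app J (gram J M) u"
proof -
  have "(\<Sum>k\<in>J. cnj (M k i) * (\<Sum>j\<in>J. M k j * u j)) = (\<Sum>j\<in>J. gram J M i j * u j)" for i
  proof -
    have "(\<Sum>k\<in>J. cnj (M k i) * (\<Sum>j\<in>J. M k j * u j)) = (\<Sum>k\<in>J. \<Sum>j\<in>J. cnj (M k i) * M k j * u j)"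
      by (simp add: sum_distrib_left mult_ac)
    also have "\<dots> = (\<Sum>j\<in>J. \<Sum>k\<in>J. cnj (M k i) * M k j * u j)" by (rule sum.swap)
    finally show ?thesis by (simp add: gram_def sum_distrib_right)
  qed
  thus ?thesis by (auto simp: mat_app_def conj_transpose_def fun_eq_iff)
qed

lemma conj_transpose_twice: "conj_transpose (conj_transpose A) = A"
  by (simp add: conj_transpose_def fun_eq_iff)

lemma inner_on_cnj: "cnj (inner_on J u v) = inner_on J v u"
  by (simp add: inner_on_def mult.commute)

lemma inner_on_gram: "finite J \<Longrightarrow> inner_on J (mat_app J (gram J M) u) v = inner_on J (mat_app J M u) (mat_app J M v)"
  using mat_app_conj_transpose[of J "conj_transpose M" "mat_app J M u" v] by (simp add: conj_transpose_twice mat_app_gram)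

lemma inner_on_self: "finite J \<Longrightarrow> inner_on J u u = of_real ((norm_on J u)\<^sup>2)"
  unfolding inner_on_def norm_on_def L2_set_def
  by (simp add: real_sqrt_pow2 sum_nonneg complex_norm_square flip: of_real_power)

lemma inner_on_sum_left: "inner_on J (\<lambda>i. \<Sum>l\<in>L. x l * w l i) v = (\<Sum>l\<in>L. x l * inner_on J (w l) v)"
proof -
  have "inner_on J (\<lambda>i. \<Sum>l\<in>L. x l * w l i) v = (\<Sum>i\<in>J. \<Sum>l\<in>L. x l * w l i * cnj (v i))"
    by (simp add: inner_on_def sum_distrib_right)
  also have "\<dots> = (\<Sum>l\<in>L. \<Sum>i\<in>J. x l * w l i * cnj (v i))" by (rule sum.swap)
  finally show ?thesis by (simp add: inner_on_def sum_distrib_left mult_ac)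
qed

lemma inner_on_scale_left: "inner_on J (\<lambda>i. a * u i) v = a * inner_on J u v"
  by (simp add: inner_on_def sum_distrib_left mult_ac)

lemma inner_on_scale_right: "inner_on J u (\<lambda>i. a * v i) = cnj a * inner_on J u v"
  by (simp add: inner_on_def sum_distrib_left mult_ac)

lemma norm_on_nonneg [simp]: "norm_on J u \<ge> 0"
  by (simp add: norm_on_def)

lemma norm_on_triangle: "norm_on J (\<lambda>i. u i + v i) \<le> norm_on J u + norm_on J v"
proof -
  have "norm_on J (\<lambda>i. u i + v i) \<le> L2_set (\<lambda>i. cmod (u i) + cmod (v i)) J"
    unfolding norm_on_def by (intro L2_set_mono norm_triangle_ineq) auto
  also have "\<dots> \<le> norm_on J u + norm_on J v" unfolding norm_on_def by (rule L2_set_triangle_ineq)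
  finally show ?thesis .
qed

lemma norm_on_scale: "norm_on J (\<lambda>i. a * u i) = cmod a * norm_on J u"
  by (simp add: norm_on_def norm_mult L2_set_right_distrib)

lemma norm_on_zero: "norm_on J (\<lambda>i. 0) = 0"
  by (simp add: norm_on_def L2_set_def)

lemma norm_on_eq_0: "finite J \<Longrightarrow> u \<in> vecs_on J \<Longrightarrow> norm_on J u = 0 \<Longrightarrow> u = (\<lambda>i. 0)"
  by (force simp: norm_on_def vecs_on_def fun_eq_iff L2_set_eq_0_iff)

definition orthonormal :: "'j set \<Rightarrow> nat \<Rightarrow> (nat \<Rightarrow> 'j \<Rightarrow> complex) \<Rightarrow> bool" where
  "orthonormal J n w \<longleftrightarrow> (\<forall>k<n. w k \<in> vecs_on J) \<and> (\<forall>k<n. \<forall>l<n. inner_on J (w k) (w l) = (if k = l then 1 else 0))"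

lemma orthonormal_coeff:
  assumes "orthonormal J n w" "L \<subseteq> {..<n}" "l \<in> {..<n}"
  shows "inner_on J (\<lambda>i. \<Sum>k\<in>L. x k * w k i) (w l) = (if l \<in> L then x l else 0)"
proof -
  have fin: "finite L" using assms(2) finite_subset by blast
  have "inner_on J (\<lambda>i. \<Sum>k\<in>L. x k * w k i) (w l) = (\<Sum>k\<in>L. if k = l then x l else 0)"
    unfolding inner_on_sum_left using assms by (intro sum.cong) (auto simp: orthonormal_def)
  thus ?thesis using fin by simp
qed

lemma orthonormal_inner:
  assumes "orthonormal J n w" "L \<subseteq> {..<n}"
  shows "inner_on J (\<lambda>i. \<Sum>k\<in>L. x k * w k i) (\<lambda>i. \<Sum>k\<in>L. y k * w k i) = (\<Sum>k\<in>L. x k * cnj (y k))"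
proof -
  have "inner_on J (\<lambda>i. \<Sum>k\<in>L. x k * w k i) (\<lambda>i. \<Sum>k\<in>L. y k * w k i)
      = (\<Sum>l\<in>L. x l * inner_on J (w l) (\<lambda>i. \<Sum>k\<in>L. y k * w k i))" by (rule inner_on_sum_left)
  also have "\<dots> = (\<Sum>l\<in>L. x l * cnj (y l))"
  proof (rule sum.cong)
    fix l assume "l \<in> L"
    hence "inner_on J (\<lambda>i. \<Sum>k\<in>L. y k * w k i) (w l) = y l"
      using orthonormal_coeff[OF assms, of l y] assms by auto
    thus "x l * inner_on J (w l) (\<lambda>i. \<Sum>k\<in>L. y k * w k i) = x l * cnj (y l)"
      by (metis inner_on_cnj)
  qed auto
  finally show ?thesis .
qed

lemma orthonormal_norm:
  assumes "finite J" "orthonormal J n w" "L \<subseteq> {..<n}"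
  shows "(norm_on J (\<lambda>i. \<Sum>k\<in>L. x k * w k i))\<^sup>2 = (\<Sum>k\<in>L. (cmod (x k))\<^sup>2)"
proof -
  have "of_real ((norm_on J (\<lambda>i. \<Sum>k\<in>L. x k * w k i))\<^sup>2) = (\<Sum>k\<in>L. x k * cnj (x k))"
    using inner_on_self[OF assms(1)] orthonormal_inner[OF assms(2,3), of x x] by metis
  also have "\<dots> = of_real (\<Sum>k\<in>L. (cmod (x k))\<^sup>2)" by (simp only: complex_norm_square of_real_sum)
  finally show ?thesis using of_real_eq_iff by blast
qed

text \<open>
  Subtract from the unit vector at \<open>i\<close> its expansion in the system. The remainder \<open>r\<close> is orthogonal
  to the system, so a linear relation between the system and \<open>r\<close>, which exists because these are
  more vectors than the dimension, can only be the relation \<open>r = 0\<close>.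
\<close>

lemma orthonormal_complete:
  assumes J: "finite J" and w: "orthonormal J (card J) w" and i: "i \<in> J" and j: "j \<in> J"
  shows "(\<Sum>l<card J. cnj (w l i) * w l j) = (if i = j then 1 else 0)"
proof -
  define N where "N = card J"
  define y where "y k = (\<Sum>l<N. cnj (w l i) * w l k)" for k
  define r where "r k = (if k = i then 1 else 0) - y k" for k
  have r_orth: "inner_on J r (w l) = 0" if l: "l < N" for l
  proof -
    have "inner_on J r (w l) = (\<Sum>k\<in>J. (if k = i then 1 else 0) * cnj (w l k)) - inner_on J y (w l)"
      by (simp add: inner_on_def r_def algebra_simps sum_subtractf)
    also have "(\<Sum>k\<in>J. (if k = i then 1 else 0) * cnj (w l k)) = (\<Sum>k\<in>J. if k = i then cnj (w l k) else 0)"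
      by (intro sum.cong) auto
    also have "\<dots> = cnj (w l i)" using J i by simp
    also have "inner_on J y (w l) = cnj (w l i)"
      unfolding y_def using orthonormal_coeff[of J N w "{..<N}" l "\<lambda>l. cnj (w l i)"] w l by (simp add: N_def)
    finally show ?thesis by simp
  qed
  define f where "f l = (if l < N then w l else r)" for l
  obtain x where x: "\<exists>l\<in>{..N}. x l \<noteq> 0" "\<forall>k\<in>J. (\<Sum>l\<le>N. x l * f l k) = 0"
    using homogeneous_system_nontrivial[of J "{..N}" f] J by (auto simp: N_def)
  have eq: "(\<Sum>l<N. x l * w l k) + x N * r k = 0" if "k \<in> J" for k
  proof -
    have "0 = (\<Sum>l<N. x l * f l k) + x N * f N k" using x that by (simp flip: lessThan_Suc_atMost)
    also have "(\<Sum>l<N. x l * f l k) = (\<Sum>l<N. x l * w l k)" by (intro sum.cong) (auto simp: f_def)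
    finally show ?thesis by (simp add: f_def)
  qed
  have xl: "x l = 0" if l: "l < N" for l
  proof -
    have "0 = inner_on J (\<lambda>k. (\<Sum>l<N. x l * w l k) + x N * r k) (w l)" using eq by (simp add: inner_on_def)
    also have "\<dots> = inner_on J (\<lambda>k. \<Sum>l<N. x l * w l k) (w l) + x N * inner_on J r (w l)"
      by (simp add: inner_on_def sum_distrib_left algebra_simps sum.distrib)
    also have "\<dots> = x l"
      using r_orth[OF l] orthonormal_coeff[of J N w "{..<N}" l x] w l by (simp add: N_def)
    finally show ?thesis by simp
  qed
  have "x N \<noteq> 0"
    using x(1) xl by (metis atMost_iff le_neq_implies_less)
  hence "r j = 0" using eq[OF j] xl by simp
  thus ?thesis by (auto simp: r_def y_def N_def split: if_splits)
qed

text \<open>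
  The vector \<open>p(F) u\<close>, computed by Horner's scheme.
\<close>

definition poly_op :: "(('j \<Rightarrow> complex) \<Rightarrow> 'j \<Rightarrow> complex) \<Rightarrow> complex poly \<Rightarrow> ('j \<Rightarrow> complex) \<Rightarrow> 'j \<Rightarrow> complex" where
  "poly_op F p u = fold_coeffs (\<lambda>a w i. a * u i + F w i) p (\<lambda>_. 0)"

lemma pop_0 [simp]: "poly_op F 0 u = (\<lambda>_. 0)"
  by (simp add: poly_op_def)

lemma poly_op_pCons: "linear_op F \<Longrightarrow> poly_op F (pCons a p) u = (\<lambda>i. a * u i + F (poly_op F p u) i)"
  by (cases "p = 0 \<and> a = 0") (auto simp: poly_op_def linear_op_zero fold_coeffs_def cCons_def)

lemma poly_op_add: "linear_op F \<Longrightarrow> poly_op F (p + q) u = (\<lambda>i. poly_op F p u i + poly_op F q u i)"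
  by (induction p q rule: poly_induct2) (simp_all add: poly_op_pCons linear_op_add algebra_simps)

lemma poly_op_smult: "linear_op F \<Longrightarrow> poly_op F (Polynomial.smult a p) u = (\<lambda>i. a * poly_op F p u i)"
  by (induction p) (simp_all add: poly_op_pCons linear_op_scale algebra_simps)

lemma poly_op_linear_op: "linear_op F \<Longrightarrow> linear_op (poly_op F p)"
proof (induction p)
  case (pCons a p)
  hence "linear_op (poly_op F p)" by simp
  show ?case unfolding linear_op_def
    by (simp add: poly_op_pCons pCons linear_opD[OF \<open>linear_op (poly_op F p)\<close>] linear_opD[OF \<open>linear_op F\<close>] algebra_simps)
qed (simp add: linear_op_def)

lemma poly_op_mult: "linear_op F \<Longrightarrow> poly_op F (p * q) u = poly_op F p (poly_op F q u)"
  by (induction p) (simp_all add: poly_op_pCons poly_op_add poly_op_smult)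

lemma poly_op_const: "linear_op F \<Longrightarrow> poly_op F [:a:] u = (\<lambda>i. a * u i)"
  by (simp add: poly_op_pCons linear_op_zero)

lemma poly_op_linear_factor: "linear_op F \<Longrightarrow> poly_op F [:- r, 1:] u = (\<lambda>i. F u i - r * u i)"
  by (simp add: poly_op_pCons linear_op_zero)

lemma poly_op_monom: "linear_op F \<Longrightarrow> poly_op F (monom a k) u = (\<lambda>i. a * (F ^^ k) u i)"
  by (induction k) (simp_all add: monom_0 monom_Suc poly_op_pCons linear_op_zero linear_op_scale)

lemma poly_op_sum:
  assumes "linear_op F" "finite L"
  shows "poly_op F (\<Sum>l\<in>L. p l) u = (\<lambda>i. \<Sum>l\<in>L. poly_op F (p l) u i)"
  using assms(2) by (induction L rule: finite_induct) (simp_all add: poly_op_add assms)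

lemma poly_op_in_vecs:
  assumes "linear_op F" "\<And>u. u \<in> vecs_on J \<Longrightarrow> F u \<in> vecs_on J" "u \<in> vecs_on J"
  shows "poly_op F p u \<in> vecs_on J"
  by (induction p) (use assms in \<open>auto simp: poly_op_pCons vecs_on_def\<close>)

text \<open>
  The vectors \<open>u, F u, F (F u), \<dots>\<close> are dependent, so \<open>p(F) u = 0\<close> for some \<open>p \<noteq> 0\<close>. Apply the
  linear factors of \<open>p\<close> to \<open>u\<close> one after another; the last nonzero vector is an eigenvector. All
  vectors stay in the invariant set \<open>S\<close>.
\<close>

lemma exists_eigenvector:
  assumes F: "linear_op F" and J: "finite J"
    and S: "\<And>u. u \<in> S \<Longrightarrow> u \<in> vecs_on J" "\<And>u. u \<in> S \<Longrightarrow> F u \<in> S"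
      "\<And>u r. u \<in> S \<Longrightarrow> (\<lambda>i. F u i - r * u i) \<in> S"
    and u: "u \<in> S" "u \<noteq> (\<lambda>i. 0)"
  obtains r w where "w \<in> S" "w \<noteq> (\<lambda>i. 0)" "F w = (\<lambda>i. r * w i)"
proof -
  define N where "N = card J"
  obtain x where x: "\<exists>k\<in>{..N}. x k \<noteq> 0" "\<forall>i\<in>J. (\<Sum>k\<le>N. x k * (F ^^ k) u i) = 0"
    using homogeneous_system_nontrivial[of J "{..N}" "\<lambda>k. (F ^^ k) u"] J by (auto simp: N_def)
  define p where "p = (\<Sum>k\<le>N. monom (x k) k)"
  have pk: "(F ^^ k) u \<in> S" for k by (induction k) (use u S in auto)
  have "poly_op F p u = (\<lambda>i. 0)"
  proof
    fix i
    have "poly_op F p u i = (\<Sum>k\<le>N. x k * (F ^^ k) u i)" by (simp add: p_def poly_op_sum F poly_op_monom)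
    also have "\<dots> = 0"
    proof (cases "i \<in> J")
      case False
      hence "(F ^^ k) u i = 0" for k using pk[of k] S(1) by (auto simp: vecs_on_def)
      thus ?thesis by simp
    qed (use x(2) in auto)
    finally show "poly_op F p u i = 0" .
  qed
  moreover have "p \<noteq> 0"
  proof
    assume "p = 0"
    obtain k where k: "k \<le> N" "x k \<noteq> 0" using x by auto
    have "coeff p k = x k" using k by (simp add: p_def coeff_sum)
    thus False using \<open>p = 0\<close> k by simp
  qed
  ultimately have "\<exists>r w. w \<in> S \<and> w \<noteq> (\<lambda>i. 0) \<and> F w = (\<lambda>i. r * w i)"
    using u
  proof (induction "degree p" arbitrary: p u)
    case 0
    then obtain a where "p = [:a:]" by (metis degree_eq_zeroE)
    thus ?case using 0 by (auto simp: poly_op_const F fun_eq_iff)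
  next
    case (Suc n)
    hence "\<not> constant (poly p)" by (simp add: constant_degree)
    then obtain r where "poly p r = 0" using fundamental_theorem_of_algebra by blast
    then obtain q where q: "p = [:- r, 1:] * q" by (metis dvdE poly_eq_0_iff_dvd)
    define v where "v = (\<lambda>i. F u i - r * u i)"
    have v: "v = poly_op F [:- r, 1:] u" by (simp add: v_def poly_op_linear_factor F)
    show ?case
    proof (cases "v = (\<lambda>i. 0)")
      case True
      hence "F u = (\<lambda>i. r * u i)" by (auto simp: v_def fun_eq_iff)
      thus ?thesis using Suc.prems by blast
    next
      case False
      have "poly_op F q v = (\<lambda>i. 0)"
        unfolding v poly_op_mult[OF F, symmetric] using Suc.prems q by (simp add: mult.commute)
      moreover have "q \<noteq> 0" using q Suc.prems by auto
      moreover have "degree q = n" using q \<open>q \<noteq> 0\<close> Suc(2) by (simp add: degree_mult_eq del: mult_pCons_left)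
      moreover have "v \<in> S" unfolding v_def using S(3) Suc.prems by blast
      ultimately show ?thesis using Suc(1)[of q v] False by blast
    qed
  qed
  thus ?thesis using that by blast
qed

definition hermitian_on :: "'j set \<Rightarrow> ('j \<Rightarrow> 'j \<Rightarrow> complex) \<Rightarrow> bool" where
  "hermitian_on J H \<longleftrightarrow> (\<forall>i\<in>J. \<forall>j\<in>J. H i j = cnj (H j i))"

lemma hermitian_inner:
  assumes "finite J" "hermitian_on J H"
  shows "inner_on J (mat_app J H u) v = inner_on J u (mat_app J H v)"
proof -
  have "conj_transpose H i j = H i j" if "i \<in> J" "j \<in> J" for i j
    using assms(2) that unfolding hermitian_on_def conj_transpose_def by metis
  hence "mat_app J (conj_transpose H) v = mat_app J H v"
    by (simp add: mat_app_def cong: if_cong)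
  thus ?thesis by (simp add: mat_app_conj_transpose assms)
qed

definition eigenbasis :: "'j set \<Rightarrow> ('j \<Rightarrow> 'j \<Rightarrow> complex) \<Rightarrow> (nat \<Rightarrow> 'j \<Rightarrow> complex) \<Rightarrow> (nat \<Rightarrow> real) \<Rightarrow> bool" where
  "eigenbasis J H w \<tau> \<longleftrightarrow> orthonormal J (card J) w \<and>
     (\<forall>l<card J. mat_app J H (w l) = (\<lambda>i. of_real (\<tau> l) * w l i))"

text \<open>
  Eigenvectors are found one at a time in the orthogonal complement of the previous ones. The
  complement is invariant because \<open>H\<close> is Hermitian, and nonzero by counting equations.
\<close>

lemma hermitian_eigenbasis:
  assumes J: "finite J" and H: "hermitian_on J H"
  obtains w \<tau> where "eigenbasis J H w \<tau>"
proof -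
  let ?F = "mat_app J H"
  have "\<exists>w \<tau>. orthonormal J n w \<and> (\<forall>l<n. ?F (w l) = (\<lambda>i. of_real (\<tau> l) * w l i))" if "n \<le> card J" for n
    using that
  proof (induction n)
    case (Suc n)
    then obtain w \<tau> where w: "orthonormal J n w" "\<forall>l<n. ?F (w l) = (\<lambda>i. of_real (\<tau> l) * w l i)"
      by auto
    define S where "S = {u \<in> vecs_on J. \<forall>l<n. inner_on J u (w l) = 0}"
    obtain x where x: "\<exists>i\<in>J. x i \<noteq> 0" "\<forall>l\<in>{..<n}. (\<Sum>i\<in>J. x i * cnj (w l i)) = 0"
      using homogeneous_system_nontrivial[of "{..<n}" J "\<lambda>i l. cnj (w l i)"] Suc.prems J by auto
    define u where "u i = (if i \<in> J then x i else 0)" for i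
    have u: "u \<in> S" "u \<noteq> (\<lambda>i. 0)"
      using x by (auto simp: S_def u_def vecs_on_def inner_on_def fun_eq_iff)
    have S_F: "?F u \<in> S" if "u \<in> S" for u
      unfolding S_def
    proof (safe intro!: mat_app_in_vecs)
      fix l assume l: "l < n"
      have "inner_on J (?F u) (w l) = inner_on J u (\<lambda>i. of_real (\<tau> l) * w l i)"
        using hermitian_inner[OF J H] w l by metis
      also have "\<dots> = 0" using that l by (simp add: S_def inner_on_scale_right)
      finally show "inner_on J (?F u) (w l) = 0" .
    qed
    have S_diff: "(\<lambda>i. ?F u i - r * u i) \<in> S" if "u \<in> S" for u r
    proof -
      have "inner_on J (\<lambda>i. ?F u i - r * u i) v = inner_on J (?F u) v - r * inner_on J u v" for v
        by (simp add: inner_on_def sum_subtractf sum_distrib_left algebra_simps)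
      thus ?thesis using S_F[OF that] that by (auto simp: S_def vecs_on_def)
    qed
    obtain r v where v: "v \<in> S" "v \<noteq> (\<lambda>i. 0)" "?F v = (\<lambda>i. r * v i)"
    proof (rule exists_eigenvector[OF linear_op_mat_app J _ S_F S_diff u])
      show "u \<in> vecs_on J" if "u \<in> S" for u using that by (simp add: S_def)
    qed
    have vJ: "v \<in> vecs_on J" using v by (simp add: S_def)
    have nv: "norm_on J v > 0" using norm_on_eq_0[OF J vJ] v(2) norm_on_nonneg[of J v] by linarith
    have ipv: "inner_on J v v \<noteq> 0" using nv by (simp add: inner_on_self J)
    have "r * inner_on J v v = cnj r * inner_on J v v"
      using hermitian_inner[OF J H, of v v] v(3) by (simp add: inner_on_scale_left inner_on_scale_right)
    hence "r = cnj r" using ipv by simp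
    then obtain t where t: "r = of_real t" by (metis Reals_cnj_iff Reals_cases)
    define v' where "v' = (\<lambda>i. of_real (1 / norm_on J v) * v i)"
    have v'v': "inner_on J v' v' = 1"
    proof -
      have "inner_on J v' v' = of_real (1 / norm_on J v) * of_real (1 / norm_on J v) * inner_on J v v"
        unfolding v'_def inner_on_scale_left inner_on_scale_right by simp
      also have "\<dots> = of_real (1 / norm_on J v * (1 / norm_on J v) * (norm_on J v)\<^sup>2)"
        unfolding inner_on_self[OF J] of_real_mult ..
      also have "1 / norm_on J v * (1 / norm_on J v) * (norm_on J v)\<^sup>2 = 1" using nv by (simp add: power2_eq_square)
      finally show ?thesis by simp
    qed
    have v'w: "inner_on J v' (w l) = 0" if "l < n" for l
      using v that unfolding v'_def inner_on_scale_left by (simp add: S_def)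
    hence wv': "inner_on J (w l) v' = 0" if "l < n" for l using that by (metis inner_on_cnj complex_cnj_zero)
    have v'J: "v' \<in> vecs_on J" using vJ by (simp add: v'_def vecs_on_def)
    have "orthonormal J (Suc n) (w(n := v'))"
      using w(1) v'v' v'w wv' v'J unfolding orthonormal_def by (auto simp: less_Suc_eq)
    moreover have "?F v' = (\<lambda>i. of_real t * v' i)"
      unfolding v'_def linear_op_scale[OF linear_op_mat_app] v(3) t by (simp only: mult_ac)
    hence "\<forall>l<Suc n. ?F ((w(n := v')) l) = (\<lambda>i. of_real ((\<tau>(n := t)) l) * (w(n := v')) l i)"
      using w(2) by (auto simp: less_Suc_eq)
    ultimately show ?case by blast
  qed (auto simp: orthonormal_def)
  from this[OF order.refl] show ?thesis using that unfolding eigenbasis_def by blast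
qed

text \<open>
  This is where integrality enters: up to sign the product is the lowest nonzero coefficient of the
  characteristic polynomial, hence a nonzero integer.
\<close>

lemma integer_hermitian_eigenvalue_product:
  assumes J: "finite J" and eb: "eigenbasis J H w \<tau>" and int: "\<And>i j. i \<in> J \<Longrightarrow> j \<in> J \<Longrightarrow> H i j \<in> \<int>"
  shows "(\<Prod>l | l < card J \<and> \<tau> l \<noteq> 0. \<bar>\<tau> l\<bar>) \<ge> 1"
proof -
  define N where "N = card J"
  obtain h where h: "bij_betw h {..<N} J" using ex_bij_betw_nat_finite[OF J] by (auto simp: N_def atLeast0LessThan)
  have hJ: "h a \<in> J" if "a < N" for a using h that by (auto simp: bij_betw_def)
  define M where "M = mat N N (\<lambda>(a, b). H (h a) (h b))"
  define W where "W = mat N N (\<lambda>(a, l). w l (h a))"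
  define V where "V = mat N N (\<lambda>(l, a). cnj (w l (h a)))"
  define D where "D = mat N N (\<lambda>(k, l). if k = l then complex_of_real (\<tau> l) else 0)"
  have carr: "M \<in> carrier_mat N N" "W \<in> carrier_mat N N" "V \<in> carrier_mat N N" "D \<in> carrier_mat N N"
    by (auto simp: M_def W_def V_def D_def)
  have on: "orthonormal J N w" using eb by (simp add: eigenbasis_def N_def)
  have reindex: "(\<Sum>a\<in>{0..<N}. f (h a)) = (\<Sum>i\<in>J. f i)" for f :: "'a \<Rightarrow> complex"
    using sum.reindex_bij_betw[OF h, of f] by (simp add: atLeast0LessThan)
  have VW: "V * W = 1\<^sub>m N"
  proof (rule eq_matI)
    fix k l assume kl: "k < dim_row (1\<^sub>m N)" "l < dim_col (1\<^sub>m N)"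
    have "(V * W) $$ (k, l) = (\<Sum>a\<in>{0..<N}. cnj (w k (h a)) * w l (h a))"
      using kl by (simp add: V_def W_def scalar_prod_def)
    also have "\<dots> = inner_on J (w l) (w k)"
      unfolding inner_on_def using reindex[of "\<lambda>i. cnj (w k i) * w l i"] by (simp add: mult.commute)
    also have "\<dots> = 1\<^sub>m N $$ (k, l)" using on kl by (auto simp: orthonormal_def)
    finally show "(V * W) $$ (k, l) = 1\<^sub>m N $$ (k, l)" .
  qed (use carr in auto)
  have WV: "W * V = 1\<^sub>m N" using mat_mult_left_right_inverse[OF carr(3) carr(2) VW] .
  have MW: "M * W = W * D"
  proof (rule eq_matI)
    fix a l assume al: "a < dim_row (W * D)" "l < dim_col (W * D)"
    hence al: "a < N" "l < N" using carr by auto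
    have "(M * W) $$ (a, l) = (\<Sum>b\<in>{0..<N}. H (h a) (h b) * w l (h b))"
      using al by (simp add: M_def W_def scalar_prod_def)
    also have "\<dots> = mat_app J H (w l) (h a)"
      using hJ al reindex[of "\<lambda>j. H (h a) j * w l j"] by (simp add: mat_app_def)
    also have "\<dots> = of_real (\<tau> l) * w l (h a)" using eb al by (simp add: eigenbasis_def N_def)
    also have "\<dots> = (\<Sum>k\<in>{0..<N}. if k = l then w l (h a) * of_real (\<tau> l) else 0)"
      using al by simp
    also have "\<dots> = (\<Sum>k\<in>{0..<N}. w k (h a) * (if k = l then of_real (\<tau> l) else 0))"
      by (intro sum.cong) auto
    also have "\<dots> = (W * D) $$ (a, l)"
      using al by (simp add: W_def D_def scalar_prod_def)
    finally show "(M * W) $$ (a, l) = (W * D) $$ (a, l)" .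
  qed (use carr in auto)
  have "M = M * (W * V)" using carr WV by simp
  also have "\<dots> = W * D * V" using carr MW by (metis assoc_mult_mat)
  finally have "similar_mat M D"
    unfolding similar_mat_def similar_mat_wit_def Let_def
    using carr VW WV by (intro exI[of _ W] exI[of _ V]) auto
  hence cp: "char_poly M = char_poly D" by (rule char_poly_similar)
  have "upper_triangular D" unfolding D_def by auto
  hence "char_poly D = (\<Prod>a\<leftarrow>diag_mat D. [:- a, 1:])" using char_poly_upper_triangular carr by blast
  also have "\<dots> = (\<Prod>l\<leftarrow>[0..<N]. [:- of_real (\<tau> l), 1:])"
    unfolding diag_mat_def map_map using carr
    by (intro arg_cong[where f = prod_list] map_cong) (auto simp: D_def)
  also have "\<dots> = (\<Prod>l<N. [:- of_real (\<tau> l), 1:])"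
    by (simp add: prod.list_conv_set_nth atLeast0LessThan)
  also have "\<dots> = (\<Prod>l | l < N \<and> \<tau> l = 0. [:- of_real (\<tau> l), 1:]) * (\<Prod>l | l < N \<and> \<tau> l \<noteq> 0. [:- of_real (\<tau> l), 1:])"
    by (subst prod.union_disjoint[symmetric]) (auto intro!: prod.cong)
  also have "(\<Prod>l | l < N \<and> \<tau> l = 0. [:- of_real (\<tau> l), 1:]) = monom (1::complex) (card {l. l < N \<and> \<tau> l = 0})"
    by (simp add: monom_altdef)
  finally have chi: "char_poly M = monom 1 (card {l. l < N \<and> \<tau> l = 0}) * (\<Prod>l | l < N \<and> \<tau> l \<noteq> 0. [:- of_real (\<tau> l), 1:])"
    using cp by simp
  define k where "k = card {l. l < N \<and> \<tau> l = 0}"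
  have "coeff (char_poly M) k = poly (\<Prod>l | l < N \<and> \<tau> l \<noteq> 0. [:- of_real (\<tau> l), 1:]) 0"
    unfolding chi k_def[symmetric] by (simp add: coeff_monom_mult poly_0_coeff_0)
  also have "\<dots> = (\<Prod>l | l < N \<and> \<tau> l \<noteq> 0. - of_real (\<tau> l))" by (simp add: poly_prod)
  finally have norm_eq: "cmod (coeff (char_poly M) k) = (\<Prod>l | l < N \<and> \<tau> l \<noteq> 0. \<bar>\<tau> l\<bar>)"
    by (simp add: prod_norm[symmetric])
  define M' where "M' = mat N N (\<lambda>(a, b). (\<lfloor>Re (H (h a) (h b))\<rfloor> :: int))"
  have "of_int \<lfloor>Re z\<rfloor> = z" if "z \<in> \<int>" for z :: complex
    using that by (auto elim!: Ints_cases)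
  hence "M = map_mat of_int M'"
    using int hJ by (intro eq_matI) (auto simp: M_def M'_def)
  hence "char_poly M = of_int_poly (char_poly M')"
    using of_int_hom.char_poly_hom[of M' N] by (simp add: M'_def)
  hence "coeff (char_poly M) k = of_int (coeff (char_poly M') k)" by simp
  moreover have "cmod (coeff (char_poly M) k) \<noteq> 0" unfolding norm_eq by auto
  ultimately have "cmod (coeff (char_poly M) k) \<ge> 1"
    by (simp flip: of_int_abs)
  thus ?thesis using norm_eq by (simp add: N_def)
qed

section \<open>Singular values of integer matrices near a transcendental number\<close>


definition bounded_op :: "'j set \<Rightarrow> real \<Rightarrow> (('j \<Rightarrow> complex) \<Rightarrow> 'j \<Rightarrow> complex) \<Rightarrow> bool" where
  "bounded_op J K F \<longleftrightarrow> linear_op F \<and> (\<forall>u. norm_on J (F u) \<le> K * norm_on J u)"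

lemma poly_op_bounded:
  assumes "K \<ge> 0"
  shows "\<exists>C\<ge>0. \<forall>(J::'j set) F. bounded_op J K F \<longrightarrow> (\<forall>u. norm_on J (poly_op F p u) \<le> C * norm_on J u)"
proof (induction p)
  case 0
  show ?case by (intro exI[of _ 0]) (auto simp: norm_on_zero)
next
  case (pCons a p)
  then obtain C where C: "C \<ge> 0"
    "\<And>(J::'j set) F u. bounded_op J K F \<Longrightarrow> norm_on J (poly_op F p u) \<le> C * norm_on J u" by blast
  have "norm_on J (poly_op F (pCons a p) u) \<le> (cmod a + K * C) * norm_on J u"
    if F: "bounded_op J K F" for J :: "'j set" and F u
  proof -
    have linear_op: "linear_op F" using F by (simp add: bounded_op_def)
    have "norm_on J (poly_op F (pCons a p) u) \<le> norm_on J (\<lambda>i. a * u i) + norm_on J (F (poly_op F p u))"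
      unfolding poly_op_pCons[OF linear_op] by (rule norm_on_triangle)
    also have "\<dots> \<le> cmod a * norm_on J u + K * norm_on J (poly_op F p u)"
      using F by (simp add: norm_on_scale bounded_op_def)
    also have "\<dots> \<le> cmod a * norm_on J u + K * (C * norm_on J u)"
      using C(2)[OF F] assms by (intro add_left_mono mult_left_mono)
    finally show ?thesis by (simp add: algebra_simps)
  qed
  moreover have "cmod a + K * C \<ge> 0" using assms C by simp
  ultimately show ?case by blast
qed

text \<open>
  A linear factor \<open>F - r\<close> has norm at most \<open>K + |r|\<close>.
\<close>

lemma poly_op_le_root_weight:
  assumes F: "bounded_op J K F" and K: "K \<ge> 0"
  shows "norm_on J (poly_op F p u) \<le> root_weight K p * norm_on J u"
proof -
  have linear_op: "linear_op F" using F by (simp add: bounded_op_def)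
  have "norm_on J (poly_op F (\<Prod>r\<in>#M. [:- r, 1:]) u) \<le> (\<Prod>r\<in>#M. K + cmod r) * norm_on J u" for M u
  proof (induction M arbitrary: u)
    case empty
    show ?case using poly_op_const[OF linear_op, of 1 u] by (simp add: one_pCons)
  next
    case (add r M)
    define v where "v = poly_op F (\<Prod>r\<in>#M. [:- r, 1:]) u"
    have eq: "poly_op F (\<Prod>r\<in>#add_mset r M. [:- r, 1:]) u = (\<lambda>i. F v i + (- r) * v i)"
      using poly_op_mult[OF linear_op, of "[:- r, 1:]" "\<Prod>r\<in>#M. [:- r, 1:]" u] poly_op_linear_factor[OF linear_op, of r v]
      by (simp add: v_def del: mult_pCons_left)
    have "norm_on J (poly_op F (\<Prod>r\<in>#add_mset r M. [:- r, 1:]) u) \<le> norm_on J (F v) + norm_on J (\<lambda>i. (- r) * v i)"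
      unfolding eq by (rule norm_on_triangle)
    also have "\<dots> \<le> K * norm_on J v + cmod r * norm_on J v"
      unfolding norm_on_scale using F by (simp add: bounded_op_def)
    also have "\<dots> = (K + cmod r) * norm_on J v" by (simp add: algebra_simps)
    also have "\<dots> \<le> (K + cmod r) * ((\<Prod>r\<in>#M. K + cmod r) * norm_on J u)"
      unfolding v_def using K by (intro mult_left_mono add) auto
    finally show ?case by (simp add: mult.assoc)
  qed
  hence "cmod (lead_coeff p) * norm_on J (poly_op F (\<Prod>r\<in>#proots p. [:- r, 1:]) u)
      \<le> cmod (lead_coeff p) * ((\<Prod>r\<in>#proots p. K + cmod r) * norm_on J u)"
    by (intro mult_left_mono) auto
  moreover have "poly_op F p u = (\<lambda>i. lead_coeff p * poly_op F (\<Prod>r\<in>#proots p. [:- r, 1:]) u i)"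
    by (subst complex_poly_decompose_multiset[of p, symmetric]) (simp only: poly_op_smult[OF linear_op])
  ultimately show ?thesis by (simp add: root_weight_def norm_on_scale mult.assoc)
qed

text \<open>
  Division with remainder gives \<open>p(F) = p(c) + q(F) (F - c)\<close>, so near an eigenvector for \<open>c\<close> the
  operator \<open>p(F)\<close> is close to the scalar \<open>p(c)\<close>. The constant is uniform in \<open>J\<close> and \<open>F\<close>, as it must
  be for matrices of unbounded size.
\<close>

lemma poly_op_value_bound:
  assumes "K \<ge> 0"
  shows "\<exists>C\<ge>0. \<forall>(J::'j set) F. bounded_op J K F \<longrightarrow>
    (\<forall>u. norm_on J (poly_op F p u) \<le> cmod (poly p c) * norm_on J u + C * norm_on J (\<lambda>i. F u i - c * u i))"
proof -
  define q where "q = synthetic_div p c"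
  obtain C where C: "C \<ge> 0" "\<And>(J::'j set) F u. bounded_op J K F \<Longrightarrow> norm_on J (poly_op F q u) \<le> C * norm_on J u"
    using poly_op_bounded[OF assms] by blast
  have "norm_on J (poly_op F p u) \<le> cmod (poly p c) * norm_on J u + C * norm_on J (\<lambda>i. F u i - c * u i)"
    if F: "bounded_op J K F" for J :: "'j set" and F u
  proof -
    have linear_op: "linear_op F" using F by (simp add: bounded_op_def)
    have "p = [:poly p c:] + q * [:- c, 1:]"
      using synthetic_div_correct'[of c p] by (simp add: q_def mult.commute add.commute)
    hence "poly_op F p u = poly_op F ([:poly p c:] + q * [:- c, 1:]) u" by (rule arg_cong)
    also have "\<dots> = (\<lambda>i. poly p c * u i + poly_op F q (\<lambda>i. F u i - c * u i) i)"
      unfolding poly_op_add[OF linear_op] poly_op_mult[OF linear_op] poly_op_const[OF linear_op] poly_op_linear_factor[OF linear_op] ..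
    finally have eq: "poly_op F p u = (\<lambda>i. poly p c * u i + poly_op F q (\<lambda>i. F u i - c * u i) i)" .
    have "norm_on J (poly_op F p u) \<le> norm_on J (\<lambda>i. poly p c * u i) + norm_on J (poly_op F q (\<lambda>i. F u i - c * u i))"
      unfolding eq by (rule norm_on_triangle)
    also have "\<dots> \<le> cmod (poly p c) * norm_on J u + C * norm_on J (\<lambda>i. F u i - c * u i)"
      using C(2)[OF F] by (simp add: norm_on_scale)
    finally show ?thesis .
  qed
  thus ?thesis using C(1) by blast
qed

definition poly_op_matrix :: "(('j \<Rightarrow> complex) \<Rightarrow> 'j \<Rightarrow> complex) \<Rightarrow> complex poly \<Rightarrow> 'j \<Rightarrow> 'j \<Rightarrow> complex" where
  "poly_op_matrix F p i j = poly_op F p (\<lambda>k. if k = j then 1 else 0) i"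

lemma unit_expansion:
  assumes "finite J" "u \<in> vecs_on J"
  shows "u = (\<lambda>i. \<Sum>j\<in>J. u j * (if i = j then 1 else 0))"
proof
  fix i
  have "(\<Sum>j\<in>J. u j * (if i = j then 1 else 0)) = (\<Sum>j\<in>J. if i = j then u i else 0)"
    by (intro sum.cong) auto
  thus "u i = (\<Sum>j\<in>J. u j * (if i = j then 1 else 0))" using assms by (auto simp: vecs_on_def)
qed

lemma poly_op_matrix_app:
  assumes J: "finite J" and F: "linear_op F" "\<And>u. F u \<in> vecs_on J" and u: "u \<in> vecs_on J"
  shows "mat_app J (poly_op_matrix F p) u = poly_op F p u"
proof -
  have "poly_op F p u = poly_op F p (\<lambda>i. \<Sum>j\<in>J. u j * (if i = j then 1 else 0))"
    using unit_expansion[OF J u] by (rule arg_cong)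
  also have "\<dots> = (\<lambda>i. \<Sum>j\<in>J. u j * poly_op_matrix F p i j)"
    unfolding poly_op_matrix_def by (rule linear_op_sum[OF poly_op_linear_op[OF F(1)] J])
  finally have eq: "poly_op F p u = (\<lambda>i. \<Sum>j\<in>J. u j * poly_op_matrix F p i j)" .
  have "poly_op F p u \<in> vecs_on J" using F u by (intro poly_op_in_vecs) auto
  thus ?thesis using eq by (auto simp: mat_app_def vecs_on_def fun_eq_iff mult.commute)
qed

lemma poly_op_matrix_int:
  assumes J: "finite J" and A: "\<And>i j. i \<in> J \<Longrightarrow> j \<in> J \<Longrightarrow> A i j \<in> \<int>"
  shows "poly_op_matrix (mat_app J A) (of_int_poly p) i j \<in> \<int>"
proof -
  have "poly_op (mat_app J A) (of_int_poly p) u i \<in> \<int>" if u: "\<And>i. u i \<in> \<int>" for u i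
  proof (induction p arbitrary: i)
    case (pCons a p)
    have "mat_app J A v i \<in> \<int>" if "\<And>i. v i \<in> \<int>" for v i
      unfolding mat_app_def using A that by auto
    hence "mat_app J A (poly_op (mat_app J A) (of_int_poly p) u) i \<in> \<int>" using pCons by blast
    moreover have "of_int_poly (pCons a p) = pCons (of_int a :: complex) (of_int_poly p)"
      by (rule poly_eqI) (auto simp: coeff_map_poly coeff_pCons split: nat.splits)
    ultimately show ?case using u by (simp add: poly_op_pCons[OF linear_op_mat_app])
  qed auto
  thus ?thesis unfolding poly_op_matrix_def by simp
qed

lemma hermitian_gram: "hermitian_on J (gram J M)"
  by (simp add: hermitian_on_def gram_def mult.commute)

lemma eigenbasis_gram_norm:
  assumes J: "finite J" and eb: "eigenbasis J (gram J M) w \<tau>" and L: "L \<subseteq> {..<card J}"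
  shows "(norm_on J (mat_app J M (\<lambda>i. \<Sum>l\<in>L. x l * w l i)))\<^sup>2 = (\<Sum>l\<in>L. (cmod (x l))\<^sup>2 * \<tau> l)"
proof -
  define v where "v = (\<lambda>i. \<Sum>l\<in>L. x l * w l i)"
  have fin: "finite L" using L finite_subset by blast
  have on: "orthonormal J (card J) w" using eb by (simp add: eigenbasis_def)
  have "mat_app J (gram J M) v = (\<lambda>i. \<Sum>l\<in>L. x l * mat_app J (gram J M) (w l) i)"
    unfolding v_def by (rule linear_op_sum[OF linear_op_mat_app fin])
  also have "\<dots> = (\<lambda>i. \<Sum>l\<in>L. (x l * of_real (\<tau> l)) * w l i)"
    using eb L by (intro ext sum.cong) (auto simp: eigenbasis_def)
  finally have Gv: "mat_app J (gram J M) v = (\<lambda>i. \<Sum>l\<in>L. (x l * of_real (\<tau> l)) * w l i)" .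
  have "of_real ((norm_on J (mat_app J M v))\<^sup>2) = inner_on J (mat_app J (gram J M) v) v"
    unfolding inner_on_gram[OF J] inner_on_self[OF J] ..
  also have "\<dots> = (\<Sum>l\<in>L. x l * of_real (\<tau> l) * cnj (x l))"
    unfolding Gv unfolding v_def by (rule orthonormal_inner[OF on L])
  also have "\<dots> = (\<Sum>l\<in>L. of_real ((cmod (x l))\<^sup>2 * \<tau> l))"
    by (intro sum.cong refl) (simp only: of_real_mult complex_norm_square mult_ac)
  also have "\<dots> = of_real (\<Sum>l\<in>L. (cmod (x l))\<^sup>2 * \<tau> l)" by simp
  finally show ?thesis unfolding v_def of_real_eq_iff .
qed

lemma eigenbasis_gram_eigenvalue:
  assumes J: "finite J" and eb: "eigenbasis J (gram J M) w \<tau>" and l: "l < card J"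
  shows "\<tau> l = (norm_on J (mat_app J M (w l)))\<^sup>2" "norm_on J (w l) = 1"
proof -
  show "\<tau> l = (norm_on J (mat_app J M (w l)))\<^sup>2"
    using eigenbasis_gram_norm[OF J eb, of "{l}" "\<lambda>_. 1"] l by simp
  have "orthonormal J (card J) w" using eb by (simp add: eigenbasis_def)
  hence "(norm_on J (w l))\<^sup>2 = 1" using orthonormal_norm[OF J, of _ w "{l}" "\<lambda>_. 1"] l by simp
  thus "norm_on J (w l) = 1" using norm_on_nonneg[of J "w l"] by (simp add: power2_eq_1_iff)
qed

text \<open>
  The span of the eigenvectors of \<open>M\<^sup>* M\<close> for eigenvalues at most \<open>\<epsilon>\<close> and the span of those of
  \<open>N\<^sup>* N\<close> for eigenvalues above \<open>\<theta>\<close> meet only in 0: on a common vector \<open>N\<close> would be both small and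
  large. Hence their dimensions add up to at most the dimension of the whole space.
\<close>

lemma count_small_eigenvalues:
  assumes J: "finite J" and W: "eigenbasis J (gram J M) w \<tau>" and B: "eigenbasis J (gram J N) b \<beta>"
    and small: "\<And>v. v \<in> vecs_on J \<Longrightarrow> (norm_on J (mat_app J M v))\<^sup>2 \<le> \<epsilon> * (norm_on J v)\<^sup>2 \<Longrightarrow>
        (norm_on J (mat_app J N v))\<^sup>2 \<le> \<theta> * (norm_on J v)\<^sup>2"
  shows "card {l. l < card J \<and> \<tau> l \<le> \<epsilon>} \<le> card {l. l < card J \<and> \<beta> l \<le> \<theta>}"
proof (rule ccontr)
  assume contra: "\<not> ?thesis"
  define n where "n = card J"
  define S where "S = {l. l < n \<and> \<tau> l \<le> \<epsilon>}"
  define T where "T = {l. l < n \<and> \<beta> l > \<theta>}"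
  have sub: "S \<subseteq> {..<n}" "T \<subseteq> {..<n}" by (auto simp: S_def T_def)
  have fin: "finite S" "finite T" by (auto simp: S_def T_def)
  have on: "orthonormal J n w" "orthonormal J n b" using W B by (auto simp: eigenbasis_def n_def)
  have "card T + card {l. l < n \<and> \<beta> l \<le> \<theta>} = card (T \<union> {l. l < n \<and> \<beta> l \<le> \<theta>})"
    by (rule card_Un_disjoint[symmetric]) (auto simp: T_def)
  also have "T \<union> {l. l < n \<and> \<beta> l \<le> \<theta>} = {..<n}" by (auto simp: T_def)
  finally have "card J < card (S <+> T)"
    using contra fin by (simp add: card_Plus n_def S_def)
  then obtain x where x: "\<exists>l\<in>S <+> T. x l \<noteq> 0"
    "\<forall>i\<in>J. (\<Sum>l\<in>S <+> T. x l * (case l of Inl k \<Rightarrow> w k | Inr k \<Rightarrow> b k) i) = 0"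
    using homogeneous_system_nontrivial[of J "S <+> T" "\<lambda>l. case l of Inl k \<Rightarrow> w k | Inr k \<Rightarrow> b k"] J fin
    by auto
  define v where "v = (\<lambda>i. \<Sum>l\<in>S. x (Inl l) * w l i)"
  have v_vecs: "v \<in> vecs_on J" using on(1) sub by (auto simp: v_def vecs_on_def orthonormal_def subset_iff intro!: sum.neutral)
  have v_b: "v = (\<lambda>i. \<Sum>l\<in>T. - x (Inr l) * b l i)"
  proof
    fix i
    show "v i = (\<Sum>l\<in>T. - x (Inr l) * b l i)"
    proof (cases "i \<in> J")
      case True
      hence "0 = (\<Sum>l\<in>S <+> T. x l * (case l of Inl k \<Rightarrow> w k | Inr k \<Rightarrow> b k) i)" using x by auto
      also have "\<dots> = v i + (\<Sum>l\<in>T. x (Inr l) * b l i)"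
        using fin by (simp add: sum.Plus v_def)
      finally show ?thesis by (simp add: sum_negf eq_neg_iff_add_eq_0)
    next
      case False
      thus ?thesis using v_vecs on(2) sub
        by (auto simp: vecs_on_def orthonormal_def subset_iff intro!: sum.neutral[symmetric])
    qed
  qed
  have nv: "(norm_on J v)\<^sup>2 = (\<Sum>l\<in>S. (cmod (x (Inl l)))\<^sup>2)" "(norm_on J v)\<^sup>2 = (\<Sum>l\<in>T. (cmod (x (Inr l)))\<^sup>2)"
    unfolding v_def by (rule orthonormal_norm[OF J on(1) sub(1)])
      (use orthonormal_norm[OF J on(2) sub(2), of "\<lambda>l. - x (Inr l)"] in
        \<open>simp only: v_b[symmetric] v_def[symmetric] norm_minus_cancel\<close>)
  have "(norm_on J (mat_app J M v))\<^sup>2 = (\<Sum>l\<in>S. (cmod (x (Inl l)))\<^sup>2 * \<tau> l)"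
    unfolding v_def using eigenbasis_gram_norm[OF J W] sub by (simp add: n_def)
  also have "\<dots> \<le> (\<Sum>l\<in>S. (cmod (x (Inl l)))\<^sup>2 * \<epsilon>)"
    by (intro sum_mono mult_left_mono) (auto simp: S_def)
  finally have "(norm_on J (mat_app J M v))\<^sup>2 \<le> \<epsilon> * (norm_on J v)\<^sup>2"
    by (simp add: nv(1) sum_distrib_left mult.commute)
  hence le: "(norm_on J (mat_app J N v))\<^sup>2 \<le> \<theta> * (norm_on J v)\<^sup>2" using small v_vecs by blast
  have eq: "(norm_on J (mat_app J N v))\<^sup>2 = (\<Sum>l\<in>T. (cmod (x (Inr l)))\<^sup>2 * \<beta> l)"
    unfolding v_b using eigenbasis_gram_norm[OF J B, of T "\<lambda>l. - x (Inr l)"] sub by (simp add: n_def)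
  have "\<exists>l\<in>T. x (Inr l) \<noteq> 0"
  proof (rule ccontr)
    assume "\<not> (\<exists>l\<in>T. x (Inr l) \<noteq> 0)"
    hence "(\<Sum>l\<in>S. (cmod (x (Inl l)))\<^sup>2) = 0" using nv by simp
    hence "\<forall>l\<in>S. x (Inl l) = 0" using fin by (simp add: sum_nonneg_eq_0_iff)
    thus False using x(1) \<open>\<not> (\<exists>l\<in>T. x (Inr l) \<noteq> 0)\<close> by auto
  qed
  then obtain l0 where l0: "l0 \<in> T" "x (Inr l0) \<noteq> 0" by blast
  have "(\<Sum>l\<in>T. (cmod (x (Inr l)))\<^sup>2 * \<theta>) < (\<Sum>l\<in>T. (cmod (x (Inr l)))\<^sup>2 * \<beta> l)"
  proof (rule sum_strict_mono_ex1)
    show "\<forall>l\<in>T. (cmod (x (Inr l)))\<^sup>2 * \<theta> \<le> (cmod (x (Inr l)))\<^sup>2 * \<beta> l"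
      by (auto simp: T_def intro!: mult_left_mono)
    show "\<exists>l\<in>T. (cmod (x (Inr l)))\<^sup>2 * \<theta> < (cmod (x (Inr l)))\<^sup>2 * \<beta> l"
      using l0 by (intro bexI[of _ l0] mult_strict_left_mono) (auto simp: T_def)
  qed (use fin in auto)
  thus False using le eq nv(2) by (simp add: sum_distrib_left mult.commute)
qed

text \<open>
  If \<open>p(F)\<close> and \<open>q(F)\<close> both kill a vector, then so does the nonzero integer in the ideal of \<open>p\<close> and
  \<open>q\<close>. The factors \<open>q(F)\<close> are removed one at a time.
\<close>

lemma poly_op_kernels_independent:
  assumes F: "linear_op F" and p: "prime p" and P: "finite P" "\<forall>q\<in>P. prime q" "p \<notin> P"
    and z: "poly_op F (of_int_poly p) z = (\<lambda>_. 0)" "poly_op F (of_int_poly (\<Prod>q\<in>P. q)) z = (\<lambda>_. 0)"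
  shows "z = (\<lambda>_. 0)"
  using P z
proof (induction P arbitrary: z rule: finite_induct)
  case empty
  thus ?case using poly_op_const[OF F, of 1 z] by (simp add: one_pCons)
next
  case (insert q P)
  define y where "y = poly_op F (of_int_poly (\<Prod>q\<in>P. q)) z"
  obtain u v r where bez: "u * p + v * q = [:r:]" "r \<noteq> 0"
    using prime_int_poly_bezout[of p q] p insert.prems by auto
  have comm: "poly_op F (a * b) x = poly_op F (b * a) x" for a b x by (simp add: mult.commute)
  have py: "poly_op F (of_int_poly p) y = (\<lambda>_. 0)"
    using comm[of "of_int_poly p" "of_int_poly (\<Prod>q\<in>P. q)" z] insert.prems
    by (simp add: y_def poly_op_mult[OF F] linear_op_zero[OF poly_op_linear_op[OF F]])
  have qy: "poly_op F (of_int_poly q) y = (\<lambda>_. 0)"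
    using insert by (simp add: y_def poly_op_mult[OF F] of_int_poly_hom.hom_mult)
  have "poly_op F (of_int_poly (u * p + v * q)) y = (\<lambda>_. 0)"
    using py qy by (simp add: of_int_poly_hom.hom_mult of_int_poly_hom.hom_add
        poly_op_add[OF F] poly_op_mult[OF F] linear_op_zero[OF poly_op_linear_op[OF F]])
  hence "y = (\<lambda>_. 0)"
    using bez poly_op_const[OF F, of "of_int r" y] by (simp add: of_int_poly_const fun_eq_iff)
  thus ?case using insert by (auto simp: y_def)
qed

text \<open>
  The eigenvectors of the Gram matrix for the eigenvalue 0 span the kernel of \<open>p(A)\<close>. In a linear
  relation between vectors of different kernels, apply the product of all \<open>q(A)\<close> except for one
  prime \<open>p\<close>: this kills all components other than the one at \<open>p\<close>, which is then 0 by
  \<open>poly_op_kernels_independent\<close>.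
\<close>

lemma sum_kernel_dims_le:
  assumes J: "finite J" and P: "finite P" "\<forall>p\<in>P. prime p"
    and eb: "\<And>p. p \<in> P \<Longrightarrow> eigenbasis J (gram J (poly_op_matrix (mat_app J A) (of_int_poly p))) (b p) (\<beta> p)"
  shows "(\<Sum>p\<in>P. card {l. l < card J \<and> \<beta> p l = 0}) \<le> card J"
proof (rule ccontr)
  assume contra: "\<not> ?thesis"
  let ?F = "mat_app J A"
  define n where "n = card J"
  define Z where "Z p = {l. l < n \<and> \<beta> p l = 0}" for p
  have Z: "Z p \<subseteq> {..<n}" "finite (Z p)" for p by (auto simp: Z_def)
  have on: "orthonormal J n (b p)" if "p \<in> P" for p using eb[OF that] by (simp add: eigenbasis_def n_def)
  have "card J < card (Sigma P Z)" using contra P Z by (simp add: card_SigmaI Z_def n_def)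
  then obtain x where x: "\<exists>l\<in>Sigma P Z. x l \<noteq> 0" "\<forall>i\<in>J. (\<Sum>l\<in>Sigma P Z. x l * b (fst l) (snd l) i) = 0"
    using homogeneous_system_nontrivial[of J "Sigma P Z" "\<lambda>l. b (fst l) (snd l)"] J P Z by auto
  define z where "z p = (\<lambda>i. \<Sum>l\<in>Z p. x (p, l) * b p l i)" for p
  have z_vecs: "z p \<in> vecs_on J" if "p \<in> P" for p
    using on[OF that] Z by (auto simp: z_def vecs_on_def orthonormal_def subset_iff intro!: sum.neutral)
  have sum_z: "(\<Sum>p\<in>P. z p i) = 0" for i
  proof (cases "i \<in> J")
    case True
    hence "(\<Sum>l\<in>Sigma P Z. x l * b (fst l) (snd l) i) = 0" using x by blast
    moreover have "(\<Sum>l\<in>Sigma P Z. x l * b (fst l) (snd l) i) = (\<Sum>p\<in>P. z p i)"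
      unfolding z_def using P Z by (subst sum.Sigma) (auto intro!: sum.cong)
    ultimately show ?thesis by simp
  next
    case False
    thus ?thesis using z_vecs by (auto simp: vecs_on_def)
  qed
  have kern: "poly_op ?F (of_int_poly p) (z p) = (\<lambda>_. 0)" if p: "p \<in> P" for p
  proof -
    define B where "B = poly_op_matrix ?F (of_int_poly p)"
    have eq: "mat_app J B (z p) = poly_op ?F (of_int_poly p) (z p)"
      unfolding B_def by (rule poly_op_matrix_app[OF J linear_op_mat_app mat_app_in_vecs z_vecs[OF p]])
    have "(norm_on J (mat_app J B (z p)))\<^sup>2 = (\<Sum>l\<in>Z p. (cmod (x (p, l)))\<^sup>2 * \<beta> p l)"
      unfolding z_def using eigenbasis_gram_norm[OF J eb[OF p], of "Z p" "\<lambda>l. x (p, l)"] Z by (simp add: n_def B_def)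
    also have "\<dots> = 0" by (simp add: Z_def)
    finally have "norm_on J (mat_app J B (z p)) = 0" by simp
    thus ?thesis using norm_on_eq_0[OF J mat_app_in_vecs] eq by metis
  qed
  have z0: "z p = (\<lambda>_. 0)" if p: "p \<in> P" for p
  proof (rule poly_op_kernels_independent[OF linear_op_mat_app _ _ _ _ kern[OF p]])
    let ?Q = "of_int_poly (\<Prod>q\<in>P - {p}. q) :: complex poly"
    have kill: "poly_op ?F ?Q (z q) = (\<lambda>_. 0)" if q: "q \<in> P - {p}" for q
    proof -
      have "(\<Prod>q\<in>P - {p}. q) = (\<Prod>q\<in>P - {p} - {q}. q) * q"
        using P q by (subst prod.remove[of _ q]) (auto simp: mult.commute)
      thus ?thesis using kern[of q] q
        by (simp add: of_int_poly_hom.hom_mult poly_op_mult[OF linear_op_mat_app] linear_op_zero[OF poly_op_linear_op[OF linear_op_mat_app]])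
    qed
    have "z p = (\<lambda>i. \<Sum>q\<in>P - {p}. - 1 * z q i)"
    proof
      fix i show "z p i = (\<Sum>q\<in>P - {p}. - 1 * z q i)"
        using sum_z[of i] P p by (simp add: sum.remove[of P p] sum_negf eq_neg_iff_add_eq_0)
    qed
    hence "poly_op ?F ?Q (z p) = poly_op ?F ?Q (\<lambda>i. \<Sum>q\<in>P - {p}. - 1 * z q i)" by (rule arg_cong)
    also have "\<dots> = (\<lambda>i. \<Sum>q\<in>P - {p}. - 1 * poly_op ?F ?Q (z q) i)"
      by (rule linear_op_sum[OF poly_op_linear_op[OF linear_op_mat_app]]) (use P in auto)
    also have "\<dots> = (\<lambda>_. 0)" using kill by simp
    finally show "poly_op ?F ?Q (z p) = (\<lambda>_. 0)" .
  qed (use P p in auto)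
  obtain p l where pl: "p \<in> P" "l \<in> Z p" "x (p, l) \<noteq> 0" using x(1) by auto
  have "(norm_on J (z p))\<^sup>2 = (\<Sum>l\<in>Z p. (cmod (x (p, l)))\<^sup>2)"
    unfolding z_def by (rule orthonormal_norm[OF J on[OF pl(1)] Z(1)])
  hence "(\<Sum>l\<in>Z p. (cmod (x (p, l)))\<^sup>2) = 0" using z0[OF pl(1)] by (simp add: norm_on_zero)
  hence "\<forall>l\<in>Z p. x (p, l) = 0" using Z by (simp add: sum_nonneg_eq_0_iff)
  thus False using pl by blast
qed


definition minus_scalar :: "('j \<Rightarrow> 'j \<Rightarrow> complex) \<Rightarrow> complex \<Rightarrow> 'j \<Rightarrow> 'j \<Rightarrow> complex" where
  "minus_scalar A c i j = A i j - (if i = j then c else 0)"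

lemma mat_app_minus_scalar:
  assumes "finite J" "u \<in> vecs_on J"
  shows "mat_app J (minus_scalar A c) u = (\<lambda>i. mat_app J A u i - c * u i)"
proof
  fix i
  show "mat_app J (minus_scalar A c) u i = mat_app J A u i - c * u i"
  proof (cases "i \<in> J")
    case True
    have "mat_app J (minus_scalar A c) u i = mat_app J A u i - (\<Sum>j\<in>J. (if i = j then c else 0) * u j)"
      using True by (simp add: mat_app_def minus_scalar_def left_diff_distrib sum_subtractf)
    also have "(\<Sum>j\<in>J. (if i = j then c else 0) * u j) = (\<Sum>j\<in>J. if i = j then c * u j else 0)"
      by (intro sum.cong) auto
    finally show ?thesis using True assms by simp
  qed (use assms in \<open>auto simp: mat_app_def vecs_on_def\<close>)
qed

text \<open>
  Take \<open>m\<close> good primes \<open>p\<close> for the exponent \<open>m + 1\<close>, where \<open>m\<close> is about \<open>2 / \<delta>\<close>. For a matrix of size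
  \<open>n\<close>, one of the kernels of \<open>p(A)\<close> has dimension at most \<open>n / m\<close>. For this \<open>p\<close>, singular values of
  \<open>A - c\<close> that are small enough give singular values of \<open>p(A)\<close> that are at most \<open>2 |p(c)|\<close>. The
  other singular values of \<open>p(A)\<close> are at most its root weight \<open>\<Phi>\<close>, and the nonzero ones have
  product at least 1; since \<open>2 |p(c)| \<Phi>\<^sup>m \<le> 1\<close>, at most \<open>n / m\<close> of the nonzero ones can be that
  small. The threshold \<open>\<epsilon>\<close> depends on the primes only, not on the matrix.
\<close>

lemma few_small_singular_values:
  fixes c :: complex and K \<delta> :: real
  assumes c: "\<not> algebraic c" and \<delta>: "\<delta> > 0"
  obtains \<epsilon> where "\<epsilon> > 0"
    "\<And>(J::'j set) A w \<tau>. finite J \<Longrightarrow> (\<And>i j. i \<in> J \<Longrightarrow> j \<in> J \<Longrightarrow> A i j \<in> \<int>) \<Longrightarrow>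
      bounded_op J K (mat_app J A) \<Longrightarrow> eigenbasis J (gram J (minus_scalar A c)) w \<tau> \<Longrightarrow>
      real (card {l. l < card J \<and> \<tau> l \<le> \<epsilon>}) \<le> \<delta> * card J"
proof -
  define R where "R = max K 2"
  have R: "R \<ge> 2" "R \<ge> K" "R > 1" "R \<ge> 0" by (auto simp: R_def)
  obtain m :: nat where m: "2 / \<delta> \<le> real m" "m \<ge> 1"
    using real_arch_simple[of "max 1 (2 / \<delta>)"] by (metis max.boundedE of_nat_1 of_nat_le_iff)
  obtain P where P: "finite P" "card P = m" "\<forall>p\<in>P. good_prime c R (m + 1) p"
    using many_good_primes[OF c R(3)] by metis
  have P_prime: "\<forall>p\<in>P. prime p" using P by (auto simp: good_prime_def)
  define \<eta> where "\<eta> p = cmod (poly (of_int_poly p) c)" for p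
  define \<Phi> where "\<Phi> p = root_weight R (of_int_poly p)" for p
  have \<eta>_pos: "\<eta> p > 0" if "p \<in> P" for p
    using poly_of_int_poly_nonzero[OF c] P_prime that unfolding \<eta>_def by fastforce
  have \<Phi>: "\<Phi> p \<ge> 2" if "p \<in> P" for p
    using good_prime_weight[of c R "m + 1" p] P R that unfolding \<Phi>_def by force
  have \<eta>\<Phi>: "2 * \<eta> p * \<Phi> p ^ m \<le> 1" if "p \<in> P" for p
  proof -
    \<comment> \<open>One of the \<open>m + 1\<close> powers of \<open>\<Phi>\<close> absorbs the factor 2, as \<open>R \<ge> 2\<close>.\<close>
    have "2 * (\<eta> p * \<Phi> p ^ m) \<le> \<Phi> p * (\<eta> p * \<Phi> p ^ m)"
      using \<Phi>[OF that] \<eta>_pos[OF that] by (intro mult_right_mono) auto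
    also have "\<dots> = \<eta> p * \<Phi> p ^ (m + 1)" by simp
    also have "\<dots> < 1" using P that by (auto simp: good_prime_def \<eta>_def \<Phi>_def)
    finally show ?thesis by simp
  qed
  have "\<exists>C\<ge>0. \<forall>(J::'j set) F. bounded_op J R F \<longrightarrow>
    (\<forall>u. norm_on J (poly_op F (of_int_poly p) u) \<le> \<eta> p * norm_on J u + C * norm_on J (\<lambda>i. F u i - c * u i))" for p
    unfolding \<eta>_def by (rule poly_op_value_bound[OF R(4)])
  then obtain C where C: "\<And>p. C p \<ge> 0" "\<And>p (J::'j set) F u. bounded_op J R F \<Longrightarrow>
    norm_on J (poly_op F (of_int_poly p) u) \<le> \<eta> p * norm_on J u + C p * norm_on J (\<lambda>i. F u i - c * u i)"
    by metis
  \<comment> \<open>Below this threshold the error term of \<open>p(A)\<close> is at most \<open>|p(c)|\<close>.\<close>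
  define e where "e p = \<eta> p / (C p + 1)" for p
  have e_pos: "e p > 0" if "p \<in> P" for p using \<eta>_pos[OF that] C(1)[of p] by (simp add: e_def)
  have Ce: "C p * e p \<le> \<eta> p" if "p \<in> P" for p
    using \<eta>_pos[OF that] C(1)[of p] by (simp add: e_def field_simps)
  define e0 where "e0 = Min (e ` P)"
  have "P \<noteq> {}" using P m by auto
  hence e0: "e0 > 0" "\<And>p. p \<in> P \<Longrightarrow> e0 \<le> e p" using e_pos P by (auto simp: e0_def)
  show ?thesis
  proof (rule that[of "e0\<^sup>2"])
    show "e0\<^sup>2 > 0" using e0 by simp
  next
    fix J :: "'j set" and A w \<tau>
    assume J: "finite J" and A: "\<And>i j. i \<in> J \<Longrightarrow> j \<in> J \<Longrightarrow> A i j \<in> \<int>"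
      and contr: "bounded_op J K (mat_app J A)" and W: "eigenbasis J (gram J (minus_scalar A c)) w \<tau>"
    define n where "n = card J"
    let ?F = "mat_app J A"
    have F: "bounded_op J R ?F"
    proof -
      have "K * norm_on J u \<le> R * norm_on J u" for u using R by (intro mult_right_mono) auto
      thus ?thesis using contr unfolding bounded_op_def by (meson order_trans)
    qed
    define B where "B p = poly_op_matrix ?F (of_int_poly p)" for p
    have "\<exists>b \<beta>. eigenbasis J (gram J (B p)) b \<beta>" for p
      using hermitian_eigenbasis[OF J hermitian_gram] by metis
    then obtain b \<beta> where eb: "\<And>p. eigenbasis J (gram J (B p)) (b p) (\<beta> p)" by metis
    define Z where "Z p = {l. l < n \<and> \<beta> p l = 0}" for p
    have "(\<Sum>p\<in>P. card (Z p)) \<le> n"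
      unfolding Z_def n_def using eb by (intro sum_kernel_dims_le[OF J P(1) P_prime]) (auto simp: B_def)
    have "\<exists>p\<in>P. m * card (Z p) \<le> n"
    proof (rule ccontr)
      assume "\<not> ?thesis"
      hence "(\<Sum>p\<in>P. n) < (\<Sum>p\<in>P. m * card (Z p))"
        using P \<open>P \<noteq> {}\<close> by (intro sum_strict_mono) (auto simp: not_le)
      hence "m * n < m * (\<Sum>p\<in>P. card (Z p))" using P by (simp add: sum_distrib_left)
      thus False using \<open>(\<Sum>p\<in>P. card (Z p)) \<le> n\<close> by simp
    qed
    then obtain p where p: "p \<in> P" "m * card (Z p) \<le> n" by blast
    have Bv: "mat_app J (B p) v = poly_op ?F (of_int_poly p) v" if "v \<in> vecs_on J" for v
      unfolding B_def by (rule poly_op_matrix_app[OF J linear_op_mat_app mat_app_in_vecs that])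
    define \<theta> where "\<theta> = (2 * \<eta> p)\<^sup>2"
    have "card {l. l < card J \<and> \<tau> l \<le> e0\<^sup>2} \<le> card {l. l < card J \<and> \<beta> p l \<le> \<theta>}"
    proof (rule count_small_eigenvalues[OF J W eb])
      fix v assume v: "v \<in> vecs_on J" "(norm_on J (mat_app J (minus_scalar A c) v))\<^sup>2 \<le> e0\<^sup>2 * (norm_on J v)\<^sup>2"
      hence "(norm_on J (mat_app J (minus_scalar A c) v))\<^sup>2 \<le> (e0 * norm_on J v)\<^sup>2" by (simp add: power_mult_distrib)
      hence "norm_on J (mat_app J (minus_scalar A c) v) \<le> e0 * norm_on J v"
        by (rule power2_le_imp_le) (use e0 in auto)
      also have "\<dots> \<le> e p * norm_on J v" using e0(2)[OF p(1)] by (intro mult_right_mono) auto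
      finally have D: "norm_on J (\<lambda>i. ?F v i - c * v i) \<le> e p * norm_on J v"
        using mat_app_minus_scalar[OF J v(1)] by simp
      have "norm_on J (mat_app J (B p) v) \<le> \<eta> p * norm_on J v + C p * norm_on J (\<lambda>i. ?F v i - c * v i)"
        unfolding Bv[OF v(1)] by (rule C(2)[OF F])
      also have "\<dots> \<le> \<eta> p * norm_on J v + C p * (e p * norm_on J v)"
        using D C(1) by (intro add_left_mono mult_left_mono)
      also have "\<dots> \<le> \<eta> p * norm_on J v + \<eta> p * norm_on J v"
        using Ce[OF p(1)] by (simp add: mult.assoc[symmetric] mult_right_mono)
      finally have "norm_on J (mat_app J (B p) v) \<le> 2 * \<eta> p * norm_on J v" by simp
      hence "(norm_on J (mat_app J (B p) v))\<^sup>2 \<le> (2 * \<eta> p * norm_on J v)\<^sup>2" by (intro power_mono) auto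
      thus "(norm_on J (mat_app J (B p) v))\<^sup>2 \<le> \<theta> * (norm_on J v)\<^sup>2"
        by (simp add: \<theta>_def power_mult_distrib)
    qed
    also have "{l. l < card J \<and> \<beta> p l \<le> \<theta>} \<subseteq> Z p \<union> {l. l < n \<and> \<beta> p l \<noteq> 0 \<and> \<beta> p l \<le> \<theta>}"
      by (auto simp: Z_def n_def)
    hence "card {l. l < card J \<and> \<beta> p l \<le> \<theta>} \<le> card (Z p \<union> {l. l < n \<and> \<beta> p l \<noteq> 0 \<and> \<beta> p l \<le> \<theta>})"
      by (intro card_mono) (auto simp: Z_def)
    also have "\<dots> \<le> card (Z p) + card {l. l < n \<and> \<beta> p l \<noteq> 0 \<and> \<beta> p l \<le> \<theta>}" by (rule card_Un_le)
    finally have count: "card {l. l < card J \<and> \<tau> l \<le> e0\<^sup>2}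
      \<le> card (Z p) + card {l. l < n \<and> \<beta> p l \<noteq> 0 \<and> \<beta> p l \<le> \<theta>}" .
    define L where "L = {l. l < n \<and> \<beta> p l \<noteq> 0}"
    define S where "S = {l. l < n \<and> \<beta> p l \<noteq> 0 \<and> \<beta> p l \<le> \<theta>}"
    have fin: "finite L" "finite S" "S \<subseteq> L" "L \<subseteq> {..<n}" by (auto simp: L_def S_def)
    have \<beta>: "\<beta> p l \<ge> 0" "\<beta> p l \<le> (\<Phi> p)\<^sup>2" if "l < n" for l
    proof -
      note ev = eigenbasis_gram_eigenvalue[OF J eb[of p], of l]
      have "b p l \<in> vecs_on J" using eb[of p] that by (simp add: eigenbasis_def orthonormal_def n_def)
      hence "norm_on J (mat_app J (B p) (b p l)) \<le> \<Phi> p * norm_on J (b p l)"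
        using Bv poly_op_le_root_weight[OF F R(4)] by (simp add: \<Phi>_def)
      hence "norm_on J (mat_app J (B p) (b p l)) \<le> \<Phi> p" using ev that by (simp add: n_def)
      hence "(norm_on J (mat_app J (B p) (b p l)))\<^sup>2 \<le> (\<Phi> p)\<^sup>2" by (intro power_mono) auto
      thus "\<beta> p l \<ge> 0" "\<beta> p l \<le> (\<Phi> p)\<^sup>2" using ev that by (simp_all add: n_def)
    qed
    have "gram J (B p) i j \<in> \<int>" for i j
    proof -
      have "B p i j \<in> \<int>" for i j unfolding B_def by (rule poly_op_matrix_int[OF J A])
      moreover have "cnj z \<in> \<int>" if "z \<in> \<int>" for z using that by (auto elim!: Ints_cases)
      ultimately show ?thesis unfolding gram_def by (intro Ints_sum Ints_mult) auto
    qed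
    hence "1 \<le> (\<Prod>l\<in>L. \<bar>\<beta> p l\<bar>)"
      using integer_hermitian_eigenvalue_product[OF J eb] by (simp add: L_def n_def)
    also have "\<dots> = (\<Prod>l\<in>S. \<bar>\<beta> p l\<bar>) * (\<Prod>l\<in>L - S. \<bar>\<beta> p l\<bar>)"
      using fin by (metis prod.subset_diff mult.commute)
    also have "\<dots> \<le> (\<Prod>l\<in>S. \<theta>) * (\<Prod>l\<in>L - S. (\<Phi> p)\<^sup>2)"
    proof (rule mult_mono)
      have "\<theta> \<ge> 0" by (simp add: \<theta>_def)
      thus "(\<Prod>l\<in>S. \<theta>) \<ge> 0" by (intro prod_nonneg) auto
      show "(\<Prod>l\<in>S. \<bar>\<beta> p l\<bar>) \<le> (\<Prod>l\<in>S. \<theta>)" using \<beta>(1) by (intro prod_mono) (auto simp: S_def)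
      show "(\<Prod>l\<in>L - S. \<bar>\<beta> p l\<bar>) \<le> (\<Prod>l\<in>L - S. (\<Phi> p)\<^sup>2)"
        using \<beta> by (intro prod_mono) (auto simp: L_def)
    qed (auto intro!: prod_nonneg)
    also have "\<dots> \<le> \<theta> ^ card S * ((\<Phi> p)\<^sup>2) ^ n"
    proof -
      have "card (L - S) \<le> n" using card_mono[of "{..<n}" "L - S"] fin by auto
      moreover have "1 \<le> (\<Phi> p)\<^sup>2" using \<Phi>[OF p(1)] by (intro one_le_power) auto
      ultimately show ?thesis
        by (simp add: \<theta>_def mult_left_mono power_increasing)
    qed
    finally have one_le: "1 \<le> \<theta> ^ card S * (\<Phi> p) ^ (2 * n)" by (simp add: power_mult)
    have \<theta>\<Phi>: "\<theta> * \<Phi> p ^ (2 * m) \<le> 1"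
    proof -
      have "\<theta> * \<Phi> p ^ (2 * m) = (2 * \<eta> p * \<Phi> p ^ m)\<^sup>2"
        by (simp add: \<theta>_def power_mult_distrib power_mult[symmetric] mult.commute)
      also have "\<dots> \<le> 1" using \<eta>\<Phi>[OF p(1)] \<eta>_pos[OF p(1)] \<Phi>[OF p(1)] by (intro power_le_one) auto
      finally show ?thesis .
    qed
    have "\<Phi> p ^ (2 * m * card S) * 1 \<le> \<Phi> p ^ (2 * m * card S) * (\<theta> ^ card S * (\<Phi> p) ^ (2 * n))"
      using one_le \<Phi>[OF p(1)] by (intro mult_left_mono) auto
    also have "\<dots> = (\<theta> * \<Phi> p ^ (2 * m)) ^ card S * \<Phi> p ^ (2 * n)"
    proof -
      have "(\<Phi> p ^ (2 * m)) ^ card S = \<Phi> p ^ (2 * m * card S)" by (rule power_mult[symmetric])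
      thus ?thesis by (simp add: power_mult_distrib mult_ac)
    qed
    also have "\<dots> \<le> 1 * \<Phi> p ^ (2 * n)"
      using \<theta>\<Phi> \<Phi>[OF p(1)] by (intro mult_right_mono power_le_one) (auto simp: \<theta>_def)
    finally have "\<Phi> p ^ (2 * m * card S) \<le> \<Phi> p ^ (2 * n)" by simp
    hence "2 * m * card S \<le> 2 * n"
      by (rule power_le_imp_le_exp[rotated]) (use \<Phi>[OF p(1)] in simp)
    hence "m * card {l. l < card J \<and> \<tau> l \<le> e0\<^sup>2} \<le> 2 * n"
      using mult_le_mono2[OF count, of m] p(2) by (simp add: S_def[symmetric] distrib_left)
    hence "real m * card {l. l < card J \<and> \<tau> l \<le> e0\<^sup>2} \<le> 2 * real n"
      by (metis of_nat_le_iff of_nat_mult of_nat_numeral)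
    hence "real (card {l. l < card J \<and> \<tau> l \<le> e0\<^sup>2}) \<le> 2 / real m * n"
      using m by (simp add: field_simps)
    also have "\<dots> \<le> \<delta> * n" using m \<delta> by (intro mult_right_mono) (auto simp: field_simps)
    finally show "real (card {l. l < card J \<and> \<tau> l \<le> e0\<^sup>2}) \<le> \<delta> * card J" by (simp add: n_def)
  qed
qed

text \<open>
  The operator \<open>1 - M\<^sup>* M / \<kappa>\<close>. Its powers fix the kernel of \<open>M\<close> and, for \<open>\<kappa>\<close> large, shrink the other
  eigenvectors of \<open>M\<^sup>* M\<close>. They are polynomials in \<open>M\<close> and its adjoint and so have a
  meaning over the group as well.
\<close>

definition damp :: "'j set \<Rightarrow> real \<Rightarrow> ('j \<Rightarrow> 'j \<Rightarrow> complex) \<Rightarrow> ('j \<Rightarrow> complex) \<Rightarrow> 'j \<Rightarrow> complex" where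
  "damp J \<kappa> M u = (\<lambda>i. u i - of_real (1 / \<kappa>) * mat_app J (gram J M) u i)"

lemma linear_op_damp: "linear_op (damp J \<kappa> M)"
  unfolding linear_op_def damp_def linear_opD[OF linear_op_mat_app] by (simp add: algebra_simps)

lemma linear_op_funpow: "linear_op F \<Longrightarrow> linear_op (F ^^ m)"
  by (induction m) (simp_all add: linear_op_def)

text \<open>
  In an eigenbasis the sum is the trace of the power \<open>2 m\<close> of \<open>1 - T / \<kappa>\<close>, where \<open>T\<close> is the Gram matrix
  of \<open>A - c\<close>. The choice of \<open>\<kappa>\<close> puts the eigenvalues of \<open>T\<close> into \<open>[0, \<kappa>]\<close>. The few that are at most
  \<open>\<epsilon>\<close> contribute at most 1 each, and all the others a quantity that is small for large \<open>m\<close>.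
\<close>

lemma transcendental_trace_decay:
  fixes c :: complex and K \<delta> :: real
  assumes c: "\<not> algebraic c" and K: "K \<ge> 0" and \<delta>: "\<delta> > 0"
  defines "\<kappa> \<equiv> (K + cmod c + 1)\<^sup>2"
  obtains m where
    "\<And>(J::'j set) A. finite J \<Longrightarrow> (\<And>i j. i \<in> J \<Longrightarrow> j \<in> J \<Longrightarrow> A i j \<in> \<int>) \<Longrightarrow>
      bounded_op J K (mat_app J A) \<Longrightarrow>
      (\<Sum>j\<in>J. (norm_on J ((damp J \<kappa> (minus_scalar A c) ^^ m) (\<lambda>i. if i = j then 1 else 0)))\<^sup>2) \<le> \<delta> * card J"
proof -
  obtain \<epsilon> where \<epsilon>: "\<epsilon> > 0" "\<And>(J::'j set) A w \<tau>. finite J \<Longrightarrow> (\<And>i j. i \<in> J \<Longrightarrow> j \<in> J \<Longrightarrow> A i j \<in> \<int>) \<Longrightarrow>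
      bounded_op J K (mat_app J A) \<Longrightarrow> eigenbasis J (gram J (minus_scalar A c)) w \<tau> \<Longrightarrow>
      real (card {l. l < card J \<and> \<tau> l \<le> \<epsilon>}) \<le> \<delta> / 2 * card J"
  proof -
    have "\<delta> / 2 > 0" using \<delta> by simp
    thus ?thesis by (rule few_small_singular_values[OF c, where K = K and 'j = 'j]) (rule that, assumption, blast)
  qed
  have "K + cmod c + 1 > 0" using K by (simp add: add_nonneg_pos)
  hence \<kappa>: "\<kappa> > 0" by (simp add: \<kappa>_def)
  define r where "r = max 0 (1 - \<epsilon> / \<kappa>)"
  have r: "0 \<le> r" "r < 1" using \<epsilon>(1) \<kappa> by (auto simp: r_def)
  obtain m where m: "r ^ m < \<delta> / 2" using real_arch_pow_inv[of "\<delta> / 2" r] r \<delta> by auto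
  show ?thesis
  proof (rule that[of m])
    fix J :: "'j set" and A
    assume J: "finite J" and A: "\<And>i j. i \<in> J \<Longrightarrow> j \<in> J \<Longrightarrow> A i j \<in> \<int>"
      and F: "bounded_op J K (mat_app J A)"
    let ?P = "damp J \<kappa> (minus_scalar A c)"
    obtain w \<tau> where W: "eigenbasis J (gram J (minus_scalar A c)) w \<tau>"
      using hermitian_eigenbasis[OF J hermitian_gram] by metis
    define n where "n = card J"
    have on: "orthonormal J n w" using W by (simp add: eigenbasis_def n_def)
    have wJ: "w l \<in> vecs_on J" if "l < n" for l using on that by (simp add: orthonormal_def)
    define s where "s l = 1 - \<tau> l / \<kappa>" for l
    have \<tau>: "0 \<le> \<tau> l" "\<tau> l \<le> \<kappa>" if l: "l < n" for l
    proof -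
      note ev = eigenbasis_gram_eigenvalue[OF J W, of l]
      have "norm_on J (mat_app J (minus_scalar A c) (w l)) \<le> norm_on J (mat_app J A (w l)) + norm_on J (\<lambda>i. - c * w l i)"
        using mat_app_minus_scalar[OF J wJ[OF l]] norm_on_triangle[of J "mat_app J A (w l)" "\<lambda>i. - c * w l i"] by simp
      also have "\<dots> \<le> K * norm_on J (w l) + cmod c * norm_on J (w l)"
        unfolding norm_on_scale using F by (simp add: bounded_op_def)
      finally have "norm_on J (mat_app J (minus_scalar A c) (w l)) \<le> K + cmod c + 1" using ev l by (simp add: n_def)
      hence "(norm_on J (mat_app J (minus_scalar A c) (w l)))\<^sup>2 \<le> \<kappa>" unfolding \<kappa>_def by (intro power_mono) auto
      thus "0 \<le> \<tau> l" "\<tau> l \<le> \<kappa>" using ev l by (simp_all add: n_def)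
    qed
    have s: "0 \<le> s l" "s l \<le> 1" if "l < n" for l using \<tau>[OF that] \<kappa> by (auto simp: s_def)
    have Pw: "(?P ^^ k) (w l) = (\<lambda>i. of_real (s l ^ k) * w l i)" if l: "l < n" for l k
    proof (induction k)
      case (Suc k)
      have "?P (w l) = (\<lambda>i. of_real (s l) * w l i)"
        using W l by (simp add: damp_def eigenbasis_def n_def s_def algebra_simps)
      hence "?P (\<lambda>i. of_real (s l ^ k) * w l i) = (\<lambda>i. of_real (s l ^ Suc k) * w l i)"
        unfolding linear_op_scale[OF linear_op_damp] by (simp add: mult_ac)
      thus ?case using Suc by simp
    qed simp
    have unit: "(\<lambda>i. if i = j then 1 else 0) = (\<lambda>i. \<Sum>l<n. cnj (w l j) * w l i)" if j: "j \<in> J" for j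
    proof
      fix i show "(if i = j then 1 else 0) = (\<Sum>l<n. cnj (w l j) * w l i)"
      proof (cases "i \<in> J")
        case True
        thus ?thesis using orthonormal_complete[OF J on[unfolded n_def] j True] by (simp add: n_def)
      next
        case False
        thus ?thesis using j wJ by (auto simp: vecs_on_def intro!: sum.neutral[symmetric])
      qed
    qed
    have norm_col: "(norm_on J ((?P ^^ m) (\<lambda>i. if i = j then 1 else 0)))\<^sup>2 = (\<Sum>l<n. (cmod (w l j))\<^sup>2 * (s l ^ m)\<^sup>2)"
      if j: "j \<in> J" for j
    proof -
      have "(?P ^^ m) (\<lambda>i. \<Sum>l<n. cnj (w l j) * w l i) = (\<lambda>i. \<Sum>l<n. cnj (w l j) * (?P ^^ m) (w l) i)"
        by (rule linear_op_sum[OF linear_op_funpow[OF linear_op_damp]]) auto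
      also have "\<dots> = (\<lambda>i. \<Sum>l<n. (cnj (w l j) * of_real (s l ^ m)) * w l i)"
        by (intro ext sum.cong) (auto simp: Pw)
      finally have "(?P ^^ m) (\<lambda>i. if i = j then 1 else 0) = (\<lambda>i. \<Sum>l<n. (cnj (w l j) * of_real (s l ^ m)) * w l i)"
        unfolding unit[OF j] .
      hence "(norm_on J ((?P ^^ m) (\<lambda>i. if i = j then 1 else 0)))\<^sup>2 = (\<Sum>l<n. (cmod (cnj (w l j) * of_real (s l ^ m)))\<^sup>2)"
        using orthonormal_norm[OF J on, of "{..<n}"] by simp
      thus ?thesis by (simp add: norm_mult power_mult_distrib norm_power del: of_real_power)
    qed
    have col: "(\<Sum>j\<in>J. (cmod (w l j))\<^sup>2) = 1" if "l < n" for l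
    proof -
      have "norm_on J (w l) = 1" using eigenbasis_gram_eigenvalue(2)[OF J W] that by (simp add: n_def)
      thus ?thesis by (simp add: norm_on_def L2_set_def)
    qed
    have "(\<Sum>j\<in>J. (norm_on J ((?P ^^ m) (\<lambda>i. if i = j then 1 else 0)))\<^sup>2)
        = (\<Sum>j\<in>J. \<Sum>l<n. (cmod (w l j))\<^sup>2 * (s l ^ m)\<^sup>2)" by (intro sum.cong norm_col refl)
    also have "\<dots> = (\<Sum>l<n. \<Sum>j\<in>J. (cmod (w l j))\<^sup>2 * (s l ^ m)\<^sup>2)" by (rule sum.swap)
    also have "\<dots> = (\<Sum>l<n. (s l ^ m)\<^sup>2)"
      unfolding sum_distrib_right[symmetric] by (intro sum.cong) (auto simp: col)
    also have "\<dots> \<le> (\<Sum>l<n. (if \<tau> l \<le> \<epsilon> then 1 else 0) + \<delta> / 2)"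
    proof (rule sum_mono)
      fix l assume "l \<in> {..<n}"
      hence l: "l < n" by simp
      show "(s l ^ m)\<^sup>2 \<le> (if \<tau> l \<le> \<epsilon> then 1 else 0) + \<delta> / 2"
      proof (cases "\<tau> l \<le> \<epsilon>")
        case True
        have "(s l ^ m)\<^sup>2 \<le> 1" using s[OF l] by (intro power_le_one) auto
        thus ?thesis using True \<delta> by simp
      next
        case False
        have "s l \<le> r" using False \<kappa> by (simp add: s_def r_def divide_right_mono max.coboundedI2)
        hence "s l ^ m \<le> r ^ m" using s[OF l] by (intro power_mono) auto
        moreover have "(s l ^ m)\<^sup>2 \<le> s l ^ m"
          using s[OF l] by (simp add: power2_eq_square mult_left_le power_le_one)
        ultimately show ?thesis using m False by simp
      qed
    qed
    also have "\<dots> = card {l. l < n \<and> \<tau> l \<le> \<epsilon>} + n * (\<delta> / 2)"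
    proof -
      have "(\<Sum>l<n. if \<tau> l \<le> \<epsilon> then 1 else 0) = real (card ({..<n} \<inter> {l. \<tau> l \<le> \<epsilon>}))"
        by (simp add: sum.If_cases)
      also have "{..<n} \<inter> {l. \<tau> l \<le> \<epsilon>} = {l. l < n \<and> \<tau> l \<le> \<epsilon>}" by auto
      finally show ?thesis by (simp add: sum.distrib)
    qed
    also have "\<dots> \<le> \<delta> * card J" using \<epsilon>(2)[OF J A F W] by (simp add: n_def field_simps)
    finally show "(\<Sum>j\<in>J. (norm_on J ((?P ^^ m) (\<lambda>i. if i = j then 1 else 0)))\<^sup>2) \<le> \<delta> * card J" .
  qed
qed

section \<open>Sofic groups\<close>


text \<open>
  Near \<open>x\<close>, as far as the elements of \<open>S\<close> can see, the maps \<open>\<sigma>\<close> behave like a free action.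
\<close>

definition sofic_point ::
  "('a, 'b) monoid_scheme \<Rightarrow> 'a set \<Rightarrow> 'x set \<Rightarrow> ('a \<Rightarrow> 'x \<Rightarrow> 'x) \<Rightarrow> 'x \<Rightarrow> bool" where
  "sofic_point G S X \<sigma> x \<longleftrightarrow>
     (\<forall>g\<in>S. \<sigma> g x \<in> X) \<and> (\<forall>g\<in>S. \<forall>h\<in>S. \<sigma> g (\<sigma> h x) = \<sigma> (g \<otimes>\<^bsub>G\<^esub> h) x) \<and>
     \<sigma> \<one>\<^bsub>G\<^esub> x = x \<and> (\<forall>g\<in>S. g \<noteq> \<one>\<^bsub>G\<^esub> \<longrightarrow> \<sigma> g x \<noteq> x)"

definition sofic_approx ::
  "('a, 'b) monoid_scheme \<Rightarrow> 'a set \<Rightarrow> real \<Rightarrow> 'x set \<Rightarrow> ('a \<Rightarrow> 'x \<Rightarrow> 'x) \<Rightarrow> bool" where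
  "sofic_approx G S \<epsilon> X \<sigma> \<longleftrightarrow> finite X \<and> X \<noteq> {} \<and>
     real (card {x \<in> X. \<not> sofic_point G S X \<sigma> x}) \<le> \<epsilon> * card X"

text \<open>
  Arbitrary maps of a finite set are admitted in place of permutations, since only good points matter.
  The finite sets consist of natural numbers; by \<open>soficI\<close> below, models of any other type will do.
\<close>

definition sofic :: "('a, 'b) monoid_scheme \<Rightarrow> bool" where
  "sofic G \<longleftrightarrow> (\<forall>S \<epsilon>. finite S \<longrightarrow> S \<subseteq> carrier G \<longrightarrow> \<epsilon> > 0 \<longrightarrow>
     (\<exists>(X :: nat set) \<sigma>. sofic_approx G S \<epsilon> X \<sigma>))"

lemma sofic_approx_nat:
  fixes X :: "'x set"
  assumes "sofic_approx G S \<epsilon> X \<sigma>"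
  shows "\<exists>(X' :: nat set) \<sigma>'. sofic_approx G S \<epsilon> X' \<sigma>'"
proof -
  have X: "finite X" "X \<noteq> {}" "real (card {x \<in> X. \<not> sofic_point G S X \<sigma> x}) \<le> \<epsilon> * card X"
    using assms by (auto simp: sofic_approx_def)
  obtain h :: "'x \<Rightarrow> nat" where h: "bij_betw h X {0..<card X}"
    using ex_bij_betw_finite_nat[OF X(1)] by blast
  define \<sigma>' where "\<sigma>' g y = h (\<sigma> g (inv_into X h y))" for g y
  have inj: "inj_on h X" using h by (simp add: bij_betw_def)
  have h_inv: "inv_into X h (h x) = x" if "x \<in> X" for x using inj that by simp
  have img: "h ` X = {0..<card X}" using h by (simp add: bij_betw_def)
  have point: "sofic_point G S {0..<card X} \<sigma>' (h x)" if x: "x \<in> X" "sofic_point G S X \<sigma> x" for x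
  proof -
    have "\<sigma>' g (h x) \<noteq> h x" if "g \<in> S" "g \<noteq> \<one>\<^bsub>G\<^esub>" for g
      using x that inj_onD[OF inj, of "\<sigma> g x" x] by (auto simp: \<sigma>'_def h_inv sofic_point_def)
    moreover have "\<sigma>' g (h x) \<in> {0..<card X}" if "g \<in> S" for g
      using x that img by (auto simp: \<sigma>'_def h_inv sofic_point_def)
    moreover have "\<sigma>' g (\<sigma>' k (h x)) = \<sigma>' (g \<otimes>\<^bsub>G\<^esub> k) (h x)" if "g \<in> S" "k \<in> S" for g k
      using x that by (simp add: \<sigma>'_def h_inv sofic_point_def)
    moreover have "\<sigma>' \<one>\<^bsub>G\<^esub> (h x) = h x" using x by (simp add: \<sigma>'_def h_inv sofic_point_def)
    ultimately show ?thesis by (auto simp: sofic_point_def)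
  qed
  have "{y \<in> {0..<card X}. \<not> sofic_point G S {0..<card X} \<sigma>' y} \<subseteq> h ` {x \<in> X. \<not> sofic_point G S X \<sigma> x}"
    using point unfolding img[symmetric] by auto
  hence "card {y \<in> {0..<card X}. \<not> sofic_point G S {0..<card X} \<sigma>' y} \<le> card {x \<in> X. \<not> sofic_point G S X \<sigma> x}"
    using X(1) by (intro order_trans[OF card_mono card_image_le]) auto
  hence "sofic_approx G S \<epsilon> {0..<card X} \<sigma>'"
    using X by (auto simp: sofic_approx_def)
  thus ?thesis by blast
qed

lemma soficI:
  fixes G :: "('a, 'b) monoid_scheme"
  assumes "\<And>S \<epsilon>. finite S \<Longrightarrow> S \<subseteq> carrier G \<Longrightarrow> \<epsilon> > 0 \<Longrightarrow> \<exists>(X :: 'x set) \<sigma>. sofic_approx G S \<epsilon> X \<sigma>"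
  shows "sofic G"
  unfolding sofic_def using assms sofic_approx_nat by metis

definition folner :: "('a, 'b) monoid_scheme \<Rightarrow> bool" where
  "folner Q \<longleftrightarrow> (\<forall>S. \<forall>\<epsilon> :: real. finite S \<longrightarrow> S \<subseteq> carrier Q \<longrightarrow> \<epsilon> > 0 \<longrightarrow>
     (\<exists>F. finite F \<and> F \<noteq> {} \<and> F \<subseteq> carrier Q \<and>
        (\<forall>s\<in>S. real (card {q \<in> F. s \<otimes>\<^bsub>Q\<^esub> q \<notin> F}) \<le> \<epsilon> * card F)))"

text \<open>
  Choose a section \<open>s\<close> of \<open>\<pi>\<close>. An element \<open>g\<close> moves the coset of \<open>s q\<close> to that of \<open>s (\<pi> g q)\<close>, with the
  discrepancy \<open>t g q\<close> in the kernel, which satisfies a cocycle identity. If \<open>X\<close> models the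
  kernel on the finitely many discrepancies over a Folner set \<open>F\<close>, then \<open>X \<times> F\<close> with
  \<open>g (x, q) = (t g q x, \<pi> g q)\<close> models the group; additional bad points arise only from the boundary
  of \<open>F\<close>.
\<close>

lemma sofic_extension:
  fixes G :: "('a, 'b) monoid_scheme" and Q :: "('q, 'c) monoid_scheme"
  assumes G: "group G" and Q: "group Q" and hom: "\<pi> \<in> hom G Q" and surj: "\<pi> ` carrier G = carrier Q"
    and N: "N = {g \<in> carrier G. \<pi> g = \<one>\<^bsub>Q\<^esub>}" "sofic (G\<lparr>carrier := N\<rparr>)" and fol: "folner Q"
  shows "sofic G"
proof (rule soficI[where 'x = "nat \<times> 'q"])
  fix S and \<epsilon> :: real
  assume S: "finite S" "S \<subseteq> carrier G" and \<epsilon>: "\<epsilon> > 0"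
  interpret G: group G by fact
  interpret Q: group Q by fact
  interpret \<pi>: group_hom G Q \<pi> by unfold_locales (rule hom)
  \<comment> \<open>Products are included because the model of \<open>g h\<close> is compared with the models of \<open>g\<close> and \<open>h\<close>.\<close>
  define S' where "S' = insert \<one>\<^bsub>G\<^esub> (S \<union> (\<lambda>(g, h). g \<otimes>\<^bsub>G\<^esub> h) ` (S \<times> S))"
  have S': "finite S'" "S' \<subseteq> carrier G" "S \<subseteq> S'" using S by (auto simp: S'_def)
  define s where "s q = (SOME g. g \<in> carrier G \<and> \<pi> g = q)" for q
  have s: "s q \<in> carrier G" "\<pi> (s q) = q" if "q \<in> carrier Q" for q
  proof -
    have "q \<in> \<pi> ` carrier G" using that surj by simp
    hence "\<exists>g. g \<in> carrier G \<and> \<pi> g = q" by blast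
    from someI_ex[OF this] show "s q \<in> carrier G" "\<pi> (s q) = q" by (auto simp: s_def)
  qed
  define t where "t g q = inv\<^bsub>G\<^esub> (s (\<pi> g \<otimes>\<^bsub>Q\<^esub> q)) \<otimes>\<^bsub>G\<^esub> (g \<otimes>\<^bsub>G\<^esub> s q)" for g q
  have t_N: "t g q \<in> N" if "g \<in> carrier G" "q \<in> carrier Q" for g q
    using that s by (simp add: t_def N)
  have t_mult: "t g (\<pi> h \<otimes>\<^bsub>Q\<^esub> q) \<otimes>\<^bsub>G\<^esub> t h q = t (g \<otimes>\<^bsub>G\<^esub> h) q"
    if "g \<in> carrier G" "h \<in> carrier G" "q \<in> carrier Q" for g h q
  proof -
    define a where "a = s (\<pi> h \<otimes>\<^bsub>Q\<^esub> q)"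
    define b where "b = s (\<pi> g \<otimes>\<^bsub>Q\<^esub> (\<pi> h \<otimes>\<^bsub>Q\<^esub> q))"
    have ab: "a \<in> carrier G" "b \<in> carrier G" using that s by (auto simp: a_def b_def)
    have "inv\<^bsub>G\<^esub> b \<otimes>\<^bsub>G\<^esub> (g \<otimes>\<^bsub>G\<^esub> a) \<otimes>\<^bsub>G\<^esub> (inv\<^bsub>G\<^esub> a \<otimes>\<^bsub>G\<^esub> (h \<otimes>\<^bsub>G\<^esub> s q))
        = inv\<^bsub>G\<^esub> b \<otimes>\<^bsub>G\<^esub> (g \<otimes>\<^bsub>G\<^esub> h \<otimes>\<^bsub>G\<^esub> s q)"
    proof -
      have "a \<otimes>\<^bsub>G\<^esub> (inv\<^bsub>G\<^esub> a \<otimes>\<^bsub>G\<^esub> z) = z" if "z \<in> carrier G" for z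
        using ab that by (simp flip: G.m_assoc)
      thus ?thesis using that ab s[OF that(3)] by (simp add: G.m_assoc)
    qed
    thus ?thesis using that by (simp add: t_def a_def b_def Q.m_assoc)
  qed
  have t_one: "t \<one>\<^bsub>G\<^esub> q = \<one>\<^bsub>G\<^esub>" if "q \<in> carrier Q" for q
    using that s[OF that] by (simp add: t_def)
  define \<epsilon>1 where "\<epsilon>1 = \<epsilon> / (2 * (card S' + 1))"
  have \<epsilon>1: "\<epsilon>1 > 0" using \<epsilon> by (simp add: \<epsilon>1_def)
  obtain F where F: "finite F" "F \<noteq> {}" "F \<subseteq> carrier Q"
    "\<And>g. g \<in> S' \<Longrightarrow> real (card {q \<in> F. \<pi> g \<otimes>\<^bsub>Q\<^esub> q \<notin> F}) \<le> \<epsilon>1 * real (card F)"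
  proof -
    have "finite (\<pi> ` S')" "\<pi> ` S' \<subseteq> carrier Q" using S' by auto
    from fol[unfolded folner_def, THEN spec, THEN spec, THEN mp, THEN mp, THEN mp, OF this \<epsilon>1]
    obtain F where "finite F" "F \<noteq> {}" "F \<subseteq> carrier Q"
      "\<forall>s\<in>\<pi> ` S'. real (card {q \<in> F. s \<otimes>\<^bsub>Q\<^esub> q \<notin> F}) \<le> \<epsilon>1 * real (card F)" by (elim exE conjE)
    thus ?thesis by (intro that) auto
  qed
  define T where "T = (\<lambda>(g, q). t g q) ` (S' \<times> F)"
  have T: "finite T" "T \<subseteq> N" using S' F by (auto simp: T_def intro!: t_N)
  obtain X :: "nat set" and \<tau> where X: "sofic_approx (G\<lparr>carrier := N\<rparr>) T (\<epsilon> / 2) X \<tau>"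
    using N(2)[unfolded sofic_def, rule_format, of T "\<epsilon> / 2"] T \<epsilon> by auto
  have X_fin: "finite X" "X \<noteq> {}" using X by (auto simp: sofic_approx_def)
  define B where "B = {x \<in> X. \<not> sofic_point (G\<lparr>carrier := N\<rparr>) T X \<tau> x}"
  have B: "real (card B) \<le> \<epsilon> / 2 * card X" using X by (simp add: B_def sofic_approx_def)
  define E where "E g = {q \<in> F. \<pi> g \<otimes>\<^bsub>Q\<^esub> q \<notin> F}" for g
  define \<sigma> where "\<sigma> g = (\<lambda>(x, q). (\<tau> (t g q) x, \<pi> g \<otimes>\<^bsub>Q\<^esub> q))" for g
  have point: "sofic_point G S (X \<times> F) \<sigma> (x, q)"
    if x: "x \<in> X" "x \<notin> B" and q: "q \<in> F" "\<And>g. g \<in> S' \<Longrightarrow> q \<notin> E g" for x q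
  proof -
    have sp: "\<And>g. g \<in> T \<Longrightarrow> \<tau> g x \<in> X" "\<And>g h. g \<in> T \<Longrightarrow> h \<in> T \<Longrightarrow> \<tau> g (\<tau> h x) = \<tau> (g \<otimes>\<^bsub>G\<^esub> h) x"
      "\<tau> \<one>\<^bsub>G\<^esub> x = x" "\<And>g. g \<in> T \<Longrightarrow> g \<noteq> \<one>\<^bsub>G\<^esub> \<Longrightarrow> \<tau> g x \<noteq> x"
      using x by (auto simp: B_def sofic_point_def)
    have qQ: "q \<in> carrier Q" using q F by auto
    have inF: "\<pi> g \<otimes>\<^bsub>Q\<^esub> q \<in> F" if "g \<in> S'" for g using q that by (auto simp: E_def)
    have inT: "t g q \<in> T" if "g \<in> S'" "q \<in> F" for g q using that by (force simp: T_def)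
    have 1: "\<sigma> g (x, q) \<in> X \<times> F" if "g \<in> S" for g
      using that S' inF inT q sp by (auto simp: \<sigma>_def)
    have 2: "\<sigma> g (\<sigma> h (x, q)) = \<sigma> (g \<otimes>\<^bsub>G\<^esub> h) (x, q)" if "g \<in> S" "h \<in> S" for g h
    proof -
      have gh: "g \<in> carrier G" "h \<in> carrier G" "g \<in> S'" "h \<in> S'" using that S S' by auto
      have "\<tau> (t g (\<pi> h \<otimes>\<^bsub>Q\<^esub> q)) (\<tau> (t h q) x) = \<tau> (t (g \<otimes>\<^bsub>G\<^esub> h) q) x"
        using sp(2) inT inF gh q t_mult[OF gh(1,2) qQ] by simp
      thus ?thesis using gh qQ by (simp add: \<sigma>_def Q.m_assoc)
    qed
    have 3: "\<sigma> \<one>\<^bsub>G\<^esub> (x, q) = (x, q)" using sp t_one qQ by (simp add: \<sigma>_def)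
    have 4: "\<sigma> g (x, q) \<noteq> (x, q)" if g: "g \<in> S" "g \<noteq> \<one>\<^bsub>G\<^esub>" for g
    proof
      assume eq: "\<sigma> g (x, q) = (x, q)"
      have gc: "g \<in> carrier G" "g \<in> S'" using g S S' by auto
      have "\<pi> g = \<one>\<^bsub>Q\<^esub>" using eq gc qQ by (simp add: \<sigma>_def Q.r_cancel_one)
      hence "t g q = inv\<^bsub>G\<^esub> (s q) \<otimes>\<^bsub>G\<^esub> (g \<otimes>\<^bsub>G\<^esub> s q)" using qQ by (simp add: t_def)
      moreover have "inv\<^bsub>G\<^esub> (s q) \<otimes>\<^bsub>G\<^esub> (g \<otimes>\<^bsub>G\<^esub> s q) \<noteq> \<one>\<^bsub>G\<^esub>"
      proof
        assume "inv\<^bsub>G\<^esub> (s q) \<otimes>\<^bsub>G\<^esub> (g \<otimes>\<^bsub>G\<^esub> s q) = \<one>\<^bsub>G\<^esub>"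
        hence "s q \<otimes>\<^bsub>G\<^esub> (inv\<^bsub>G\<^esub> (s q) \<otimes>\<^bsub>G\<^esub> (g \<otimes>\<^bsub>G\<^esub> s q)) = s q \<otimes>\<^bsub>G\<^esub> \<one>\<^bsub>G\<^esub>" by simp
        hence "g \<otimes>\<^bsub>G\<^esub> s q = s q" using gc s[OF qQ] by (simp add: G.m_assoc[symmetric])
        thus False using g gc s[OF qQ] by (simp add: G.r_cancel_one)
      qed
      ultimately have "\<tau> (t g q) x \<noteq> x" using sp(4) inT gc q by metis
      thus False using eq by (simp add: \<sigma>_def)
    qed
    show ?thesis using 1 2 3 4 unfolding sofic_point_def by blast
  qed
  have E: "real (card (E g)) \<le> \<epsilon>1 * card F" if "g \<in> S'" for g using F(4)[OF that] by (simp add: E_def)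
  have fin: "finite B" "finite (E g)" for g using X_fin F by (auto simp: B_def E_def)
  have "{y \<in> X \<times> F. \<not> sofic_point G S (X \<times> F) \<sigma> y} \<subseteq> B \<times> F \<union> (\<Union>g\<in>S'. X \<times> E g)"
  proof
    fix y assume y: "y \<in> {y \<in> X \<times> F. \<not> sofic_point G S (X \<times> F) \<sigma> y}"
    then obtain x q where "y = (x, q)" "x \<in> X" "q \<in> F" by auto
    thus "y \<in> B \<times> F \<union> (\<Union>g\<in>S'. X \<times> E g)" using point[of x q] y by auto
  qed
  hence "card {y \<in> X \<times> F. \<not> sofic_point G S (X \<times> F) \<sigma> y} \<le> card (B \<times> F \<union> (\<Union>g\<in>S'. X \<times> E g))"
    using fin F X_fin S' by (intro card_mono) auto
  also have "\<dots> \<le> card (B \<times> F) + card (\<Union>g\<in>S'. X \<times> E g)" by (rule card_Un_le)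
  also have "\<dots> \<le> card B * card F + (\<Sum>g\<in>S'. card X * card (E g))"
    using card_UN_le[OF S'(1), of "\<lambda>g. X \<times> E g"] by (simp add: card_cartesian_product)
  finally have "real (card {y \<in> X \<times> F. \<not> sofic_point G S (X \<times> F) \<sigma> y})
      \<le> card B * card F + (\<Sum>g\<in>S'. card X * card (E g))" by linarith
  also have "\<dots> = real (card B) * card F + (\<Sum>g\<in>S'. real (card X) * card (E g))" by simp
  also have "\<dots> \<le> (\<epsilon> / 2 * card X) * card F + (\<Sum>g\<in>S'. real (card X) * (\<epsilon>1 * card F))"
    by (intro add_mono mult_right_mono B sum_mono mult_left_mono E) auto
  also have "\<dots> = \<epsilon> / 2 * (real (card X) * real (card F)) + (real (card S') * \<epsilon>1) * (real (card X) * real (card F))" by simp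
  also have "\<dots> \<le> \<epsilon> / 2 * (real (card X) * real (card F)) + \<epsilon> / 2 * (real (card X) * real (card F))"
  proof (intro add_left_mono mult_right_mono)
    show "real (card S') * \<epsilon>1 \<le> \<epsilon> / 2" using \<epsilon> by (simp add: \<epsilon>1_def field_simps)
  qed auto
  finally have "real (card {y \<in> X \<times> F. \<not> sofic_point G S (X \<times> F) \<sigma> y}) \<le> \<epsilon> * card (X \<times> F)"
    by (simp add: card_cartesian_product mult.commute)
  hence "sofic_approx G S \<epsilon> (X \<times> F) \<sigma>" using F X_fin by (auto simp: sofic_approx_def)
  thus "\<exists>(X :: (nat \<times> 'q) set) \<sigma>. sofic_approx G S \<epsilon> X \<sigma>" by blast
qed

lemma sofic_directed_union:
  assumes G: "group G" and dir: "directed_union_of G \<H>" and H: "\<And>H. H \<in> \<H> \<Longrightarrow> sofic (G\<lparr>carrier := H\<rparr>)"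
  shows "sofic G"
proof (rule soficI[where 'x = nat])
  fix S and \<epsilon> :: real
  assume S: "finite S" "S \<subseteq> carrier G" and \<epsilon>: "\<epsilon> > 0"
  have "\<exists>H\<in>\<H>. S \<subseteq> H"
    using S
  proof (induction S rule: finite_induct)
    case empty
    thus ?case using dir by (auto simp: directed_union_of_def)
  next
    case (insert g S)
    then obtain H1 where "H1 \<in> \<H>" "S \<subseteq> H1" by auto
    moreover have "g \<in> \<Union>\<H>" using insert.prems dir by (auto simp: directed_union_of_def)
    then obtain H2 where "H2 \<in> \<H>" "g \<in> H2" by blast
    ultimately show ?case using dir unfolding directed_union_of_def by (meson insert_subset subset_trans subsetD)
  qed
  then obtain H where "H \<in> \<H>" "S \<subseteq> H" by blast
  then obtain X :: "nat set" and \<sigma> where "sofic_approx (G\<lparr>carrier := H\<rparr>) S \<epsilon> X \<sigma>"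
    using H[unfolded sofic_def, rule_format, of H S \<epsilon>] S \<epsilon> by auto
  hence "sofic_approx G S \<epsilon> X \<sigma>" by (simp add: sofic_approx_def sofic_point_def)
  thus "\<exists>(X :: nat set) \<sigma>. sofic_approx G S \<epsilon> X \<sigma>" by blast
qed

lemma sofic_trivial: "sofic (G\<lparr>carrier := {\<one>\<^bsub>G\<^esub>}\<rparr>)"
proof (rule soficI[where 'x = nat])
  fix S and \<epsilon> :: real
  assume S: "finite S" "S \<subseteq> carrier (G\<lparr>carrier := {\<one>\<^bsub>G\<^esub>}\<rparr>)" and \<epsilon>: "\<epsilon> > 0"
  have "sofic_point (G\<lparr>carrier := {\<one>\<^bsub>G\<^esub>}\<rparr>) S {0::nat} (\<lambda>_ x. x) 0"
    using S by (auto simp: sofic_point_def)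
  hence none: "{x \<in> {0::nat}. \<not> sofic_point (G\<lparr>carrier := {\<one>\<^bsub>G\<^esub>}\<rparr>) S {0} (\<lambda>_ x. x) x} = {}" by blast
  have "sofic_approx (G\<lparr>carrier := {\<one>\<^bsub>G\<^esub>}\<rparr>) S \<epsilon> {0::nat} (\<lambda>_ x. x)"
    unfolding sofic_approx_def none using \<epsilon> by simp
  thus "\<exists>(X :: nat set) \<sigma>. sofic_approx (G\<lparr>carrier := {\<one>\<^bsub>G\<^esub>}\<rparr>) S \<epsilon> X \<sigma>" by blast
qed

lemma sofic_of_folner:
  assumes "group G" "folner G"
  shows "sofic G"
proof (rule sofic_extension[OF assms(1,1) _ _ _ sofic_trivial assms(2)])
  interpret group G by fact
  show "(\<lambda>g. g) \<in> hom G G" by (simp add: hom_def)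
  show "{\<one>\<^bsub>G\<^esub>} = {g \<in> carrier G. g = \<one>\<^bsub>G\<^esub>}" by auto
qed auto

lemma sofic_normal_extension:
  assumes N: "N \<lhd> G" and "sofic (G\<lparr>carrier := N\<rparr>)" "folner (G Mod N)"
  shows "sofic G"
proof -
  interpret normal N G by fact
  show ?thesis
  proof (rule sofic_extension[OF is_group factorgroup_is_group r_coset_hom_Mod _ _ assms(2,3)])
    show "(\<lambda>a. N #>\<^bsub>G\<^esub> a) ` carrier G = carrier (G Mod N)"
      by (auto simp: FactGroup_def RCOSETS_def)
    show "N = {g \<in> carrier G. N #>\<^bsub>G\<^esub> g = \<one>\<^bsub>G Mod N\<^esub>}"
      using coset_join1[OF _ _ is_subgroup] coset_join2[OF _ is_subgroup] mem_carrier
      by (auto simp: FactGroup_def)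
  qed
qed


section \<open>Amenable groups have Folner sets\<close>

text \<open>
  Rado's proof. Take a minimal subfamily \<open>R\<close> of the sets that still satisfies Hall's condition; it exists
  by Zorn's lemma because the sets are finite. If \<open>R\<close> had two elements \<open>x, y\<close> at one index \<open>i\<close>,
  the removal of each would violate the condition for some finite set of indices, and counting
  the union and the intersection of the two violating sets contradicts the condition for
  \<open>R\<close>. So \<open>R\<close> is a function, and the condition for two indices makes it injective.
\<close>

lemma infinite_hall:
  fixes A :: "'i \<Rightarrow> 'v set"
  assumes fin: "\<And>i. i \<in> I \<Longrightarrow> finite (A i)"
    and hall: "\<And>J. finite J \<Longrightarrow> J \<subseteq> I \<Longrightarrow> card J \<le> card (\<Union>i\<in>J. A i)"
  obtains f where "\<And>i. i \<in> I \<Longrightarrow> f i \<in> A i" "inj_on f I"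
proof -
  define hc where "hc R \<longleftrightarrow> (\<forall>J. finite J \<longrightarrow> J \<subseteq> I \<longrightarrow> card J \<le> card (R `` J))" for R :: "('i \<times> 'v) set"
  define A0 where "A0 = Sigma I A"
  define \<D> where "\<D> = {D. D \<subseteq> A0 \<and> hc (A0 - D)}"
  have finJ: "finite (A0 `` J)" if "finite J" for J
  proof -
    have "A0 `` J \<subseteq> (\<Union>i\<in>J \<inter> I. A i)" by (auto simp: A0_def)
    thus ?thesis using that fin by (meson finite_Int finite_UN_I finite_subset IntD2)
  qed
  have "{} \<in> \<D>"
  proof -
    have "card J \<le> card (A0 `` J)" if "finite J" "J \<subseteq> I" for J
    proof -
      have "A0 `` J = (\<Union>i\<in>J. A i)" using that by (auto simp: A0_def)
      thus ?thesis using hall that by simp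
    qed
    thus ?thesis by (auto simp: \<D>_def hc_def)
  qed
  hence "\<D> \<noteq> {}" by blast
  moreover have "\<Union>\<C> \<in> \<D>" if \<C>: "\<C> \<noteq> {}" "subset.chain \<D> \<C>" for \<C>
  proof -
    have sub: "\<C> \<subseteq> \<D>" and chain: "\<And>X Y. X \<in> \<C> \<Longrightarrow> Y \<in> \<C> \<Longrightarrow> X \<subseteq> Y \<or> Y \<subseteq> X"
      using \<C>(2) by (auto simp: subset.chain_def)
    have "card J \<le> card ((A0 - \<Union>\<C>) `` J)" if J: "finite J" "J \<subseteq> I" for J
    proof -
      define K where "K = Sigma J A \<inter> \<Union>\<C>"
      have K_fin: "finite K" using J fin unfolding K_def by (intro finite_Int disjI1 finite_SigmaI) auto
      have "\<exists>X\<in>\<C>. K \<subseteq> X"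
      proof -
        have "\<exists>X\<in>\<C>. K' \<subseteq> X" if "finite K'" "K' \<subseteq> \<Union>\<C>" for K'
          using that
        proof (induction K' rule: finite_induct)
          case (insert k K')
          then obtain X Y where "X \<in> \<C>" "K' \<subseteq> X" "Y \<in> \<C>" "k \<in> Y" by auto
          thus ?case using chain[of X Y] by (meson insert_subset subset_trans subsetD)
        qed (use \<C>(1) in auto)
        thus ?thesis using K_fin by (simp add: K_def)
      qed
      then obtain X where X: "X \<in> \<C>" "K \<subseteq> X" by blast
      hence "card J \<le> card ((A0 - X) `` J)" using sub J by (auto simp: \<D>_def hc_def)
      also have "(A0 - X) `` J \<subseteq> (A0 - \<Union>\<C>) `` J" using X by (auto simp: K_def A0_def)
      hence "card ((A0 - X) `` J) \<le> card ((A0 - \<Union>\<C>) `` J)"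
        by (rule card_mono[rotated]) (rule finite_subset[OF _ finJ[OF J(1)]], auto)
      finally show ?thesis .
    qed
    moreover have "\<Union>\<C> \<subseteq> A0" using sub by (auto simp: \<D>_def)
    ultimately show ?thesis by (auto simp: \<D>_def hc_def)
  qed
  ultimately obtain D where D: "D \<in> \<D>" "\<And>X. X \<in> \<D> \<Longrightarrow> D \<subseteq> X \<Longrightarrow> X = D"
    using subset_Zorn_nonempty[of \<D>] by metis
  define R where "R = A0 - D"
  have R_sub: "R \<subseteq> A0" and R_hc: "hc R" using D(1) by (auto simp: R_def \<D>_def)
  have hcD: "card J \<le> card (R `` J)" if "finite J" "J \<subseteq> I" for J
    using R_hc that by (simp add: hc_def)
  have R_fin: "finite (R `` J)" if "finite J" for J
    using finJ[OF that] R_sub by (meson Image_mono finite_subset order_refl)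
  have R_min: "\<not> hc (R - {(i, x)})" if "(i, x) \<in> R" for i x
  proof
    assume "hc (R - {(i, x)})"
    moreover have "R - {(i, x)} = A0 - insert (i, x) D" by (auto simp: R_def)
    moreover have "insert (i, x) D \<subseteq> A0" using that D(1) by (auto simp: R_def \<D>_def)
    ultimately have "insert (i, x) D \<in> \<D>" by (simp add: \<D>_def)
    hence "insert (i, x) D = D" using D(2)[of "insert (i, x) D"] by blast
    thus False using that by (auto simp: R_def)
  qed
  have critical: "\<exists>J. finite J \<and> J \<subseteq> I \<and> i \<notin> J \<and> card (R `` J \<union> (R `` {i} - {x})) \<le> card J"
    if ix: "(i, x) \<in> R" for i x
  proof -
    obtain J where J: "finite J" "J \<subseteq> I" "card ((R - {(i, x)}) `` J) < card J"
      using R_min[OF ix] by (auto simp: hc_def not_le)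
    have "i \<in> J"
    proof (rule ccontr)
      assume "i \<notin> J"
      hence "(R - {(i, x)}) `` J = R `` J" by auto
      thus False using J hcD[of J] by simp
    qed
    define J' where "J' = J - {i}"
    have "(R - {(i, x)}) `` J = R `` J' \<union> (R `` {i} - {x})" using \<open>i \<in> J\<close> by (auto simp: J'_def)
    moreover have "card J = Suc (card J')" using card_Suc_Diff1[OF J(1) \<open>i \<in> J\<close>] by (simp add: J'_def)
    ultimately show ?thesis using J by (intro exI[of _ J']) (auto simp: J'_def)
  qed
  have single: "x = y" if ix: "(i, x) \<in> R" and iy: "(i, y) \<in> R" for i x y
  proof (rule ccontr)
    assume xy: "x \<noteq> y"
    obtain J where J: "finite J" "J \<subseteq> I" "i \<notin> J" "card (R `` J \<union> (R `` {i} - {x})) \<le> card J"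
      using critical[OF ix] by blast
    obtain K where K: "finite K" "K \<subseteq> I" "i \<notin> K" "card (R `` K \<union> (R `` {i} - {y})) \<le> card K"
      using critical[OF iy] by blast
    define U where "U = R `` J \<union> (R `` {i} - {x})"
    define V where "V = R `` K \<union> (R `` {i} - {y})"
    have UV_fin: "finite U" "finite V" using R_fin J K by (auto simp: U_def V_def)
    have iI: "i \<in> I" using ix R_sub by (auto simp: A0_def)
    have "R `` insert i (J \<union> K) \<subseteq> U \<union> V" using xy by (auto simp: U_def V_def)
    hence "card (R `` insert i (J \<union> K)) \<le> card (U \<union> V)" using UV_fin by (intro card_mono) auto
    moreover have "card (insert i (J \<union> K)) \<le> card (R `` insert i (J \<union> K))"
      by (rule hcD) (use J K iI in auto)
    moreover have "card (insert i (J \<union> K)) = Suc (card (J \<union> K))" using J K by simp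
    ultimately have 1: "Suc (card (J \<union> K)) \<le> card (U \<union> V)" by linarith
    have "card (R `` (J \<inter> K)) \<le> card (U \<inter> V)" using UV_fin by (intro card_mono) (auto simp: U_def V_def)
    moreover have "card (J \<inter> K) \<le> card (R `` (J \<inter> K))" by (rule hcD) (use J K in auto)
    ultimately have 2: "card (J \<inter> K) \<le> card (U \<inter> V)" by linarith
    have "card U + card V = card (U \<union> V) + card (U \<inter> V)" by (rule card_Un_Int[OF UV_fin])
    moreover have "card J + card K = card (J \<union> K) + card (J \<inter> K)" by (rule card_Un_Int[OF J(1) K(1)])
    ultimately show False using 1 2 J(4) K(4) by (simp add: U_def V_def)
  qed
  have ex: "\<exists>x. (i, x) \<in> R" if "i \<in> I" for i
  proof (rule ccontr)
    assume "\<nexists>x. (i, x) \<in> R"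
    hence "R `` {i} = {}" by auto
    moreover have "card {i} \<le> card (R `` {i})" by (rule hcD) (use that in auto)
    ultimately show False by simp
  qed
  define f where "f i = (SOME x. (i, x) \<in> R)" for i
  have f: "(i, f i) \<in> R" if "i \<in> I" for i using someI_ex[OF ex[OF that]] by (simp add: f_def)
  show ?thesis
  proof (rule that[of f])
    show "f i \<in> A i" if "i \<in> I" for i using f[OF that] R_sub by (auto simp: A0_def)
    show "inj_on f I"
    proof (rule inj_onI, rule ccontr)
      fix i j assume ij: "i \<in> I" "j \<in> I" "f i = f j" "i \<noteq> j"
      have "x = f i" if "(k, x) \<in> R" "k \<in> {i, j}" for k x
        using single[OF that(1) f] that(2) ij by auto
      hence "R `` {i, j} \<subseteq> {f i}" by blast
      hence "card (R `` {i, j}) \<le> 1" using card_mono[of "{f i}"] by fastforce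
      moreover have "card {i, j} \<le> card (R `` {i, j})" by (rule hcD) (use ij in auto)
      ultimately show False using ij by simp
    qed
  qed
qed

text \<open>
  If no finite set is almost invariant, then multiplication by \<open>S \<union> {1}\<close> enlarges every finite set by a
  factor \<open>1 + \<epsilon>\<close>; this is iterated until the factor exceeds 2.
\<close>

lemma not_folner_doubling:
  fixes G :: "('a, 'b) monoid_scheme" (structure)
  assumes G: "group G" and nf: "\<not> folner G"
  obtains T where "finite T" "T \<subseteq> carrier G"
    "\<And>F. finite F \<Longrightarrow> F \<subseteq> carrier G \<Longrightarrow> 2 * card F \<le> card ((\<lambda>(t, q). t \<otimes> q) ` (T \<times> F))"
proof -
  interpret group G by fact
  obtain S and \<epsilon> :: real where S: "finite S" "S \<subseteq> carrier G" "\<epsilon> > 0"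
    "\<And>F. finite F \<Longrightarrow> F \<noteq> {} \<Longrightarrow> F \<subseteq> carrier G \<Longrightarrow> \<exists>s\<in>S. real (card {q \<in> F. s \<otimes> q \<notin> F}) > \<epsilon> * card F"
  proof -
    obtain S and \<epsilon> :: real where neg: "\<not> (finite S \<longrightarrow> S \<subseteq> carrier G \<longrightarrow> \<epsilon> > 0 \<longrightarrow>
       (\<exists>F. finite F \<and> F \<noteq> {} \<and> F \<subseteq> carrier G \<and>
          (\<forall>s\<in>S. real (card {q \<in> F. s \<otimes> q \<notin> F}) \<le> \<epsilon> * card F)))"
      using nf unfolding folner_def not_all by (elim exE) (rule that)
    hence S: "finite S \<and> S \<subseteq> carrier G \<and> \<epsilon> > 0 \<and>
       \<not> (\<exists>F. finite F \<and> F \<noteq> {} \<and> F \<subseteq> carrier G \<and>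
          (\<forall>s\<in>S. real (card {q \<in> F. s \<otimes> q \<notin> F}) \<le> \<epsilon> * card F))"
      unfolding not_imp .
    have "\<exists>s\<in>S. real (card {q \<in> F. s \<otimes> q \<notin> F}) > \<epsilon> * card F"
      if F: "finite F" "F \<noteq> {}" "F \<subseteq> carrier G" for F
    proof (rule ccontr)
      assume "\<not> (\<exists>s\<in>S. real (card {q \<in> F. s \<otimes> q \<notin> F}) > \<epsilon> * card F)"
      hence "\<forall>s\<in>S. real (card {q \<in> F. s \<otimes> q \<notin> F}) \<le> \<epsilon> * card F" by (simp add: not_less)
      thus False using S F by blast
    qed
    thus ?thesis using that[of S \<epsilon>] S by blast
  qed
  define pr where "pr T F = (\<lambda>(t, q). t \<otimes> q) ` (T \<times> F)" for T F
  define U where "U = insert \<one> S"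
  have U: "finite U" "U \<subseteq> carrier G" using S by (auto simp: U_def)
  have pr_closed: "finite (pr T F)" "pr T F \<subseteq> carrier G"
    if "finite T" "T \<subseteq> carrier G" "finite F" "F \<subseteq> carrier G" for T F
    using that by (auto simp: pr_def)
  have prI: "t \<otimes> q \<in> pr T F" if "t \<in> T" "q \<in> F" for t q T F
    unfolding pr_def by (rule image_eqI[of _ _ "(t, q)"]) (use that in auto)
  have pr_assoc: "pr (pr T T') F = pr T (pr T' F)"
    if "T \<subseteq> carrier G" "T' \<subseteq> carrier G" "F \<subseteq> carrier G" for T T' F
  proof
    show "pr (pr T T') F \<subseteq> pr T (pr T' F)"
    proof
      fix z assume "z \<in> pr (pr T T') F"
      then obtain a b c where z: "a \<in> T" "b \<in> T'" "c \<in> F" "z = (a \<otimes> b) \<otimes> c" by (auto simp: pr_def)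
      hence "z = a \<otimes> (b \<otimes> c)" using that by (simp add: m_assoc subset_iff)
      thus "z \<in> pr T (pr T' F)" using z by (simp add: prI)
    qed
    show "pr T (pr T' F) \<subseteq> pr (pr T T') F"
    proof
      fix z assume "z \<in> pr T (pr T' F)"
      then obtain a b c where z: "a \<in> T" "b \<in> T'" "c \<in> F" "z = a \<otimes> (b \<otimes> c)" by (auto simp: pr_def)
      hence "z = (a \<otimes> b) \<otimes> c" using that by (simp add: m_assoc subset_iff)
      thus "z \<in> pr (pr T T') F" using z by (simp add: prI)
    qed
  qed
  have grow: "(1 + \<epsilon>) * card F \<le> card (pr U F)" if F: "finite F" "F \<subseteq> carrier G" for F
  proof (cases "F = {}")
    case False
    then obtain s where s: "s \<in> S" "real (card {q \<in> F. s \<otimes> q \<notin> F}) > \<epsilon> * card F" using S(4) F by blast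
    define E where "E = (\<lambda>q. s \<otimes> q) ` {q \<in> F. s \<otimes> q \<notin> F}"
    have "inj_on (\<lambda>q. s \<otimes> q) {q \<in> F. s \<otimes> q \<notin> F}"
      using s S F by (auto simp: inj_on_def subset_iff)
    hence cE: "card E = card {q \<in> F. s \<otimes> q \<notin> F}" by (simp add: E_def card_image)
    have "F \<union> E \<subseteq> pr U F"
    proof -
      have "q \<in> pr U F" if "q \<in> F" for q
        using prI[of \<one> U q F] that F by (auto simp: U_def subset_iff)
      moreover have "E \<subseteq> pr U F" using s prI[of s U] by (auto simp: E_def U_def)
      ultimately show ?thesis by blast
    qed
    hence "card (F \<union> E) \<le> card (pr U F)" using pr_closed[OF U F] by (intro card_mono) auto
    moreover have "card (F \<union> E) = card F + card E" using F by (intro card_Un_disjoint) (auto simp: E_def)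
    ultimately have "real (card F) + card E \<le> card (pr U F)" by linarith
    thus ?thesis using s(2) cE by (simp add: algebra_simps)
  qed simp
  obtain n where n: "2 < (1 + \<epsilon>) ^ n" using real_arch_pow[of "1 + \<epsilon>" 2] S(3) by auto
  define T where "T k = ((pr U) ^^ k) {\<one>}" for k
  have T: "finite (T k) \<and> T k \<subseteq> carrier G" for k
    by (induction k) (use pr_closed[OF U] in \<open>auto simp: T_def\<close>)
  have "(1 + \<epsilon>) ^ k * card F \<le> card (pr (T k) F)" if F: "finite F" "F \<subseteq> carrier G" for k F
  proof (induction k)
    case 0
    have "pr {\<one>} F = (\<lambda>q. \<one> \<otimes> q) ` F" by (auto simp: pr_def)
    also have "\<dots> = F" using F by (simp add: subset_iff)
    finally have "pr {\<one>} F = F" .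
    thus ?case by (simp add: T_def)
  next
    case (Suc k)
    have "T (Suc k) = pr U (T k)" by (simp add: T_def)
    hence eq: "pr (T (Suc k)) F = pr U (pr (T k) F)" using pr_assoc U T F by simp
    have "(1 + \<epsilon>) ^ Suc k * card F = (1 + \<epsilon>) * ((1 + \<epsilon>) ^ k * card F)" by simp
    also have "\<dots> \<le> (1 + \<epsilon>) * card (pr (T k) F)" using Suc S(3) by (intro mult_left_mono) auto
    also have "\<dots> \<le> card (pr U (pr (T k) F))" using pr_closed T F by (intro grow) auto
    finally show ?case by (simp add: eq)
  qed
  note growth = this
  have "2 * card F \<le> card (pr (T n) F)" if "finite F" "F \<subseteq> carrier G" for F
  proof -
    have "2 * real (card F) \<le> (1 + \<epsilon>) ^ n * card F" using n by (intro mult_right_mono) auto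
    also have "\<dots> \<le> card (pr (T n) F)" by (rule growth[OF that])
    finally show ?thesis by linarith
  qed
  thus ?thesis using that[of "T n"] T unfolding pr_def by blast
qed

lemma invariant_mean_sum:
  assumes m: "invariant_mean G m" and K: "finite K" and f: "\<And>i. i \<in> K \<Longrightarrow> f i \<in> bounded_fun G"
  shows "(\<lambda>x. \<Sum>i\<in>K. f i x) \<in> bounded_fun G \<and> m (\<lambda>x. \<Sum>i\<in>K. f i x) = (\<Sum>i\<in>K. m (f i))"
  using K f
proof (induction K rule: finite_induct)
  case empty
  have b: "(\<lambda>_. 0::real) \<in> bounded_fun G" unfolding bounded_fun_def bounded_iff by (auto intro: exI[of _ 0])
  have "\<forall>c. \<forall>f\<in>bounded_fun G. m (\<lambda>x. c * f x) = c * m f" using m unfolding invariant_mean_def by blast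
  from this[rule_format, OF b, of 0] show ?case using b by simp
next
  case (insert i K)
  hence 1: "f i \<in> bounded_fun G" "(\<lambda>x. \<Sum>i\<in>K. f i x) \<in> bounded_fun G"
    "m (\<lambda>x. \<Sum>i\<in>K. f i x) = (\<Sum>i\<in>K. m (f i))" by auto
  obtain a b where "\<forall>x\<in>carrier G. \<bar>f i x\<bar> \<le> a" "\<forall>x\<in>carrier G. \<bar>\<Sum>i\<in>K. f i x\<bar> \<le> b"
    using 1 unfolding bounded_fun_def bounded_iff by auto
  hence "\<forall>x\<in>carrier G. \<bar>f i x + (\<Sum>i\<in>K. f i x)\<bar> \<le> a + b" by (meson abs_triangle_ineq add_mono order_trans)
  hence "(\<lambda>x. f i x + (\<Sum>i\<in>K. f i x)) \<in> bounded_fun G" unfolding bounded_fun_def bounded_iff by auto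
  moreover have "m (\<lambda>x. f i x + (\<Sum>i\<in>K. f i x)) = m (f i) + m (\<lambda>x. \<Sum>i\<in>K. f i x)"
  proof -
    have "\<forall>f\<in>bounded_fun G. \<forall>g\<in>bounded_fun G. m (\<lambda>x. f x + g x) = m f + m g"
      using m unfolding invariant_mean_def by blast
    from this[rule_format, OF 1(1,2)] show ?thesis .
  qed
  ultimately show ?case using insert 1 by simp
qed

text \<open>
  A doubling and Hall's theorem give an injection \<open>f\<close> of two copies of the group into the group that
  moves every element by left multiplication with some \<open>t\<close> from a finite set \<open>T\<close>. The sets on which
  copy \<open>b\<close> is moved by \<open>t\<close> have total mean 2, because they cover the group once for each of the two
  copies. Their translates by \<open>t\<close> are disjoint and have total mean at most 1. This contradicts
  invariance.
\<close>

lemma folner_of_amenable: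
  fixes G :: "('a, 'b) monoid_scheme" (structure)
  assumes "amenable G"
  shows "folner G"
proof (rule ccontr)
  assume nf: "\<not> folner G"
  have G: "group G" using assms by (simp add: amenable_def)
  interpret group G by fact
  obtain m where m: "invariant_mean G m" using assms by (auto simp: amenable_def)
  obtain T where T: "finite T" "T \<subseteq> carrier G"
    "\<And>F. finite F \<Longrightarrow> F \<subseteq> carrier G \<Longrightarrow> 2 * card F \<le> card ((\<lambda>(t, q). t \<otimes> q) ` (T \<times> F))"
    using not_folner_doubling[OF G nf] by metis
  define A where "A i = (\<lambda>t. t \<otimes> fst i) ` T" for i :: "'a \<times> bool"
  obtain f where f: "\<And>i. i \<in> carrier G \<times> UNIV \<Longrightarrow> f i \<in> A i" "inj_on f (carrier G \<times> (UNIV :: bool set))"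
  proof (rule infinite_hall[of "carrier G \<times> (UNIV :: bool set)" A])
    show "finite (A i)" for i using T by (simp add: A_def)
    fix J assume J: "finite J" "J \<subseteq> carrier G \<times> (UNIV :: bool set)"
    have "card J \<le> card (fst ` J \<times> (UNIV :: bool set))"
      using J by (intro card_mono) (auto simp: image_iff, metis fst_conv)
    also have "\<dots> = 2 * card (fst ` J)" by (simp add: card_cartesian_product)
    also have "\<dots> \<le> card ((\<lambda>(t, q). t \<otimes> q) ` (T \<times> fst ` J))" using J by (intro T(3)) auto
    also have "(\<lambda>(t, q). t \<otimes> q) ` (T \<times> fst ` J) = (\<Union>i\<in>J. A i)" by (force simp: A_def)
    finally show "card J \<le> card (\<Union>i\<in>J. A i)" .
  qed (use that in blast)
  define I where "I t b g = (if g \<in> carrier G \<and> f (g, b) = t \<otimes> g then 1 else 0 :: real)" for t b g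
  have I_bounded: "I t b \<in> bounded_fun G" "(\<lambda>x. I t b (inv t \<otimes> x)) \<in> bounded_fun G" for t b
    unfolding bounded_fun_def bounded_iff by (auto simp: I_def intro!: exI[of _ 1])
  define K where "K = T \<times> (UNIV :: bool set)"
  have K: "finite K" using T by (simp add: K_def)
  define k where "k x = (\<Sum>(t, b)\<in>K. I t b x)" for x
  define h where "h x = (\<Sum>(t, b)\<in>K. I t b (inv t \<otimes> x))" for x
  have k: "k \<in> bounded_fun G" "m k = (\<Sum>(t, b)\<in>K. m (I t b))"
    using invariant_mean_sum[OF m K, of "\<lambda>(t, b). I t b"] I_bounded
    unfolding k_def by (auto simp: case_prod_beta)
  have h: "h \<in> bounded_fun G" "m h = (\<Sum>(t, b)\<in>K. m (\<lambda>x. I t b (inv t \<otimes> x)))"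
    using invariant_mean_sum[OF m K, of "\<lambda>(t, b) x. I t b (inv t \<otimes> x)"] I_bounded
    unfolding h_def by (auto simp: case_prod_beta)
  have "\<forall>g\<in>carrier G. \<forall>f\<in>bounded_fun G. m (\<lambda>x. f (inv g \<otimes> x)) = m f"
    using m unfolding invariant_mean_def by blast
  hence "m (\<lambda>x. I t b (inv t \<otimes> x)) = m (I t b)" if "t \<in> T" for t b
    using I_bounded T that by blast
  hence "m h = m k" unfolding h k by (intro sum.cong) (auto simp: K_def)
  have kx: "k x = 2" if x: "x \<in> carrier G" for x
  proof -
    have "(\<Sum>t\<in>T. I t b x) = 1" for b
    proof -
      obtain t0 where t0: "t0 \<in> T" "f (x, b) = t0 \<otimes> x" using f(1)[of "(x, b)"] x by (auto simp: A_def)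
      have "I t b x = (if t = t0 then 1 else 0)" if "t \<in> T" for t
        using that t0 x T by (auto simp: I_def subset_iff)
      thus ?thesis using t0 T by simp
    qed
    moreover have "k x = (\<Sum>b\<in>UNIV. \<Sum>t\<in>T. I t b x)"
      unfolding k_def K_def sum.cartesian_product[symmetric] by (rule sum.swap)
    ultimately show ?thesis by simp
  qed
  have hx: "h x \<le> 1" if x: "x \<in> carrier G" for x
  proof -
    define L where "L = {(t, b) \<in> K. f (inv t \<otimes> x, b) = x}"
    have "I t b (inv t \<otimes> x) = (if f (inv t \<otimes> x, b) = x then 1 else 0)" if "t \<in> T" for t b
      using that x T by (auto simp: I_def subset_iff m_assoc[symmetric])
    hence "h x = (\<Sum>i\<in>K. if i \<in> L then 1 else 0)"
      unfolding h_def by (intro sum.cong) (auto simp: L_def K_def split: if_splits)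
    also have "\<dots> = card (K \<inter> L)" using K by (simp add: sum.If_cases)
    also have "K \<inter> L = L" by (auto simp: L_def)
    also have "card L \<le> 1"
    proof -
      have "i = j" if "i \<in> L" "j \<in> L" for i j
      proof -
        obtain t b t' b' where ij: "i = (t, b)" "j = (t', b')" by fastforce
        have tc: "t \<in> carrier G" "t' \<in> carrier G" using that ij T by (auto simp: L_def K_def)
        have "f (inv t \<otimes> x, b) = f (inv t' \<otimes> x, b')" using that ij by (auto simp: L_def)
        hence "inv t \<otimes> x = inv t' \<otimes> x" "b = b'"
          using inj_onD[OF f(2), of "(inv t \<otimes> x, b)" "(inv t' \<otimes> x, b')"] tc x by auto
        hence "inv t \<otimes> x \<otimes> inv x = inv t' \<otimes> x \<otimes> inv x" by simp
        hence "inv t = inv t'" using tc x by (simp add: m_assoc)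
        hence "t = t'" using tc by (metis inv_inv)
        thus ?thesis using ij \<open>b = b'\<close> by simp
      qed
      hence "L = {} \<or> (\<exists>i. L = {i})" by blast
      thus ?thesis by auto
    qed
    finally show ?thesis by simp
  qed
  have ne: "carrier G \<noteq> {}" by auto
  have "2 \<le> (INF x\<in>carrier G. k x)" using kx ne by simp
  also have "\<dots> \<le> m k" using m k(1) unfolding invariant_mean_def by blast
  also have "\<dots> = m h" using \<open>m h = m k\<close> by simp
  also have "\<dots> \<le> (SUP x\<in>carrier G. h x)" using m h(1) unfolding invariant_mean_def by blast
  also have "\<dots> \<le> 1" using hx ne by (intro cSUP_least) auto
  finally show False by simp
qed

lemma sofic_of_amenable: "amenable G \<Longrightarrow> sofic G"
  using sofic_of_folner folner_of_amenable by (auto simp: amenable_def)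

section \<open>Free groups\<close>


lemma extend_to_permutation:
  assumes Y: "finite Y" and A: "A \<subseteq> Y" and f: "inj_on f A" "f ` A \<subseteq> Y"
  shows "\<exists>p. p permutes Y \<and> (\<forall>x\<in>A. p x = f x)"
proof -
  have "card (Y - A) = card (Y - f ` A)"
    using Y A f by (simp add: card_Diff_subset card_image finite_subset)
  then obtain h where h: "bij_betw h (Y - A) (Y - f ` A)"
    using Y finite_same_card_bij[of "Y - A" "Y - f ` A"] by auto
  define p where "p x = (if x \<in> A then f x else if x \<in> Y then h x else x)" for x
  have "bij_betw p A (f ` A)"
    using f(1) by (simp add: bij_betw_def inj_on_def p_def image_def)
  moreover have "bij_betw p (Y - A) (Y - f ` A)"
    using h by (rule bij_betw_cong[THEN iffD1, rotated]) (auto simp: p_def)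
  ultimately have "bij_betw p (A \<union> (Y - A)) (f ` A \<union> (Y - f ` A))"
    by (rule bij_betw_combine) auto
  moreover have "A \<union> (Y - A) = Y" "f ` A \<union> (Y - f ` A) = Y" using A f by auto
  ultimately have "p permutes Y" by (intro bij_imp_permutes) (use A in \<open>auto simp: p_def\<close>)
  thus ?thesis by (intro exI[of _ p]) (auto simp: p_def)
qed

text \<open>
  The partial map on the positions \<open>0, \<dots>, length w\<close> by which \<open>s\<close> has to act in order that the letter
  \<open>w ! i\<close> always moves position \<open>i + 1\<close> to position \<open>i\<close>.
\<close>

definition letter_moves :: "('a \<times> bool) list \<Rightarrow> 'a \<Rightarrow> nat \<Rightarrow> nat" where
  "letter_moves w s k = (if k > 0 \<and> w ! (k - 1) = (s, True) then k - 1 else Suc k)"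

definition letter_domain :: "('a \<times> bool) list \<Rightarrow> 'a \<Rightarrow> nat set" where
  "letter_domain w s = {k. k \<le> length w \<and> (k > 0 \<and> w ! (k - 1) = (s, True) \<or> k < length w \<and> w ! k = (s, False))}"

lemma reduced_word_nth:
  assumes "reduced_word w" "Suc i < length w"
  shows "\<not> (fst (w ! i) = fst (w ! Suc i) \<and> snd (w ! i) \<noteq> snd (w ! Suc i))"
  using assms unfolding reduced_word_def by (rule successively_nth)

text \<open>
  Two positions with the same image would belong to adjacent letters that are inverse to each other.
\<close>

lemma inj_on_letter_moves:
  assumes w: "reduced_word w"
  shows "inj_on (letter_moves w s) (letter_domain w s)"
proof (rule inj_onI)
  fix k l assume kl: "k \<in> letter_domain w s" "l \<in> letter_domain w s" "letter_moves w s k = letter_moves w s l"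
  define P where "P n \<longleftrightarrow> n > 0 \<and> w ! (n - 1) = (s, True)" for n
  have moves: "letter_moves w s n = (if P n then n - 1 else Suc n)" for n
    by (simp add: letter_moves_def P_def)
  have clash: False if "k' \<in> letter_domain w s" "l' \<in> letter_domain w s" "P k'" "\<not> P l'" "k' - 1 = Suc l'" for k' l'
  proof -
    have "w ! l' = (s, False)" "w ! Suc l' = (s, True)" "Suc l' < length w"
      using that by (auto simp: letter_domain_def P_def)
    thus False using reduced_word_nth[OF w, of l'] by simp
  qed
  show "k = l"
  proof (cases "P k"; cases "P l")
    assume "P k" "P l"
    moreover from this have "k > 0" "l > 0" by (simp_all add: P_def)
    ultimately show ?thesis using kl(3) unfolding moves by simp
  next
    assume P: "P k" "\<not> P l"
    hence "k - 1 = Suc l" using kl(3) unfolding moves by simp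
    thus ?thesis using clash[OF kl(1,2) P] by blast
  next
    assume P: "\<not> P k" "P l"
    hence "l - 1 = Suc k" using kl(3) unfolding moves by simp
    thus ?thesis using clash[OF kl(2,1) P(2,1)] by blast
  next
    assume "\<not> P k" "\<not> P l"
    thus ?thesis using kl(3) unfolding moves by simp
  qed
qed

lemma letter_permutation_exists:
  assumes w: "reduced_word w"
  shows "\<exists>p. p permutes {..length w} \<and> (\<forall>i<length w. w ! i = (s, True) \<longrightarrow> p (Suc i) = i)
    \<and> (\<forall>i<length w. w ! i = (s, False) \<longrightarrow> p i = Suc i)"
proof -
  have "letter_moves w s ` letter_domain w s \<subseteq> {..length w}"
    by (auto simp: letter_moves_def letter_domain_def Suc_le_eq)
  then obtain p where p: "p permutes {..length w}" "\<forall>k\<in>letter_domain w s. p k = letter_moves w s k"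
    using extend_to_permutation[of "{..length w}" "letter_domain w s" "letter_moves w s"]
      inj_on_letter_moves[OF w] by (auto simp: letter_domain_def)
  have "p (Suc i) = i" if "i < length w" "w ! i = (s, True)" for i
    using p(2) that by (auto simp: letter_domain_def letter_moves_def)
  moreover have "p i = Suc i" if i: "i < length w" "w ! i = (s, False)" for i
  proof -
    have "\<not> (i > 0 \<and> w ! (i - 1) = (s, True))"
    proof
      assume a: "i > 0 \<and> w ! (i - 1) = (s, True)"
      thus False using reduced_word_nth[OF w, of "i - 1"] i by auto
    qed
    moreover have "i \<in> letter_domain w s" using i by (auto simp: letter_domain_def)
    ultimately show ?thesis using p(2) by (auto simp: letter_moves_def)
  qed
  ultimately show ?thesis using p(1) by blast
qed

text \<open>
  The action of a word when the generators act by the permutations \<open>f\<close>; the counterpart of the value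
  of the word in the group.
\<close>

definition word_action :: "('a \<Rightarrow> 'y \<Rightarrow> 'y) \<Rightarrow> ('a \<times> bool) list \<Rightarrow> 'y \<Rightarrow> 'y" where
  "word_action f w = foldr (\<lambda>(s, e) p. (if e then f s else inv_into UNIV (f s)) \<circ> p) w id"

lemma word_action_Nil [simp]: "word_action f [] = id"
  by (simp add: word_action_def)

lemma word_action_Cons [simp]: "word_action f ((s, e) # w) = (if e then f s else inv_into UNIV (f s)) \<circ> word_action f w"
  by (simp add: word_action_def)

lemma word_action_append: "word_action f (u @ v) = word_action f u \<circ> word_action f v"
  by (induction u) auto

lemma word_action_permutes:
  assumes "\<And>s. f s permutes Y"
  shows "word_action f w permutes Y"
proof (induction w)
  case Nil
  show ?case unfolding word_action_Nil by (rule permutes_id)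
next
  case (Cons a w)
  obtain s e where a: "a = (s, e)" by fastforce
  have "(if e then f s else inv_into UNIV (f s)) permutes Y"
    using assms[of s] permutes_inv[OF assms[of s]] by simp
  thus ?case unfolding a word_action_Cons by (rule permutes_compose[OF Cons])
qed

context group
begin

lemma word_value_Nil [simp]: "word_value G [] = \<one>"
  by (simp add: word_value_def)

lemma word_value_Cons [simp]: "word_value G ((s, e) # w) = (if e then s else inv s) \<otimes> word_value G w"
  by (simp add: word_value_def)

lemma word_value_closed:
  assumes "S \<subseteq> carrier G" "w \<in> words_over S"
  shows "word_value G w \<in> carrier G"
  using assms(2) by (induction w) (use assms(1) in \<open>auto simp: words_over_def\<close>)

lemma word_value_append:
  assumes "S \<subseteq> carrier G" "u \<in> words_over S" "v \<in> words_over S"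
  shows "word_value G (u @ v) = word_value G u \<otimes> word_value G v"
  using assms(2)
proof (induction u)
  case (Cons a u)
  obtain s e where a: "a = (s, e)" by fastforce
  have "s \<in> carrier G" "u \<in> words_over S" using Cons.prems assms(1) by (auto simp: a words_over_def)
  thus ?case using Cons.IH word_value_closed[OF assms(1)] assms(3) by (simp add: a m_assoc)
qed (use word_value_closed[OF assms(1,3)] in simp)

text \<open>
  Cancellation changes neither the value of a word nor its action. Through this lemma the action of
  reduced words becomes a homomorphism.
\<close>

lemma reduce_word:
  fixes f :: "'a \<Rightarrow> 'y \<Rightarrow> 'y"
  assumes S: "S \<subseteq> carrier G" and f: "\<And>s. bij (f s)" and u: "u \<in> words_over S"
  shows "\<exists>r. r \<in> words_over S \<and> reduced_word r \<and> word_value G r = word_value G u \<and> word_action f r = word_action f u"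
  using u
proof (induction u)
  case Nil
  thus ?case by (intro exI[of _ "[]"]) (auto simp: reduced_word_def)
next
  case (Cons a u)
  obtain s e where a: "a = (s, e)" by fastforce
  have s: "s \<in> S" "s \<in> carrier G" and "u \<in> words_over S" using Cons.prems S by (auto simp: a words_over_def)
  then obtain r where r: "r \<in> words_over S" "reduced_word r" "word_value G r = word_value G u" "word_action f r = word_action f u"
    using Cons.IH by blast
  show ?case
  proof (cases "\<exists>r'. r = (s, \<not> e) # r'")
    case True
    then obtain r' where r': "r = (s, \<not> e) # r'" by blast
    have r'S: "r' \<in> words_over S" using r(1) r' by (auto simp: words_over_def)
    have "reduced_word r'" using r(2) r' by (cases r') (auto simp: reduced_word_def)
    moreover have "word_value G r' = word_value G (a # u)"
      using r(3)[symmetric] s word_value_closed[OF S r'S] by (simp add: a r' m_assoc[symmetric])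
    moreover have "word_action f r' = word_action f (a # u)"
    proof -
      have "f s \<circ> (inv_into UNIV (f s) \<circ> g) = g" "inv_into UNIV (f s) \<circ> (f s \<circ> g) = g" for g :: "'y \<Rightarrow> 'y"
        using f[of s] by (auto simp: fun_eq_iff bij_is_inj bij_is_surj surj_f_inv_f)
      thus ?thesis using r(4)[symmetric] by (simp add: a r')
    qed
    ultimately show ?thesis using r'S by blast
  next
    case False
    have "reduced_word (a # r)"
      using r(2) False by (cases r) (auto simp: reduced_word_def a)
    moreover have "a # r \<in> words_over S" using r(1) s by (auto simp: a words_over_def)
    ultimately show ?thesis using r(3,4) by (intro exI[of _ "a # r"]) (auto simp: a)
  qed
qed

end

text \<open>
  Let \<open>Y\<close> be the disjoint union of the intervals \<open>0, \<dots>, length w\<close> for the reduced words \<open>w\<close> of the given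
  finitely many elements. The generators permute \<open>Y\<close> in such a way that each of these words \<open>w\<close>
  moves the last position of its own interval to 0, so that only the trivial element acts trivially.
  To obtain an action without fixed points, let the group act by composition on the finite set of all
  permutations of \<open>Y\<close>.
\<close>

lemma sofic_of_free_group:
  fixes G :: "('a, 'b) monoid_scheme"
  assumes "free_group G"
  shows "sofic G"
proof (rule soficI[where 'x = "('a \<times> bool) list \<times> nat \<Rightarrow> ('a \<times> bool) list \<times> nat"])
  fix T and \<epsilon> :: real
  assume T: "finite T" "T \<subseteq> carrier G" and \<epsilon>: "\<epsilon> > 0"
  obtain S where grp: "group G" and S: "S \<subseteq> carrier G"
    and bij: "bij_betw (word_value G) {w \<in> words_over S. reduced_word w} (carrier G)"
    using assms by (auto simp: free_group_def free_basis_def)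
  interpret group G by fact
  define nf where "nf = inv_into {w \<in> words_over S. reduced_word w} (word_value G)"
  have nf: "nf g \<in> words_over S" "reduced_word (nf g)" "word_value G (nf g) = g" if "g \<in> carrier G" for g
  proof -
    have "g \<in> word_value G ` {w \<in> words_over S. reduced_word w}" using bij that by (simp add: bij_betw_def)
    from inv_into_into[OF this] f_inv_into_f[OF this]
    show "nf g \<in> words_over S" "reduced_word (nf g)" "word_value G (nf g) = g" by (auto simp: nf_def)
  qed
  have nf_eq: "nf (word_value G w) = w" if "w \<in> words_over S" "reduced_word w" for w
    unfolding nf_def using bij that by (intro inv_into_f_f) (auto simp: bij_betw_def)
  define W where "W = nf ` T"
  have W: "finite W" "\<And>w. w \<in> W \<Longrightarrow> reduced_word w" using T nf by (auto simp: W_def)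
  define Y where "Y = Sigma W (\<lambda>w. {..length w})"
  have Y: "finite Y" using W by (simp add: Y_def)
  have "\<exists>p. \<forall>w\<in>W. p w permutes {..length w} \<and> (\<forall>i<length w. w ! i = (s, True) \<longrightarrow> p w (Suc i) = i)
    \<and> (\<forall>i<length w. w ! i = (s, False) \<longrightarrow> p w i = Suc i)" for s
    using letter_permutation_exists[OF W(2)] by (intro bchoice) blast
  then obtain p where p: "\<And>s w. w \<in> W \<Longrightarrow> p s w permutes {..length w}"
    "\<And>s w i. w \<in> W \<Longrightarrow> i < length w \<Longrightarrow> w ! i = (s, True) \<Longrightarrow> p s w (Suc i) = i"
    "\<And>s w i. w \<in> W \<Longrightarrow> i < length w \<Longrightarrow> w ! i = (s, False) \<Longrightarrow> p s w i = Suc i"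
    by metis
  define f where "f s y = (if y \<in> Y then (fst y, p s (fst y) (snd y)) else y)" for s y
  have f_perm: "f s permutes Y" for s
  proof (rule bij_imp_permutes)
    have "inj_on (f s) Y"
    proof (rule inj_onI)
      fix y z assume yz: "y \<in> Y" "z \<in> Y" "f s y = f s z"
      hence "fst y = fst z" "p s (fst y) (snd y) = p s (fst y) (snd z)" by (auto simp: f_def)
      moreover have "inj (p s (fst y))" using p(1)[of "fst y" s] yz(1) by (auto simp: Y_def intro: permutes_inj)
      ultimately show "y = z" by (metis injD prod_eqI)
    qed
    moreover have "f s ` Y \<subseteq> Y"
    proof (rule image_subsetI)
      fix y assume y: "y \<in> Y"
      hence "p s (fst y) (snd y) \<in> {..length (fst y)}"
        using permutes_in_image[OF p(1)[of "fst y" s]] by (auto simp: Y_def)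
      thus "f s y \<in> Y" using y by (auto simp: f_def Y_def)
    qed
    ultimately show "bij_betw (f s) Y Y" using Y by (simp add: bij_betw_def endo_inj_surj)
  qed (auto simp: f_def)
  have f_bij: "bij (f s)" for s using f_perm by (rule permutes_bij)
  define \<phi> where "\<phi> g = word_action f (nf g)" for g
  have \<phi>_mult: "\<phi> (g \<otimes>\<^bsub>G\<^esub> h) = \<phi> g \<circ> \<phi> h" if g: "g \<in> carrier G" and h: "h \<in> carrier G" for g h
  proof -
    have "nf g @ nf h \<in> words_over S" using nf(1)[OF g] nf(1)[OF h] by (simp add: words_over_def)
    from reduce_word[of S f, OF S f_bij this]
    obtain r where r: "r \<in> words_over S" "reduced_word r"
      "word_value G r = word_value G (nf g @ nf h)" "word_action f r = word_action f (nf g @ nf h)"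
      by (elim exE conjE) (rule that)
    have "word_value G r = g \<otimes>\<^bsub>G\<^esub> h" using r(3) word_value_append[OF S] nf[OF g] nf[OF h] by simp
    hence "nf (g \<otimes>\<^bsub>G\<^esub> h) = r" using nf_eq[OF r(1,2)] by simp
    thus ?thesis using r(4) by (simp add: \<phi>_def word_action_append)
  qed
  have nf_one: "nf \<one>\<^bsub>G\<^esub> = []"
    using nf_eq[of "[]"] by (simp add: words_over_def reduced_word_def)
  have \<phi>_perm: "\<phi> g permutes Y" for g unfolding \<phi>_def by (rule word_action_permutes[OF f_perm])
  have \<phi>_moves: "\<phi> g \<noteq> id" if g: "g \<in> T" "g \<noteq> \<one>\<^bsub>G\<^esub>" for g
  proof -
    define w where "w = nf g"
    have w: "w \<in> W" using g by (simp add: w_def W_def)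
    have w_ne: "w \<noteq> []"
      using nf(3)[of g] g T by (auto simp: w_def)
    have "word_action f (drop i w) (w, length w) = (w, i)" if "i \<le> length w" for i
      using that
    proof (induction rule: inc_induct)
      case base
      show ?case by simp
    next
      case (step i)
      obtain s e where se: "w ! i = (s, e)" by fastforce
      have "drop i w = (s, e) # drop (Suc i) w" using step(2) se by (simp add: Cons_nth_drop_Suc[symmetric])
      hence "word_action f (drop i w) (w, length w) = (if e then f s else inv_into UNIV (f s)) (w, Suc i)"
        using step by simp
      also have "\<dots> = (w, i)"
      proof (cases e)
        case True
        thus ?thesis using p(2)[OF w step(2), of s] se step(2) w by (simp add: f_def Y_def)
      next
        case False
        hence "f s (w, i) = (w, Suc i)" using p(3)[OF w step(2), of s] se step(2) w by (simp add: f_def Y_def)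
        thus ?thesis using False f_bij[of s] by (simp add: inv_f_eq bij_is_inj)
      qed
      finally show ?case .
    qed
    from this[of 0] have "\<phi> g (w, length w) = (w, 0)" by (simp add: \<phi>_def w_def)
    thus ?thesis using w_ne by auto
  qed
  define X where "X = {q. q permutes Y}"
  have "id \<in> X" unfolding X_def mem_Collect_eq by (rule permutes_id)
  hence X: "finite X" "X \<noteq> {}" using finite_permutations[OF Y] unfolding X_def by blast+
  define \<sigma> where "\<sigma> g q = \<phi> g \<circ> q" for g and q :: "('a \<times> bool) list \<times> nat \<Rightarrow> ('a \<times> bool) list \<times> nat"
  have "sofic_point G T X \<sigma> q" if q: "q \<in> X" for q
    unfolding sofic_point_def
  proof (intro conjI ballI impI)
    fix g assume g: "g \<in> T"
    show "\<sigma> g q \<in> X" using q \<phi>_perm by (simp add: X_def \<sigma>_def permutes_compose)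
    fix h assume "h \<in> T"
    hence "\<phi> (g \<otimes>\<^bsub>G\<^esub> h) = \<phi> g \<circ> \<phi> h" using g T by (intro \<phi>_mult) auto
    thus "\<sigma> g (\<sigma> h q) = \<sigma> (g \<otimes>\<^bsub>G\<^esub> h) q" by (simp add: \<sigma>_def o_assoc)
  next
    show "\<sigma> \<one>\<^bsub>G\<^esub> q = q" by (simp add: \<sigma>_def \<phi>_def nf_one)
  next
    fix g assume g: "g \<in> T" "g \<noteq> \<one>\<^bsub>G\<^esub>"
    show "\<sigma> g q \<noteq> q"
    proof
      assume "\<sigma> g q = q"
      hence "\<phi> g \<circ> q = q" by (simp add: \<sigma>_def)
      moreover have "surj q" by (rule permutes_surj[of q Y]) (use q in \<open>simp add: X_def\<close>)
      ultimately have "\<phi> g y = y" for y by (metis comp_apply surjD)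
      thus False using \<phi>_moves[OF g] by auto
    qed
  qed
  hence none: "{q \<in> X. \<not> sofic_point G T X \<sigma> q} = {}" by blast
  have "sofic_approx G T \<epsilon> X \<sigma>" unfolding sofic_approx_def none using X \<epsilon> by simp
  thus "\<exists>(X :: (('a \<times> bool) list \<times> nat \<Rightarrow> ('a \<times> bool) list \<times> nat) set) \<sigma>. sofic_approx G T \<epsilon> X \<sigma>"
    by blast
qed

lemma sofic_of_class_K: "class_K G \<Longrightarrow> sofic G"
proof (induction rule: class_K.induct)
  case (free G)
  thus ?case by (rule sofic_of_free_group)
next
  case (amenable G)
  thus ?case by (rule sofic_of_amenable)
next
  case (extension N G)
  thus ?case using sofic_normal_extension folner_of_amenable by blast
next
  case (directed_union G \<H>)
  show ?case
    by (rule sofic_directed_union[OF directed_union(1,2)]) (use directed_union in blast)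
qed


section \<open>Reduction to integer coefficients\<close>

definition zspan :: "complex set \<Rightarrow> complex set" where
  "zspan V = {z. \<exists>k :: complex \<Rightarrow> int. z = (\<Sum>v\<in>V. of_int (k v) * v)}"

lemma zspanI: "z = (\<Sum>v\<in>V. of_int (k v) * v) \<Longrightarrow> z \<in> zspan V"
  by (auto simp: zspan_def)

lemma zspan_add: "x \<in> zspan V \<Longrightarrow> y \<in> zspan V \<Longrightarrow> x + y \<in> zspan V"
proof -
  assume "x \<in> zspan V" "y \<in> zspan V"
  then obtain k l :: "complex \<Rightarrow> int" where "x = (\<Sum>v\<in>V. of_int (k v) * v)" "y = (\<Sum>v\<in>V. of_int (l v) * v)"
    by (auto simp: zspan_def)
  hence "x + y = (\<Sum>v\<in>V. of_int (k v + l v) * v)" by (simp add: sum.distrib algebra_simps)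
  thus ?thesis by (rule zspanI)
qed

lemma zspan_scale: "x \<in> zspan V \<Longrightarrow> of_int n * x \<in> zspan V"
proof -
  assume "x \<in> zspan V"
  then obtain k :: "complex \<Rightarrow> int" where "x = (\<Sum>v\<in>V. of_int (k v) * v)" by (auto simp: zspan_def)
  hence "of_int n * x = (\<Sum>v\<in>V. of_int (n * k v) * v)" by (simp add: sum_distrib_left mult_ac)
  thus ?thesis by (rule zspanI)
qed

lemma zspan_sum: "(\<And>i. i \<in> I \<Longrightarrow> f i \<in> zspan V) \<Longrightarrow> (\<Sum>i\<in>I. f i) \<in> zspan V"
proof (induction I rule: infinite_finite_induct)
  case (insert i I)
  thus ?case by (simp add: zspan_add)
qed (auto simp: zspan_def intro!: exI[of _ "\<lambda>_. 0"])

lemma zspan_base: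
  assumes "finite V" "v \<in> V"
  shows "v \<in> zspan V"
proof -
  have "(\<Sum>u\<in>V. of_int (if u = v then 1 else 0) * u) = (\<Sum>u\<in>V. if u = v then v else 0)"
    by (intro sum.cong) auto
  also have "\<dots> = v" using assms by simp
  finally show ?thesis by (intro zspanI[of _ "\<lambda>u. if u = v then 1 else 0"]) simp
qed

text \<open>
  If \<open>L\<close> is the leading coefficient of an integer equation of degree \<open>n\<close> for \<open>a\<close>, then multiplying the
  equation by the power \<open>n - 1\<close> of \<open>L\<close> gives a monic equation for \<open>L a\<close>.
\<close>

lemma algebraic_integral_multiple:
  fixes a :: complex
  assumes "algebraic a"
  obtains L :: int and n k where "L \<noteq> 0" "n \<ge> 1"
    "(of_int L * a) ^ n = (\<Sum>i<n. of_int (k i) * (of_int L * a) ^ i)"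
proof -
  obtain p :: "int poly" where p: "p \<noteq> 0" "poly (of_int_poly p) a = 0" using assms by (rule algebraicE')
  define n where "n = degree p"
  define L where "L = lead_coeff p"
  have L: "L \<noteq> 0" using p by (simp add: L_def)
  have n: "n \<ge> 1"
  proof (rule ccontr)
    assume "\<not> n \<ge> 1"
    hence "degree p = 0" by (simp add: n_def)
    then obtain b where "p = [:b:]" by (metis degree_eq_zeroE)
    thus False using p by (simp add: of_int_poly_const)
  qed
  define b where "b = of_int L * a"
  have "0 = of_int L ^ (n - 1) * poly (of_int_poly p) a" using p by simp
  also have "poly (of_int_poly p) a = (\<Sum>i\<le>n. of_int (coeff p i) * a ^ i)"
    by (simp add: poly_altdef n_def)
  also have "of_int L ^ (n - 1) * \<dots> = (\<Sum>i\<le>n. of_int L ^ (n - 1) * of_int (coeff p i) * a ^ i)"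
    by (simp add: sum_distrib_left mult_ac)
  also have "\<dots> = of_int L ^ (n - 1) * of_int (coeff p n) * a ^ n
      + (\<Sum>i<n. of_int L ^ (n - 1) * of_int (coeff p i) * a ^ i)"
    by (simp flip: lessThan_Suc_atMost)
  also have "of_int L ^ (n - 1) * of_int (coeff p n) * a ^ n = b ^ n"
  proof -
    have "of_int L ^ (n - 1) * complex_of_int L = of_int L ^ n" using n by (simp add: power_eq_if)
    thus ?thesis by (simp add: b_def n_def L_def power_mult_distrib)
  qed
  also have "(\<Sum>i<n. of_int L ^ (n - 1) * of_int (coeff p i) * a ^ i)
      = (\<Sum>i<n. of_int (coeff p i * L ^ (n - 1 - i)) * b ^ i)"
  proof (rule sum.cong)
    fix i assume "i \<in> {..<n}"
    hence "complex_of_int L ^ (n - 1) = of_int L ^ (n - 1 - i) * of_int L ^ i" by (simp flip: power_add)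
    thus "of_int L ^ (n - 1) * of_int (coeff p i) * a ^ i = of_int (coeff p i * L ^ (n - 1 - i)) * b ^ i"
      by (simp add: b_def power_mult_distrib mult_ac)
  qed simp
  finally have "b ^ n = - (\<Sum>i<n. of_int (coeff p i * L ^ (n - 1 - i)) * b ^ i)"
    by (simp add: eq_neg_iff_add_eq_0)
  also have "\<dots> = (\<Sum>i<n. of_int (- (coeff p i * L ^ (n - 1 - i))) * b ^ i)" by (simp add: sum_negf)
  finally show ?thesis using that[of L n "\<lambda>i. - (coeff p i * L ^ (n - 1 - i))"] L n by (simp add: b_def)
qed

text \<open>
  Treat the numbers one at a time. If \<open>b = L a\<close> satisfies a monic equation of degree \<open>n\<close>, replace \<open>V\<close>
  by its products with \<open>1, b, \<dots>, b\<^sup>n\<^sup>-\<^sup>1\<close>: multiplication by \<open>b\<close> preserves the new span, and the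
  numbers treated before still act on the factors from \<open>V\<close>.
\<close>

lemma algebraic_numbers_preserve_lattice:
  assumes "finite E" "\<And>a. a \<in> E \<Longrightarrow> algebraic a"
  shows "\<exists>(V :: complex set) (D :: int). finite V \<and> (\<exists>v\<in>V. v \<noteq> 0) \<and> D \<noteq> 0 \<and>
    (\<forall>a\<in>E. \<forall>x\<in>V. of_int D * a * x \<in> zspan V)"
    using assms
proof (induction E rule: finite_induct)
    case empty
    show ?case by (intro exI[of _ "{1}"] exI[of _ 1]) auto
  next
    case (insert a E)
    then obtain V and D :: int where V: "finite V" "\<exists>v\<in>V. v \<noteq> 0" "D \<noteq> 0"
      "\<And>a x. a \<in> E \<Longrightarrow> x \<in> V \<Longrightarrow> of_int D * a * x \<in> zspan V" by (metis insertCI)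
    have "algebraic a" using insert by auto
    then obtain L :: int and n k where L: "L \<noteq> 0" "n \<ge> 1"
      "(of_int L * a) ^ n = (\<Sum>i<n. of_int (k i) * (of_int L * a) ^ i)"
      using algebraic_integral_multiple by metis
    define b where "b = of_int L * a"
    define V' where "V' = (\<lambda>(x, s). x * b ^ s) ` (V \<times> {..<n})"
    have V': "finite V'" using V by (simp add: V'_def)
    have V'I: "x * b ^ s \<in> zspan V'" if "x \<in> V" "s < n" for x s
    proof (rule zspan_base[OF V'])
      show "x * b ^ s \<in> V'" unfolding V'_def by (rule image_eqI[of _ _ "(x, s)"]) (use that in auto)
    qed
    have old: "of_int (D * L) * e * y \<in> zspan V'" if e: "e \<in> E" and y: "y \<in> V'" for e y
    proof -
      obtain x s where xs: "x \<in> V" "s < n" "y = x * b ^ s" using y by (auto simp: V'_def)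
      obtain l :: "complex \<Rightarrow> int" where l: "of_int D * e * x = (\<Sum>v\<in>V. of_int (l v) * v)"
        using V(4)[OF e xs(1)] by (auto simp: zspan_def)
      have "of_int (D * L) * e * y = of_int L * ((of_int D * e * x) * b ^ s)" by (simp add: xs mult_ac)
      also have "(of_int D * e * x) * b ^ s = (\<Sum>v\<in>V. of_int (l v) * (v * b ^ s))"
        unfolding l by (simp add: sum_distrib_right mult.assoc)
      finally have eq: "of_int (D * L) * e * y = of_int L * (\<Sum>v\<in>V. of_int (l v) * (v * b ^ s))" .
      show ?thesis unfolding eq by (intro zspan_scale zspan_sum V'I xs)
    qed
    have new: "of_int (D * L) * a * y \<in> zspan V'" if y: "y \<in> V'" for y
    proof -
      obtain x s where xs: "x \<in> V" "s < n" "y = x * b ^ s" using y by (auto simp: V'_def)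
      have eq: "of_int (D * L) * a * y = of_int D * (x * b ^ Suc s)" by (simp add: xs b_def mult_ac)
      have "x * b ^ Suc s \<in> zspan V'"
      proof (cases "Suc s < n")
        case True
        thus ?thesis using V'I xs by blast
      next
        case False
        hence "Suc s = n" using xs by simp
        hence eq: "x * b ^ Suc s = (\<Sum>i<n. of_int (k i) * (x * b ^ i))"
          using L(3) by (simp add: b_def sum_distrib_left mult_ac del: power_Suc)
        show ?thesis unfolding eq by (intro zspan_sum zspan_scale V'I xs) simp
      qed
      thus ?thesis unfolding eq by (rule zspan_scale)
    qed
    obtain v where v: "v \<in> V" "v \<noteq> 0" using V by blast
    have "v \<in> V'" unfolding V'_def by (rule image_eqI[of _ _ "(v, 0)"]) (use v L in auto)
    hence "\<exists>v\<in>V'. v \<noteq> 0" using v by blast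
    moreover have "\<forall>e\<in>insert a E. \<forall>y\<in>V'. of_int (D * L) * e * y \<in> zspan V'" using old new by blast
    ultimately show ?case using V' V(3) L(1) by (intro exI[of _ V'] exI[of _ "D * L"]) simp
qed

section \<open>Finite models of a group ring matrix\<close>

lemma norm_on_sum:
  assumes "finite T"
  shows "norm_on J (\<lambda>i. \<Sum>t\<in>T. f t i) \<le> (\<Sum>t\<in>T. norm_on J (f t))"
  using assms
proof (induction T rule: finite_induct)
  case (insert t T)
  thus ?case using norm_on_triangle[of J "f t" "\<lambda>i. \<Sum>t\<in>T. f t i"] by simp
qed (simp add: norm_on_zero)

text \<open>
  The maps \<open>\<sigma> h\<close> and \<open>\<rho> h\<close> model \<open>h\<close> and its inverse. Requiring both conditions makes the relation a
  partial injection even at points where the model is bad, which bounds the norm of the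
  model matrix.
\<close>

definition model_edge :: "('h \<Rightarrow> 'x \<Rightarrow> 'x) \<Rightarrow> ('h \<Rightarrow> 'x \<Rightarrow> 'x) \<Rightarrow> 'h \<Rightarrow> 'x \<Rightarrow> 'x \<Rightarrow> bool" where
  "model_edge \<sigma> \<rho> h x y \<longleftrightarrow> x = \<sigma> h y \<and> y = \<rho> h x"

definition model_matrix ::
  "'h set \<Rightarrow> ('i \<Rightarrow> 'i \<Rightarrow> 'h \<Rightarrow> int) \<Rightarrow> ('h \<Rightarrow> 'x \<Rightarrow> 'x) \<Rightarrow> ('h \<Rightarrow> 'x \<Rightarrow> 'x) \<Rightarrow> 'i \<times> 'x \<Rightarrow> 'i \<times> 'x \<Rightarrow> complex" where
  "model_matrix S a \<sigma> \<rho> p q =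
     (\<Sum>h\<in>S. of_int (a (fst p) (fst q) h) * (if model_edge \<sigma> \<rho> h (snd p) (snd q) then 1 else 0))"

lemma model_matrix_int: "model_matrix S a \<sigma> \<rho> p q \<in> \<int>"
  unfolding model_matrix_def by (intro Ints_sum Ints_mult) auto

lemma model_matrix_app:
  assumes I: "finite I" and X: "finite X" and p: "i \<in> I" "x \<in> X"
  shows "mat_app (I \<times> X) (model_matrix S a \<sigma> \<rho>) u (i, x)
    = (\<Sum>j\<in>I. \<Sum>h\<in>S. of_int (a i j h) * (\<Sum>y\<in>X. if model_edge \<sigma> \<rho> h x y then u (j, y) else 0))"
proof -
  have "mat_app (I \<times> X) (model_matrix S a \<sigma> \<rho>) u (i, x)
      = (\<Sum>j\<in>I. \<Sum>y\<in>X. model_matrix S a \<sigma> \<rho> (i, x) (j, y) * u (j, y))"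
    using p by (simp add: mat_app_def sum.cartesian_product)
  also have "\<dots> = (\<Sum>j\<in>I. \<Sum>y\<in>X. \<Sum>h\<in>S. of_int (a i j h) * (if model_edge \<sigma> \<rho> h x y then u (j, y) else 0))"
    unfolding model_matrix_def sum_distrib_right by (intro sum.cong) auto
  also have "\<dots> = (\<Sum>j\<in>I. \<Sum>h\<in>S. \<Sum>y\<in>X. of_int (a i j h) * (if model_edge \<sigma> \<rho> h x y then u (j, y) else 0))"
    by (intro sum.cong refl sum.swap)
  finally show ?thesis by (simp add: sum_distrib_left)
qed

lemma model_matrix_adj_app:
  assumes I: "finite I" and X: "finite X" and p: "j \<in> I" "y \<in> X"
  shows "mat_app (I \<times> X) (conj_transpose (model_matrix S a \<sigma> \<rho>)) u (j, y)
    = (\<Sum>i\<in>I. \<Sum>h\<in>S. of_int (a i j h) * (\<Sum>x\<in>X. if model_edge \<sigma> \<rho> h x y then u (i, x) else 0))"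
proof -
  have "mat_app (I \<times> X) (conj_transpose (model_matrix S a \<sigma> \<rho>)) u (j, y)
      = (\<Sum>i\<in>I. \<Sum>x\<in>X. cnj (model_matrix S a \<sigma> \<rho> (i, x) (j, y)) * u (i, x))"
    using p by (simp add: mat_app_def sum.cartesian_product conj_transpose_def)
  also have "\<dots> = (\<Sum>i\<in>I. \<Sum>x\<in>X. \<Sum>h\<in>S. of_int (a i j h) * (if model_edge \<sigma> \<rho> h x y then u (i, x) else 0))"
    unfolding model_matrix_def cnj_sum sum_distrib_right by (intro sum.cong) auto
  also have "\<dots> = (\<Sum>i\<in>I. \<Sum>h\<in>S. \<Sum>x\<in>X. of_int (a i j h) * (if model_edge \<sigma> \<rho> h x y then u (i, x) else 0))"
    by (intro sum.cong refl sum.swap)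
  finally show ?thesis by (simp add: sum_distrib_left)
qed

text \<open>
  The model matrix is a combination of matrices of partial injections, which have norm at most 1.
\<close>

lemma model_matrix_bounded_op:
  fixes I :: "'i set" and a :: "'i \<Rightarrow> 'i \<Rightarrow> 'h \<Rightarrow> int" and \<sigma> \<rho> :: "'h \<Rightarrow> 'x \<Rightarrow> 'x"
  assumes I: "finite I" and X: "finite X" and S: "finite S"
  shows "bounded_op (I \<times> X) (\<Sum>i\<in>I. \<Sum>j\<in>I. \<Sum>h\<in>S. real_of_int \<bar>a i j h\<bar>)
    (mat_app (I \<times> X) (model_matrix S a \<sigma> \<rho>))"
proof -
  let ?J = "I \<times> X"
  define E where "E i j h u p = (if p \<in> ?J \<and> fst p = i then
      (\<Sum>y\<in>X. if model_edge \<sigma> \<rho> h (snd p) y then u (j, y) else 0) else (0::complex))" for i j :: 'i and h u and p :: "'i \<times> 'x"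
  have J: "finite ?J" using I X by simp
  have E_le: "norm_on ?J (E i j h u) \<le> norm_on ?J u" if "i \<in> I" "j \<in> I" for i j h u
  proof -
    define C where "C = {x \<in> X. \<rho> h x \<in> X \<and> x = \<sigma> h (\<rho> h x)}"
    have C: "finite C" "C \<subseteq> X" using X by (auto simp: C_def)
    have inj: "inj_on (\<rho> h) C" by (rule inj_on_inverseI[of _ "\<sigma> h"]) (auto simp: C_def)
    have E_val: "E i j h u (i, x) = (if x \<in> C then u (j, \<rho> h x) else 0)" if x: "x \<in> X" for x
    proof -
      have "E i j h u (i, x) = (\<Sum>y\<in>X. if y = \<rho> h x then (if x = \<sigma> h (\<rho> h x) then u (j, \<rho> h x) else 0) else 0)"
      proof -
        have "(if model_edge \<sigma> \<rho> h x y then u (j, y) else 0)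
          = (if y = \<rho> h x then (if x = \<sigma> h (\<rho> h x) then u (j, \<rho> h x) else 0) else 0)" for y
          by (auto simp: model_edge_def)
        thus ?thesis using x \<open>i \<in> I\<close> by (simp add: E_def)
      qed
      thus ?thesis using X x by (auto simp: C_def)
    qed
    have "(\<Sum>p\<in>?J. (cmod (E i j h u p))\<^sup>2) = (\<Sum>i'\<in>I. \<Sum>x\<in>X. (cmod (E i j h u (i', x)))\<^sup>2)"
      by (simp add: sum.cartesian_product)
    also have "\<dots> = (\<Sum>i'\<in>I. if i' = i then (\<Sum>x\<in>X. (cmod (E i j h u (i, x)))\<^sup>2) else 0)"
      by (intro sum.cong) (auto simp: E_def)
    also have "\<dots> = (\<Sum>x\<in>X. (cmod (E i j h u (i, x)))\<^sup>2)" using I \<open>i \<in> I\<close> by simp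
    also have "\<dots> = (\<Sum>x\<in>X. if x \<in> C then (cmod (u (j, \<rho> h x)))\<^sup>2 else 0)"
      by (intro sum.cong) (auto simp: E_val)
    also have "\<dots> = (\<Sum>x\<in>C. (cmod (u (j, \<rho> h x)))\<^sup>2)"
      using X C by (simp add: sum.inter_restrict[symmetric] Int_absorb1)
    also have "\<dots> = (\<Sum>q\<in>(\<lambda>x. (j, \<rho> h x)) ` C. (cmod (u q))\<^sup>2)"
      using inj by (subst sum.reindex) (auto simp: inj_on_def)
    also have "\<dots> \<le> (\<Sum>q\<in>?J. (cmod (u q))\<^sup>2)"
      using J \<open>j \<in> I\<close> by (intro sum_mono2) (auto simp: C_def)
    finally show ?thesis unfolding norm_on_def L2_set_def by (rule real_sqrt_le_mono)
  qed
  have "norm_on ?J (mat_app ?J (model_matrix S a \<sigma> \<rho>) u)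
      \<le> (\<Sum>i\<in>I. \<Sum>j\<in>I. \<Sum>h\<in>S. real_of_int \<bar>a i j h\<bar>) * norm_on ?J u" for u
  proof -
    have "mat_app ?J (model_matrix S a \<sigma> \<rho>) u
        = (\<lambda>p. \<Sum>t\<in>I \<times> I \<times> S. of_int (a (fst t) (fst (snd t)) (snd (snd t))) * E (fst t) (fst (snd t)) (snd (snd t)) u p)"
    proof
      fix p
      show "mat_app ?J (model_matrix S a \<sigma> \<rho>) u p
        = (\<Sum>t\<in>I \<times> I \<times> S. of_int (a (fst t) (fst (snd t)) (snd (snd t))) * E (fst t) (fst (snd t)) (snd (snd t)) u p)"
      proof (cases "p \<in> ?J")
        case True
        then obtain i x where p: "p = (i, x)" "i \<in> I" "x \<in> X" by auto
        have "(\<Sum>t\<in>I \<times> I \<times> S. of_int (a (fst t) (fst (snd t)) (snd (snd t))) * E (fst t) (fst (snd t)) (snd (snd t)) u p)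
          = (\<Sum>k\<in>I. \<Sum>j\<in>I. \<Sum>h\<in>S. of_int (a k j h) * E k j h u p)"
          by (simp add: sum.cartesian_product case_prod_beta)
        also have "\<dots> = (\<Sum>k\<in>I. if k = i then (\<Sum>j\<in>I. \<Sum>h\<in>S. of_int (a i j h) * E i j h u p) else 0)"
          by (intro sum.cong) (auto simp: E_def p)
        also have "\<dots> = (\<Sum>j\<in>I. \<Sum>h\<in>S. of_int (a i j h) * E i j h u p)" using I p by simp
        also have "\<dots> = mat_app ?J (model_matrix S a \<sigma> \<rho>) u p"
          unfolding p(1) model_matrix_app[OF I X p(2,3)] using p by (simp add: E_def)
        finally show ?thesis by simp
      next
        case False
        thus ?thesis by (simp add: mat_app_def E_def)
      qed
    qed
    hence "norm_on ?J (mat_app ?J (model_matrix S a \<sigma> \<rho>) u)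
      \<le> (\<Sum>t\<in>I \<times> I \<times> S. norm_on ?J (\<lambda>p. of_int (a (fst t) (fst (snd t)) (snd (snd t))) * E (fst t) (fst (snd t)) (snd (snd t)) u p))"
      using norm_on_sum[of "I \<times> I \<times> S"] I S by simp
    also have "\<dots> \<le> (\<Sum>t\<in>I \<times> I \<times> S. real_of_int \<bar>a (fst t) (fst (snd t)) (snd (snd t))\<bar> * norm_on ?J u)"
      unfolding norm_on_scale by (intro sum_mono mult_mono E_le) auto
    also have "\<dots> = (\<Sum>i\<in>I. \<Sum>j\<in>I. \<Sum>h\<in>S. real_of_int \<bar>a i j h\<bar>) * norm_on ?J u"
      by (simp add: sum_distrib_right[symmetric] sum.cartesian_product case_prod_beta)
    finally show ?thesis .
  qed
  thus ?thesis by (simp add: bounded_op_def linear_op_mat_app)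
qed

lemma conj_transpose_minus_scalar: "conj_transpose (minus_scalar A c) = minus_scalar (conj_transpose A) (cnj c)"
  by (auto simp: conj_transpose_def minus_scalar_def fun_eq_iff)

lemma damp_in_vecs: "u \<in> vecs_on J \<Longrightarrow> damp J \<kappa> M u \<in> vecs_on J"
  by (auto simp: damp_def vecs_on_def mat_app_def)


section \<open>Transfer between the group and its finite models\<close>

context group
begin

text \<open>
  The operator \<open>A - c\<close> for the matrix \<open>A\<close> over the integral group ring with coefficients \<open>a\<close> supported in
  \<open>S\<close>, on functions indexed by pairs. Its formal adjoint and the analogue of \<open>damp\<close> follow.
\<close>

definition group_op :: "'i set \<Rightarrow> 'a set \<Rightarrow> ('i \<Rightarrow> 'i \<Rightarrow> 'a \<Rightarrow> int) \<Rightarrow> complex \<Rightarrow> ('i \<times> 'a \<Rightarrow> complex) \<Rightarrow> 'i \<times> 'a \<Rightarrow> complex" where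
  "group_op I S a c u p = (if p \<in> I \<times> carrier G then
     (\<Sum>j\<in>I. \<Sum>h\<in>S. of_int (a (fst p) j h) * u (j, inv h \<otimes> snd p)) - c * u p else 0)"

definition group_op_adj :: "'i set \<Rightarrow> 'a set \<Rightarrow> ('i \<Rightarrow> 'i \<Rightarrow> 'a \<Rightarrow> int) \<Rightarrow> complex \<Rightarrow> ('i \<times> 'a \<Rightarrow> complex) \<Rightarrow> 'i \<times> 'a \<Rightarrow> complex" where
  "group_op_adj I S a c u p = (if p \<in> I \<times> carrier G then
     (\<Sum>i\<in>I. \<Sum>h\<in>S. of_int (a i (fst p) h) * u (i, h \<otimes> snd p)) - cnj c * u p else 0)"

definition group_damp :: "'i set \<Rightarrow> 'a set \<Rightarrow> real \<Rightarrow> ('i \<Rightarrow> 'i \<Rightarrow> 'a \<Rightarrow> int) \<Rightarrow> complex \<Rightarrow> ('i \<times> 'a \<Rightarrow> complex) \<Rightarrow> 'i \<times> 'a \<Rightarrow> complex" where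
  "group_damp I S \<kappa> a c u = (\<lambda>p. u p - of_real (1 / \<kappa>) * group_op_adj I S a c (group_op I S a c u) p)"

fun cayley_ball :: "'a set \<Rightarrow> nat \<Rightarrow> 'a set" where
  "cayley_ball S 0 = {\<one>}"
| "cayley_ball S (Suc r) = (\<lambda>(u, b). u \<otimes> b) ` (insert \<one> (S \<union> m_inv G ` S) \<times> cayley_ball S r)"

lemma ball_finite: "finite S \<Longrightarrow> finite (cayley_ball S r)"
  by (induction r) auto

lemma ball_carrier: "S \<subseteq> carrier G \<Longrightarrow> cayley_ball S r \<subseteq> carrier G"
  by (induction r) auto

lemma ball_step:
  assumes "b \<in> cayley_ball S r"
  shows "h \<in> S \<Longrightarrow> h \<otimes> b \<in> cayley_ball S (Suc r)" "h \<in> S \<Longrightarrow> inv h \<otimes> b \<in> cayley_ball S (Suc r)"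
proof -
  have I: "u \<otimes> b \<in> cayley_ball S (Suc r)" if "u \<in> insert \<one> (S \<union> m_inv G ` S)" for u
    unfolding cayley_ball.simps by (rule image_eqI[of _ _ "(u, b)"]) (use that assms in auto)
  show "h \<in> S \<Longrightarrow> h \<otimes> b \<in> cayley_ball S (Suc r)" "h \<in> S \<Longrightarrow> inv h \<otimes> b \<in> cayley_ball S (Suc r)"
    by (rule I; simp)+
qed

lemma ball_Suc:
  assumes "S \<subseteq> carrier G" "b \<in> cayley_ball S r"
  shows "b \<in> cayley_ball S (Suc r)"
proof -
  have "\<one> \<otimes> b \<in> cayley_ball S (Suc r)"
    unfolding cayley_ball.simps by (rule image_eqI[of _ _ "(\<one>, b)"]) (use assms in auto)
  thus ?thesis using assms ball_carrier by (simp add: subset_iff)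
qed

lemma ball_mono:
  assumes "S \<subseteq> carrier G" "r \<le> r'"
  shows "cayley_ball S r \<subseteq> cayley_ball S r'"
  using assms(2) by (induction rule: dec_induct) (use ball_Suc[OF assms(1)] in blast)+

lemma ball_mult:
  assumes S: "S \<subseteq> carrier G"
  shows "x \<in> cayley_ball S r \<Longrightarrow> y \<in> cayley_ball S s \<Longrightarrow> x \<otimes> y \<in> cayley_ball S (r + s)"
proof (induction r arbitrary: x)
  case 0
  thus ?case using ball_carrier[OF S] by (auto simp: subset_iff)
next
  case (Suc r)
  then obtain u b where x: "u \<in> insert \<one> (S \<union> m_inv G ` S)" "b \<in> cayley_ball S r" "x = u \<otimes> b" by auto
  have "u \<in> carrier G" "b \<in> carrier G" "y \<in> carrier G"
    using x Suc.prems S ball_carrier[OF S] by (auto simp: subset_iff)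
  hence "x \<otimes> y = u \<otimes> (b \<otimes> y)" by (simp add: x m_assoc)
  moreover have "b \<otimes> y \<in> cayley_ball S (r + s)" using Suc.IH x(2) Suc.prems by blast
  ultimately show ?case
    unfolding add_Suc cayley_ball.simps by (intro image_eqI[of _ _ "(u, b \<otimes> y)"]) (use x(1) in auto)
qed

lemma ball_inv:
  assumes S: "S \<subseteq> carrier G"
  shows "x \<in> cayley_ball S r \<Longrightarrow> inv x \<in> cayley_ball S r"
proof (induction r arbitrary: x)
  case (Suc r)
  then obtain u b where x: "u \<in> insert \<one> (S \<union> m_inv G ` S)" "b \<in> cayley_ball S r" "x = u \<otimes> b" by auto
  have car: "u \<in> carrier G" "b \<in> carrier G"
    using x S ball_carrier[OF S] by (auto simp: subset_iff)
  have "\<one> \<in> cayley_ball S 0" by simp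
  have "inv u \<in> insert \<one> (S \<union> m_inv G ` S)" using x(1) S by (auto simp: subset_iff)
  hence "inv u \<otimes> \<one> \<in> cayley_ball S (Suc 0)"
    unfolding cayley_ball.simps by (intro image_eqI[of _ _ "(inv u, \<one>)"]) auto
  hence "inv u \<in> cayley_ball S 1" using car by simp
  hence "inv b \<otimes> inv u \<in> cayley_ball S (r + 1)" using ball_mult[OF S] Suc.IH x(2) by blast
  thus ?case using car by (simp add: x(3) inv_mult_group)
qed simp

definition supported_in :: "'i set \<Rightarrow> 'a set \<Rightarrow> ('i \<times> 'a \<Rightarrow> complex) \<Rightarrow> bool" where
  "supported_in I B u \<longleftrightarrow> (\<forall>i g. u (i, g) \<noteq> 0 \<longrightarrow> i \<in> I \<and> g \<in> B)"

lemma supported_group_op: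
  assumes S: "S \<subseteq> carrier G" and u: "supported_in I (cayley_ball S r) u"
  shows "supported_in I (cayley_ball S (Suc r)) (group_op I S a c u)"
  unfolding supported_in_def
proof (intro allI impI)
  fix i g assume nz: "group_op I S a c u (i, g) \<noteq> 0"
  hence ig: "i \<in> I" "g \<in> carrier G" by (auto simp: group_op_def split: if_splits)
  show "i \<in> I \<and> g \<in> cayley_ball S (Suc r)"
  proof (rule ccontr)
    assume "\<not> (i \<in> I \<and> g \<in> cayley_ball S (Suc r))"
    hence g: "g \<notin> cayley_ball S (Suc r)" using ig by blast
    have "u (j, inv h \<otimes> g) = 0" if "h \<in> S" for j h
    proof (rule ccontr)
      assume "u (j, inv h \<otimes> g) \<noteq> 0"
      hence "inv h \<otimes> g \<in> cayley_ball S r" using u by (auto simp: supported_in_def)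
      hence "h \<otimes> (inv h \<otimes> g) \<in> cayley_ball S (Suc r)" using ball_step(1) that by blast
      moreover have "h \<otimes> (inv h \<otimes> g) = g" using that S ig by (simp add: m_assoc[symmetric] subset_iff)
      ultimately show False using g by simp
    qed
    hence "(\<Sum>j\<in>I. \<Sum>h\<in>S. of_int (a i j h) * u (j, inv h \<otimes> g)) = 0" by (intro sum.neutral ballI) simp
    moreover have "u (i, g) = 0" using u g ball_Suc[OF S] by (auto simp: supported_in_def simp del: cayley_ball.simps)
    ultimately show False using nz ig by (simp add: group_op_def)
  qed
qed

lemma supported_group_op_adj:
  assumes S: "S \<subseteq> carrier G" and u: "supported_in I (cayley_ball S r) u"
  shows "supported_in I (cayley_ball S (Suc r)) (group_op_adj I S a c u)"
  unfolding supported_in_def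
proof (intro allI impI)
  fix i g assume nz: "group_op_adj I S a c u (i, g) \<noteq> 0"
  hence ig: "i \<in> I" "g \<in> carrier G" by (auto simp: group_op_adj_def split: if_splits)
  show "i \<in> I \<and> g \<in> cayley_ball S (Suc r)"
  proof (rule ccontr)
    assume "\<not> (i \<in> I \<and> g \<in> cayley_ball S (Suc r))"
    hence g: "g \<notin> cayley_ball S (Suc r)" using ig by blast
    have "u (j, h \<otimes> g) = 0" if "h \<in> S" for j h
    proof (rule ccontr)
      assume "u (j, h \<otimes> g) \<noteq> 0"
      hence "h \<otimes> g \<in> cayley_ball S r" using u by (auto simp: supported_in_def)
      hence "inv h \<otimes> (h \<otimes> g) \<in> cayley_ball S (Suc r)" using ball_step(2) that by blast
      moreover have "inv h \<otimes> (h \<otimes> g) = g" using that S ig by (simp add: m_assoc[symmetric] subset_iff)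
      ultimately show False using g by simp
    qed
    hence "(\<Sum>j\<in>I. \<Sum>h\<in>S. of_int (a j i h) * u (j, h \<otimes> g)) = 0" by (intro sum.neutral ballI) simp
    moreover have "u (i, g) = 0" using u g ball_Suc[OF S] by (auto simp: supported_in_def simp del: cayley_ball.simps)
    ultimately show False using nz ig by (simp add: group_op_adj_def)
  qed
qed

text \<open>
  For an eigenfunction \<open>w\<close> this says \<open>\<langle>(A - c)\<^sup>* z, w\<rangle> = \<langle>z, (A - c) w\<rangle> = 0\<close>. As \<open>z\<close> has finite support, all
  sums are finite and may be rearranged.
\<close>

lemma group_op_adj_orthogonal:
  fixes w :: "'i \<Rightarrow> 'a \<Rightarrow> complex"
  assumes I: "finite I" and S: "finite S" "S \<subseteq> carrier G" and z: "supported_in I (cayley_ball S r) z"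
    and w: "\<And>i g. i \<in> I \<Longrightarrow> g \<in> carrier G \<Longrightarrow> (\<Sum>j\<in>I. \<Sum>h\<in>S. of_int (a i j h) * w j (inv h \<otimes> g)) = c * w i g"
  shows "(\<Sum>j\<in>I. \<Sum>g\<in>cayley_ball S (Suc r). group_op_adj I S a c z (j, g) * cnj (w j g)) = 0"
proof -
  let ?B = "cayley_ball S r" and ?B' = "cayley_ball S (Suc r)"
  have fin: "finite ?B" "finite ?B'" using ball_finite[OF S(1)] by blast+
  have car: "?B \<subseteq> carrier G" "?B' \<subseteq> carrier G" using ball_carrier[OF S(2)] by blast+
  have BB': "?B \<subseteq> ?B'" using ball_Suc[OF S(2)] by blast
  have z0: "z (i, g) = 0" if "g \<notin> ?B" for i g using z that by (auto simp: supported_in_def)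
  have move: "(\<Sum>g\<in>?B'. z (i, h \<otimes> g) * y g) = (\<Sum>g\<in>?B. z (i, g) * y (inv h \<otimes> g))"
    if h: "h \<in> S" for i h and y :: "'a \<Rightarrow> complex"
  proof -
    have hc: "h \<in> carrier G" using h S by auto
    have inj: "inj_on (\<lambda>g. inv h \<otimes> g) ?B" using hc car by (auto simp: inj_on_def subset_iff)
    have "(\<Sum>g\<in>?B. z (i, g) * y (inv h \<otimes> g)) = (\<Sum>g\<in>?B. z (i, h \<otimes> (inv h \<otimes> g)) * y (inv h \<otimes> g))"
      using hc car by (intro sum.cong) (auto simp: m_assoc[symmetric] subset_iff)
    also have "\<dots> = (\<Sum>g\<in>(\<lambda>g. inv h \<otimes> g) ` ?B. z (i, h \<otimes> g) * y g)"
      by (simp add: sum.reindex[OF inj])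
    also have "\<dots> = (\<Sum>g\<in>?B'. z (i, h \<otimes> g) * y g)"
    proof (rule sum.mono_neutral_left[OF fin(2)])
      show "(\<lambda>g. inv h \<otimes> g) ` ?B \<subseteq> ?B'" using ball_step(2)[OF _ h] by blast
      show "\<forall>g\<in>?B' - (\<lambda>g. inv h \<otimes> g) ` ?B. z (i, h \<otimes> g) * y g = 0"
      proof
        fix g assume g: "g \<in> ?B' - (\<lambda>g. inv h \<otimes> g) ` ?B"
        hence "g \<in> carrier G" using car by blast
        hence "g = inv h \<otimes> (h \<otimes> g)" using hc by (simp add: m_assoc[symmetric])
        hence "h \<otimes> g \<notin> ?B" using g by blast
        thus "z (i, h \<otimes> g) * y g = 0" using z0 by simp
      qed
    qed
    finally show ?thesis by simp
  qed
  have "(\<Sum>j\<in>I. \<Sum>g\<in>?B'. group_op_adj I S a c z (j, g) * cnj (w j g))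
      = (\<Sum>j\<in>I. \<Sum>g\<in>?B'. (\<Sum>i\<in>I. \<Sum>h\<in>S. of_int (a i j h) * (z (i, h \<otimes> g) * cnj (w j g))) - cnj c * (z (j, g) * cnj (w j g)))"
  proof (intro sum.cong refl)
    fix j g assume "j \<in> I" "g \<in> ?B'"
    hence "(j, g) \<in> I \<times> carrier G" using car by blast
    thus "group_op_adj I S a c z (j, g) * cnj (w j g)
      = (\<Sum>i\<in>I. \<Sum>h\<in>S. of_int (a i j h) * (z (i, h \<otimes> g) * cnj (w j g))) - cnj c * (z (j, g) * cnj (w j g))"
      by (simp add: group_op_adj_def left_diff_distrib sum_distrib_right mult.assoc)
  qed
  also have "\<dots> = (\<Sum>j\<in>I. \<Sum>g\<in>?B'. \<Sum>i\<in>I. \<Sum>h\<in>S. of_int (a i j h) * (z (i, h \<otimes> g) * cnj (w j g)))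
      - (\<Sum>j\<in>I. \<Sum>g\<in>?B'. cnj c * (z (j, g) * cnj (w j g)))" by (simp add: sum_subtractf)
  also have "(\<Sum>j\<in>I. \<Sum>g\<in>?B'. cnj c * (z (j, g) * cnj (w j g))) = (\<Sum>j\<in>I. \<Sum>g\<in>?B. z (j, g) * cnj (c * w j g))"
    using z0 BB' fin by (intro sum.cong refl sum.mono_neutral_cong_right) auto
  also have "(\<Sum>j\<in>I. \<Sum>g\<in>?B'. \<Sum>i\<in>I. \<Sum>h\<in>S. of_int (a i j h) * (z (i, h \<otimes> g) * cnj (w j g)))
      = (\<Sum>i\<in>I. \<Sum>g\<in>?B. z (i, g) * cnj (c * w i g))"
  proof -
    have "(\<Sum>j\<in>I. \<Sum>g\<in>?B'. \<Sum>i\<in>I. \<Sum>h\<in>S. of_int (a i j h) * (z (i, h \<otimes> g) * cnj (w j g)))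
        = (\<Sum>j\<in>I. \<Sum>i\<in>I. \<Sum>g\<in>?B'. \<Sum>h\<in>S. of_int (a i j h) * (z (i, h \<otimes> g) * cnj (w j g)))"
      by (intro sum.cong refl sum.swap)
    also have "\<dots> = (\<Sum>i\<in>I. \<Sum>j\<in>I. \<Sum>g\<in>?B'. \<Sum>h\<in>S. of_int (a i j h) * (z (i, h \<otimes> g) * cnj (w j g)))"
      by (rule sum.swap)
    also have "\<dots> = (\<Sum>i\<in>I. \<Sum>j\<in>I. \<Sum>h\<in>S. \<Sum>g\<in>?B'. of_int (a i j h) * (z (i, h \<otimes> g) * cnj (w j g)))"
      by (intro sum.cong refl sum.swap)
    also have "\<dots> = (\<Sum>i\<in>I. \<Sum>j\<in>I. \<Sum>h\<in>S. \<Sum>g\<in>?B. of_int (a i j h) * (z (i, g) * cnj (w j (inv h \<otimes> g))))"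
      unfolding sum_distrib_left[symmetric] by (intro sum.cong refl arg_cong2[where f = "(*)"] move)
    also have "\<dots> = (\<Sum>i\<in>I. \<Sum>j\<in>I. \<Sum>g\<in>?B. \<Sum>h\<in>S. of_int (a i j h) * (z (i, g) * cnj (w j (inv h \<otimes> g))))"
      by (intro sum.cong refl sum.swap)
    also have "\<dots> = (\<Sum>i\<in>I. \<Sum>g\<in>?B. \<Sum>j\<in>I. \<Sum>h\<in>S. of_int (a i j h) * (z (i, g) * cnj (w j (inv h \<otimes> g))))"
      by (intro sum.cong refl sum.swap)
    also have "\<dots> = (\<Sum>i\<in>I. \<Sum>g\<in>?B. z (i, g) * cnj (\<Sum>j\<in>I. \<Sum>h\<in>S. of_int (a i j h) * w j (inv h \<otimes> g)))"
      by (intro sum.cong refl) (simp add: sum_distrib_left mult_ac)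
    also have "\<dots> = (\<Sum>i\<in>I. \<Sum>g\<in>?B. z (i, g) * cnj (c * w i g))"
      using w car by (intro sum.cong refl) (auto simp: subset_iff)
    finally show ?thesis .
  qed
  finally show ?thesis by simp
qed

text \<open>
  The inner product of the damped unit vector with the eigenfunction \<open>w\<close> does not depend on \<open>m\<close>, since
  the correction terms are orthogonal to \<open>w\<close>. It is nonzero if \<open>w\<close> is nonzero at the starting point,
  and Cauchy-Schwarz bounds the norm from below.
\<close>

lemma group_damp_lower_bound:
  fixes w :: "'i \<Rightarrow> 'a \<Rightarrow> complex"
  assumes I: "finite I" and S: "finite S" "S \<subseteq> carrier G" and i0: "i0 \<in> I"
    and w: "\<And>i g. i \<in> I \<Longrightarrow> g \<in> carrier G \<Longrightarrow> (\<Sum>j\<in>I. \<Sum>h\<in>S. of_int (a i j h) * w j (inv h \<otimes> g)) = c * w i g"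
    and bound: "\<And>F. finite F \<Longrightarrow> F \<subseteq> carrier G \<Longrightarrow> (\<Sum>i\<in>I. \<Sum>g\<in>F. (cmod (w i g))\<^sup>2) \<le> b" and b: "b > 0"
  shows "(cmod (w i0 \<one>))\<^sup>2 / b \<le> (\<Sum>p\<in>I \<times> cayley_ball S (2 * m).
    (cmod ((group_damp I S \<kappa> a c ^^ m) (\<lambda>p. if p = (i0, \<one>) then 1 else 0) p))\<^sup>2)"
proof -
  define u where "u k = (group_damp I S \<kappa> a c ^^ k) (\<lambda>p. if p = (i0, \<one>) then 1 else 0)" for k
  have u_Suc: "u (Suc k) = (\<lambda>p. u k p - of_real (1 / \<kappa>) * group_op_adj I S a c (group_op I S a c (u k)) p)" for k
    by (simp add: u_def group_damp_def)
  have supp_adj: "supported_in I (cayley_ball S (Suc (2 * k))) (group_op I S a c (u k))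
      \<and> supported_in I (cayley_ball S (Suc (Suc (2 * k)))) (group_op_adj I S a c (group_op I S a c (u k)))"
    if "supported_in I (cayley_ball S (2 * k)) (u k)" for k
    using supported_group_op[OF S(2) that] supported_group_op_adj[OF S(2)] by blast
  have supp: "supported_in I (cayley_ball S (2 * k)) (u k)" for k
  proof (induction k)
    case 0
    show ?case using i0 by (auto simp: supported_in_def u_def split: if_splits)
  next
    case (Suc k)
    have up: "g \<in> cayley_ball S (Suc (Suc (2 * k)))" if "g \<in> cayley_ball S (2 * k)" for g
      using ball_Suc[OF S(2)] that by blast
    have "i \<in> I \<and> g \<in> cayley_ball S (Suc (Suc (2 * k)))" if nz: "u (Suc k) (i, g) \<noteq> 0" for i g
    proof (cases "u k (i, g) = 0")
      case True
      hence "group_op_adj I S a c (group_op I S a c (u k)) (i, g) \<noteq> 0" using nz by (auto simp: u_Suc)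
      thus ?thesis using supp_adj[OF Suc] unfolding supported_in_def by blast
    next
      case False
      thus ?thesis using Suc up unfolding supported_in_def by blast
    qed
    thus ?case unfolding supported_in_def by simp
  qed
  define P where "P B z = (\<Sum>i\<in>I. \<Sum>g\<in>B. z (i, g) * cnj (w i g))" for B z
  have P_mono: "P (cayley_ball S (Suc (Suc (2 * k)))) (u k) = P (cayley_ball S (2 * k)) (u k)" for k
    unfolding P_def
  proof (rule sum.cong[OF refl], rule sum.mono_neutral_right[OF ball_finite[OF S(1)]])
    show "cayley_ball S (2 * k) \<subseteq> cayley_ball S (Suc (Suc (2 * k)))" by (rule ball_mono[OF S(2)]) simp
    show "\<forall>g\<in>cayley_ball S (Suc (Suc (2 * k))) - cayley_ball S (2 * k). u k (i, g) * cnj (w i g) = 0" for i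
      using supp[of k] by (auto simp: supported_in_def simp del: cayley_ball.simps)
  qed
  have P_u: "P (cayley_ball S (2 * k)) (u k) = cnj (w i0 \<one>)" for k
  proof (induction k)
    case 0
    have "P (cayley_ball S (2 * 0)) (u 0) = (\<Sum>i\<in>I. if i = i0 then cnj (w i \<one>) else 0)"
      unfolding P_def by (intro sum.cong) (auto simp: u_def)
    thus ?case using I i0 by simp
  next
    case (Suc k)
    let ?B = "cayley_ball S (Suc (Suc (2 * k)))"
    let ?z = "group_op_adj I S a c (group_op I S a c (u k))"
    have "P ?B (u (Suc k)) = P ?B (u k) - of_real (1 / \<kappa>) * P ?B ?z"
    proof -
      have "P B (\<lambda>p. f p - t * z p) = P B f - t * P B z" for B f t z
        by (simp add: P_def left_diff_distrib sum_subtractf sum_distrib_left mult.assoc)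
      thus ?thesis unfolding u_Suc .
    qed
    also have "P ?B ?z = 0"
      unfolding P_def using supp_adj[OF supp] by (intro group_op_adj_orthogonal[OF I S _ w]) auto
    finally show ?case using P_mono[of k] Suc by (simp del: cayley_ball.simps)
  qed
  let ?J = "I \<times> cayley_ball S (2 * m)"
  have "cmod (w i0 \<one>) = cmod (\<Sum>p\<in>?J. u m p * cnj (w (fst p) (snd p)))"
    using P_u[of m] by (simp add: P_def sum.cartesian_product case_prod_beta)
  also have "\<dots> \<le> (\<Sum>p\<in>?J. \<bar>cmod (u m p)\<bar> * \<bar>cmod (w (fst p) (snd p))\<bar>)"
    by (rule order_trans[OF norm_sum]) (simp add: norm_mult)
  also have "\<dots> \<le> L2_set (\<lambda>p. cmod (u m p)) ?J * L2_set (\<lambda>p. cmod (w (fst p) (snd p))) ?J"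
    by (rule L2_set_mult_ineq)
  finally have "(cmod (w i0 \<one>))\<^sup>2 \<le> (L2_set (\<lambda>p. cmod (u m p)) ?J * L2_set (\<lambda>p. cmod (w (fst p) (snd p))) ?J)\<^sup>2"
    by (intro power_mono) auto
  also have "\<dots> = (\<Sum>p\<in>?J. (cmod (u m p))\<^sup>2) * (\<Sum>p\<in>?J. (cmod (w (fst p) (snd p)))\<^sup>2)"
    by (simp add: power_mult_distrib L2_set_def sum_nonneg)
  also have "(\<Sum>p\<in>?J. (cmod (w (fst p) (snd p)))\<^sup>2) = (\<Sum>i\<in>I. \<Sum>g\<in>cayley_ball S (2 * m). (cmod (w i g))\<^sup>2)"
    by (simp add: sum.cartesian_product case_prod_beta)
  also have "(\<Sum>p\<in>?J. (cmod (u m p))\<^sup>2) * \<dots> \<le> (\<Sum>p\<in>?J. (cmod (u m p))\<^sup>2) * b"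
    using bound[OF ball_finite[OF S(1)] ball_carrier[OF S(2)]] by (intro mult_left_mono sum_nonneg) auto
  finally show ?thesis using b by (simp add: u_def pos_divide_le_eq)
qed

text \<open>
  Functions on the model are pulled back to the group along \<open>g \<mapsto> \<sigma> g x\<close>. Each application of the
  operator or its adjoint in the model corresponds to the one in the group, at the cost of one
  unit of the radius of the ball on which the comparison is valid.
\<close>

lemma model_damp_matches:
  fixes \<sigma> :: "'a \<Rightarrow> 'x \<Rightarrow> 'x"
  assumes I: "finite I" and S: "finite S" "S \<subseteq> carrier G" and X: "finite X" and x: "x \<in> X"
    and sp: "sofic_point G (cayley_ball S R) X \<sigma> x" and R: "R \<ge> 1" and i0: "i0 \<in> I"
  shows "2 * k \<le> R \<Longrightarrow> i \<in> I \<Longrightarrow> g \<in> cayley_ball S (R - 2 * k) \<Longrightarrow>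
    (damp (I \<times> X) \<kappa> (minus_scalar (model_matrix S a \<sigma> (\<lambda>h. \<sigma> (inv h))) c) ^^ k) (\<lambda>p. if p = (i0, x) then 1 else 0) (i, \<sigma> g x)
    = (group_damp I S \<kappa> a c ^^ k) (\<lambda>p. if p = (i0, \<one>) then 1 else 0) (i, g)"
proof (induction k arbitrary: i g)
  case 0
  have "g \<in> cayley_ball S R" using 0 by simp
  hence "\<sigma> g x = x \<longleftrightarrow> g = \<one>" using sp by (auto simp: sofic_point_def)
  thus ?case by simp
next
  case (Suc k)
  let ?J = "I \<times> X" and ?A = "model_matrix S a \<sigma> (\<lambda>h. \<sigma> (inv h))"
  let ?M = "minus_scalar ?A c"
  define ut where "ut = (damp ?J \<kappa> ?M ^^ k) (\<lambda>p. if p = (i0, x) then 1 else 0)"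
  define u where "u = (group_damp I S \<kappa> a c ^^ k) (\<lambda>p. if p = (i0, \<one>) then 1 else 0)"
  have J: "finite ?J" using I X by simp
  have ut_vecs: "ut \<in> vecs_on ?J"
  proof -
    have "(damp ?J \<kappa> ?M ^^ n) (\<lambda>p. if p = (i0, x) then 1 else 0) \<in> vecs_on ?J" for n
    proof (induction n)
      case 0
      show ?case using i0 x by (auto simp: vecs_on_def)
    next
      case (Suc n)
      thus ?case using damp_in_vecs by simp
    qed
    thus ?thesis by (simp add: ut_def)
  qed
  have IH: "ut (i, \<sigma> g x) = u (i, g)" if "i \<in> I" "g \<in> cayley_ball S (R - 2 * k)" for i g
    unfolding ut_def u_def using Suc.IH[of i g] Suc.prems(1) that by simp
  have BR: "cayley_ball S r \<subseteq> cayley_ball S R" if "r \<le> R" for r using ball_mono[OF S(2) that] .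
  have SR: "h \<in> cayley_ball S R" "inv h \<in> cayley_ball S R" "h \<in> carrier G" if "h \<in> S" for h
  proof -
    show hc: "h \<in> carrier G" using that S by auto
    have "h \<otimes> \<one> \<in> cayley_ball S (Suc 0)" "inv h \<otimes> \<one> \<in> cayley_ball S (Suc 0)"
      using ball_step[of \<one> S 0 h] that by simp_all
    hence "h \<in> cayley_ball S 1" "inv h \<in> cayley_ball S 1" using hc by simp_all
    thus "h \<in> cayley_ball S R" "inv h \<in> cayley_ball S R" using BR[OF R] by blast+
  qed
  have \<sigma>X: "\<sigma> g x \<in> X" if "g \<in> cayley_ball S R" for g using sp that by (simp add: sofic_point_def)
  have \<sigma>m: "\<sigma> h (\<sigma> g x) = \<sigma> (h \<otimes> g) x" if "h \<in> cayley_ball S R" "g \<in> cayley_ball S R" for h g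
    using sp that by (simp add: sofic_point_def)
  have cancel: "h \<otimes> (inv h \<otimes> g) = g" "inv h \<otimes> (h \<otimes> g) = g" if "h \<in> S" "g \<in> cayley_ball S R" for h g
    using SR(3)[OF that(1)] that(2) ball_carrier[OF S(2), of R] by (simp_all add: m_assoc[symmetric] subset_iff)
  have op: "mat_app ?J ?M v (i, \<sigma> g x) = group_op I S a c z (i, g)"
    if i: "i \<in> I" and g: "g \<in> cayley_ball S r" and r: "Suc r \<le> R" and v: "v \<in> vecs_on ?J"
      and vz: "\<And>i g. i \<in> I \<Longrightarrow> g \<in> cayley_ball S (Suc r) \<Longrightarrow> v (i, \<sigma> g x) = z (i, g)" for i g r v z
  proof -
    have gR: "g \<in> cayley_ball S R" using g BR[of r] r by auto
    have gS: "g \<in> cayley_ball S (Suc r)" using ball_Suc[OF S(2) g] .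
    have "(\<Sum>y\<in>X. if model_edge \<sigma> (\<lambda>h. \<sigma> (inv h)) h (\<sigma> g x) y then v (j, y) else 0) = z (j, inv h \<otimes> g)"
      if "j \<in> I" "h \<in> S" for j h
    proof -
      have hg: "inv h \<otimes> g \<in> cayley_ball S (Suc r)" using ball_step(2)[OF g \<open>h \<in> S\<close>] .
      hence hgR: "inv h \<otimes> g \<in> cayley_ball S R" using BR[OF r] by blast
      have "model_edge \<sigma> (\<lambda>h. \<sigma> (inv h)) h (\<sigma> g x) y \<longleftrightarrow> y = \<sigma> (inv h \<otimes> g) x" for y
        using \<sigma>m[OF SR(2)[OF \<open>h \<in> S\<close>] gR] \<sigma>m[OF SR(1)[OF \<open>h \<in> S\<close>] hgR] cancel(1)[OF \<open>h \<in> S\<close> gR]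
        by (auto simp: model_edge_def)
      hence "(\<Sum>y\<in>X. if model_edge \<sigma> (\<lambda>h. \<sigma> (inv h)) h (\<sigma> g x) y then v (j, y) else 0)
        = (\<Sum>y\<in>X. if y = \<sigma> (inv h \<otimes> g) x then v (j, \<sigma> (inv h \<otimes> g) x) else 0)"
        by (intro sum.cong) auto
      also have "\<dots> = z (j, inv h \<otimes> g)" using X \<sigma>X[OF hgR] vz[OF \<open>j \<in> I\<close> hg] by simp
      finally show ?thesis .
    qed
    hence "mat_app ?J ?A v (i, \<sigma> g x) = (\<Sum>j\<in>I. \<Sum>h\<in>S. of_int (a i j h) * z (j, inv h \<otimes> g))"
      unfolding model_matrix_app[OF I X i \<sigma>X[OF gR]] by (intro sum.cong refl) auto
    moreover have "g \<in> carrier G" using gR ball_carrier[OF S(2)] by blast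
    ultimately show ?thesis
      using i vz[OF i gS] by (simp add: mat_app_minus_scalar[OF J v] group_op_def)
  qed
  have op_adj: "mat_app ?J (conj_transpose ?M) v (j, \<sigma> g x) = group_op_adj I S a c z (j, g)"
    if j: "j \<in> I" and g: "g \<in> cayley_ball S r" and r: "Suc r \<le> R" and v: "v \<in> vecs_on ?J"
      and vz: "\<And>i g. i \<in> I \<Longrightarrow> g \<in> cayley_ball S (Suc r) \<Longrightarrow> v (i, \<sigma> g x) = z (i, g)" for j g r v z
  proof -
    have gR: "g \<in> cayley_ball S R" using g BR[of r] r by auto
    have gS: "g \<in> cayley_ball S (Suc r)" using ball_Suc[OF S(2) g] .
    have "(\<Sum>y\<in>X. if model_edge \<sigma> (\<lambda>h. \<sigma> (inv h)) h y (\<sigma> g x) then v (i, y) else 0) = z (i, h \<otimes> g)"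
      if "i \<in> I" "h \<in> S" for i h
    proof -
      have hg: "h \<otimes> g \<in> cayley_ball S (Suc r)" using ball_step(1)[OF g \<open>h \<in> S\<close>] .
      hence hgR: "h \<otimes> g \<in> cayley_ball S R" using BR[OF r] by blast
      have "model_edge \<sigma> (\<lambda>h. \<sigma> (inv h)) h y (\<sigma> g x) \<longleftrightarrow> y = \<sigma> (h \<otimes> g) x" for y
        using \<sigma>m[OF SR(1)[OF \<open>h \<in> S\<close>] gR] \<sigma>m[OF SR(2)[OF \<open>h \<in> S\<close>] hgR] cancel(2)[OF \<open>h \<in> S\<close> gR]
        by (auto simp: model_edge_def)
      hence "(\<Sum>y\<in>X. if model_edge \<sigma> (\<lambda>h. \<sigma> (inv h)) h y (\<sigma> g x) then v (i, y) else 0)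
        = (\<Sum>y\<in>X. if y = \<sigma> (h \<otimes> g) x then v (i, \<sigma> (h \<otimes> g) x) else 0)"
        by (intro sum.cong) auto
      also have "\<dots> = z (i, h \<otimes> g)" using X \<sigma>X[OF hgR] vz[OF \<open>i \<in> I\<close> hg] by simp
      finally show ?thesis .
    qed
    hence "mat_app ?J (conj_transpose ?A) v (j, \<sigma> g x) = (\<Sum>i\<in>I. \<Sum>h\<in>S. of_int (a i j h) * z (i, h \<otimes> g))"
      unfolding model_matrix_adj_app[OF I X j \<sigma>X[OF gR]] by (intro sum.cong refl) auto
    moreover have "g \<in> carrier G" using gR ball_carrier[OF S(2)] by blast
    ultimately show ?thesis
      using j vz[OF j gS] by (simp add: conj_transpose_minus_scalar mat_app_minus_scalar[OF J v] group_op_adj_def)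
  qed
  define r where "r = R - 2 * Suc k"
  have r: "R - 2 * k = Suc (Suc r)" "Suc (Suc r) \<le> R" using Suc.prems(1) by (auto simp: r_def)
  have g: "g \<in> cayley_ball S r" using Suc.prems by (simp add: r_def)
  have "mat_app ?J ?M ut (i, \<sigma> g x) = group_op I S a c u (i, g)" if "i \<in> I" "g \<in> cayley_ball S (Suc r)" for i g
    using op[OF that r(2) ut_vecs] IH unfolding r(1) by blast
  hence "mat_app ?J (conj_transpose ?M) (mat_app ?J ?M ut) (i, \<sigma> g x) = group_op_adj I S a c (group_op I S a c u) (i, g)"
    using op_adj[OF Suc.prems(2) g _ mat_app_in_vecs] r(2) by simp
  moreover have "ut (i, \<sigma> g x) = u (i, g)"
    using IH[OF Suc.prems(2)] ball_Suc[OF S(2) ball_Suc[OF S(2) g]] unfolding r(1) by blast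
  ultimately have "damp ?J \<kappa> ?M ut (i, \<sigma> g x) = group_damp I S \<kappa> a c u (i, g)"
    by (simp add: damp_def group_damp_def mat_app_gram)
  thus ?case by (simp add: ut_def u_def)
qed

text \<open>
  After \<open>m\<close> steps the comparison with the group is valid on the ball of radius \<open>2 m\<close>, which contains the
  support. The map \<open>g \<mapsto> \<sigma> g x\<close> is injective on this ball because quotients of its elements lie in
  the ball of radius \<open>4 m\<close>.
\<close>

lemma model_trace_lower_bound:
  fixes I :: "'i set" and \<sigma> :: "'a \<Rightarrow> 'x \<Rightarrow> 'x"
  assumes I: "finite I" and S: "finite S" "S \<subseteq> carrier G" and i0: "i0 \<in> I"
    and X: "finite X" and x: "x \<in> X" and sp: "sofic_point G (cayley_ball S (4 * m + 1)) X \<sigma> x"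
  shows "(\<Sum>p\<in>I \<times> cayley_ball S (2 * m).
      (cmod ((group_damp I S \<kappa> a c ^^ m) (\<lambda>p. if p = (i0, \<one>) then 1 else 0) p))\<^sup>2)
    \<le> (norm_on (I \<times> X) ((damp (I \<times> X) \<kappa> (minus_scalar (model_matrix S a \<sigma> (\<lambda>h. \<sigma> (inv h))) c) ^^ m)
          (\<lambda>p. if p = (i0, x) then 1 else 0)))\<^sup>2"
proof -
  let ?R = "4 * m + 1" and ?B = "cayley_ball S (2 * m)" and ?J = "I \<times> X"
  define ut where "ut = (damp ?J \<kappa> (minus_scalar (model_matrix S a \<sigma> (\<lambda>h. \<sigma> (inv h))) c) ^^ m) (\<lambda>p. if p = (i0, x) then 1 else 0)"
  define u where "u = (group_damp I S \<kappa> a c ^^ m) (\<lambda>p. if p = (i0, \<one>) then 1 else 0)"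
  define e where "e p = (fst p, \<sigma> (snd p) x)" for p :: "'i \<times> 'a"
  have BR: "?B \<subseteq> cayley_ball S (?R - 2 * m)" "?B \<subseteq> cayley_ball S ?R" by (rule ball_mono[OF S(2)], simp)+
  have match: "ut (e p) = u p" if pI: "p \<in> I \<times> ?B" for p
  proof -
    obtain i g where p: "p = (i, g)" "i \<in> I" "g \<in> ?B" using pI by blast
    have "g \<in> cayley_ball S (?R - 2 * m)" using p BR by blast
    thus ?thesis
      unfolding p(1) e_def ut_def u_def fst_conv snd_conv
      by (intro model_damp_matches[OF I S X x sp _ i0] p(2)) auto
  qed
  have inj: "inj_on e (I \<times> ?B)"
  proof (rule inj_onI)
    fix p q assume pq: "p \<in> I \<times> ?B" "q \<in> I \<times> ?B" "e p = e q"
    define g h where "g = snd p" and "h = snd q"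
    have gh: "g \<in> ?B" "h \<in> ?B" "\<sigma> g x = \<sigma> h x" using pq by (auto simp: g_def h_def e_def)
    have car: "g \<in> carrier G" "h \<in> carrier G" using gh ball_carrier[OF S(2)] by blast+
    have hi: "inv h \<in> ?B" using ball_inv[OF S(2)] gh by blast
    have hg: "inv h \<otimes> g \<in> cayley_ball S ?R"
    proof -
      have "inv h \<otimes> g \<in> cayley_ball S (2 * m + 2 * m)" using ball_mult[OF S(2) hi gh(1)] .
      moreover have "cayley_ball S (2 * m + 2 * m) \<subseteq> cayley_ball S ?R" by (rule ball_mono[OF S(2)]) simp
      ultimately show ?thesis by blast
    qed
    have mult: "\<sigma> (inv h) (\<sigma> k x) = \<sigma> (inv h \<otimes> k) x" if "k \<in> ?B" for k
      using sp hi that BR(2) unfolding sofic_point_def by blast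
    have "\<sigma> (inv h \<otimes> g) x = \<sigma> (inv h \<otimes> h) x" using mult[OF gh(1)] mult[OF gh(2)] gh(3) by simp
    also have "\<dots> = x" using sp car by (simp add: sofic_point_def)
    finally have "inv h \<otimes> g = \<one>" using sp hg unfolding sofic_point_def by blast
    hence "h \<otimes> (inv h \<otimes> g) = h \<otimes> \<one>" by simp
    hence "g = h" using car by (simp add: m_assoc[symmetric])
    thus "p = q" using pq(3) by (auto simp: g_def h_def e_def prod_eq_iff)
  qed
  have "(\<Sum>p\<in>I \<times> ?B. (cmod (u p))\<^sup>2) = (\<Sum>p\<in>I \<times> ?B. (cmod (ut (e p)))\<^sup>2)"
    using match by (intro sum.cong) auto
  also have "\<dots> = (\<Sum>q\<in>e ` (I \<times> ?B). (cmod (ut q))\<^sup>2)" by (simp add: sum.reindex[OF inj])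
  also have "\<dots> \<le> (\<Sum>q\<in>?J. (cmod (ut q))\<^sup>2)"
  proof (rule sum_mono2)
    show "e ` (I \<times> ?B) \<subseteq> ?J"
      using sp BR(2) unfolding e_def sofic_point_def by (auto simp del: cayley_ball.simps)
  qed (use I X in auto)
  finally show ?thesis by (simp add: norm_on_def L2_set_def sum_nonneg u_def ut_def)
qed

text \<open>
  If \<open>c\<close> were transcendental, the trace bound with a proportion \<open>\<delta>\<close> would hold for some \<open>m\<close> in all finite
  models, while each good point of a model contributes at least the constant \<open>d\<close> to the trace.
\<close>

lemma sofic_integer_eigenvalue_algebraic:
  fixes I :: "'i set" and v :: "'i \<Rightarrow> 'a \<Rightarrow> complex"
  assumes sofic: "sofic G" and I: "finite I" and S: "finite S" "S \<subseteq> carrier G"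
    and eig: "\<And>i g. i \<in> I \<Longrightarrow> g \<in> carrier G \<Longrightarrow> (\<Sum>j\<in>I. \<Sum>h\<in>S. of_int (a i j h) * v j (inv h \<otimes> g)) = c * v i g"
    and l2: "\<And>i. i \<in> I \<Longrightarrow> (\<lambda>g. (cmod (v i g))\<^sup>2) summable_on carrier G"
    and nz: "i0 \<in> I" "g0 \<in> carrier G" "v i0 g0 \<noteq> 0"
  shows "algebraic c"
proof (rule ccontr)
  assume c: "\<not> algebraic c"
  \<comment> \<open>A right translation commutes with left multiplication and moves a nonzero value to the identity.\<close>
  define w where "w i g = v i (g \<otimes> g0)" for i g
  define b where "b = 1 + (\<Sum>i\<in>I. infsum (\<lambda>g. (cmod (v i g))\<^sup>2) (carrier G))"
  have b: "b > 0" unfolding b_def by (intro add_pos_nonneg sum_nonneg infsum_nonneg) auto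
  have w_eig: "(\<Sum>j\<in>I. \<Sum>h\<in>S. of_int (a i j h) * w j (inv h \<otimes> g)) = c * w i g"
    if "i \<in> I" "g \<in> carrier G" for i g
  proof -
    have "(\<Sum>j\<in>I. \<Sum>h\<in>S. of_int (a i j h) * w j (inv h \<otimes> g))
        = (\<Sum>j\<in>I. \<Sum>h\<in>S. of_int (a i j h) * v j (inv h \<otimes> (g \<otimes> g0)))"
      unfolding w_def using S that nz by (intro sum.cong refl) (auto simp: m_assoc subset_iff)
    thus ?thesis using eig[OF that(1), of "g \<otimes> g0"] that nz by (simp add: w_def)
  qed
  have bound: "(\<Sum>i\<in>I. \<Sum>g\<in>F. (cmod (w i g))\<^sup>2) \<le> b" if F: "finite F" "F \<subseteq> carrier G" for F
  proof -
    have "(\<Sum>g\<in>F. (cmod (w i g))\<^sup>2) \<le> infsum (\<lambda>g. (cmod (v i g))\<^sup>2) (carrier G)" if i: "i \<in> I" for i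
    proof -
      have inj: "inj_on (\<lambda>g. g \<otimes> g0) F" using F nz by (auto simp: inj_on_def subset_iff)
      have "(\<Sum>g\<in>F. (cmod (w i g))\<^sup>2) = (\<Sum>g\<in>(\<lambda>g. g \<otimes> g0) ` F. (cmod (v i g))\<^sup>2)"
        by (simp add: sum.reindex[OF inj] w_def)
      also have "\<dots> \<le> infsum (\<lambda>g. (cmod (v i g))\<^sup>2) (carrier G)"
        using F nz by (intro finite_sum_le_infsum l2 i) auto
      finally show ?thesis .
    qed
    hence "(\<Sum>i\<in>I. \<Sum>g\<in>F. (cmod (w i g))\<^sup>2) \<le> (\<Sum>i\<in>I. infsum (\<lambda>g. (cmod (v i g))\<^sup>2) (carrier G))"
      by (rule sum_mono)
    thus ?thesis by (simp add: b_def)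
  qed
  define d where "d = (cmod (w i0 \<one>))\<^sup>2 / b"
  have d: "d > 0" using nz b by (simp add: d_def w_def)
  define K where "K = (\<Sum>i\<in>I. \<Sum>j\<in>I. \<Sum>h\<in>S. real_of_int \<bar>a i j h\<bar>)"
  have K: "K \<ge> 0" unfolding K_def by (intro sum_nonneg) auto
  define \<kappa> where "\<kappa> = (K + cmod c + 1)\<^sup>2"
  have cI: "card I > 0" using I nz by (auto simp: card_gt_0_iff)
  \<comment> \<open>At least half of the points will be good, so the trace is at least \<open>d |X| / 2\<close>; this choice of \<open>\<delta>\<close>
    makes the upper bound \<open>d |X| / 4\<close>.\<close>
  define \<delta> where "\<delta> = d / (4 * card I)"
  have \<delta>: "\<delta> > 0" using d cI by (simp add: \<delta>_def)
  obtain m where m: "\<And>(J :: ('i \<times> nat) set) A. finite J \<Longrightarrow> (\<And>i j. i \<in> J \<Longrightarrow> j \<in> J \<Longrightarrow> A i j \<in> \<int>) \<Longrightarrow>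
      bounded_op J K (mat_app J A) \<Longrightarrow>
      (\<Sum>j\<in>J. (norm_on J ((damp J \<kappa> (minus_scalar A c) ^^ m) (\<lambda>i. if i = j then 1 else 0)))\<^sup>2) \<le> \<delta> * card J"
  proof (rule transcendental_trace_decay[OF c K \<delta>, where 'j = "'i \<times> nat"])
    fix m
    assume "\<And>(J :: ('i \<times> nat) set) A. finite J \<Longrightarrow> (\<And>i j. i \<in> J \<Longrightarrow> j \<in> J \<Longrightarrow> A i j \<in> \<int>) \<Longrightarrow>
      bounded_op J K (mat_app J A) \<Longrightarrow>
      (\<Sum>j\<in>J. (norm_on J ((damp J ((K + cmod c + 1)\<^sup>2) (minus_scalar A c) ^^ m) (\<lambda>i. if i = j then 1 else 0)))\<^sup>2)
        \<le> \<delta> * card J"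
    thus thesis by (rule that[unfolded \<kappa>_def])
  qed
  let ?B = "cayley_ball S (4 * m + 1)"
  obtain X :: "nat set" and \<sigma> where X: "sofic_approx G ?B (1 / 2) X \<sigma>"
  proof -
    have "finite ?B" "?B \<subseteq> carrier G" "(1 / 2 :: real) > 0"
      using ball_finite[OF S(1)] ball_carrier[OF S(2)] by (blast, blast, simp)
    thus ?thesis using sofic that unfolding sofic_def by metis
  qed
  have X_fin: "finite X" "X \<noteq> {}" using X by (auto simp: sofic_approx_def)
  define Y where "Y = {x \<in> X. sofic_point G ?B X \<sigma> x}"
  have cY: "real (card Y) \<ge> card X / 2"
  proof -
    have "card Y + card {x \<in> X. \<not> sofic_point G ?B X \<sigma> x} = card (Y \<union> {x \<in> X. \<not> sofic_point G ?B X \<sigma> x})"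
      using X_fin by (intro card_Un_disjoint[symmetric]) (auto simp: Y_def)
    also have "Y \<union> {x \<in> X. \<not> sofic_point G ?B X \<sigma> x} = X" by (auto simp: Y_def)
    finally have "real (card Y) + real (card {x \<in> X. \<not> sofic_point G ?B X \<sigma> x}) = card X" by linarith
    moreover have "real (card {x \<in> X. \<not> sofic_point G ?B X \<sigma> x}) \<le> 1 / 2 * card X"
      using X by (simp add: sofic_approx_def)
    ultimately show ?thesis by simp
  qed
  let ?J = "I \<times> X" and ?A = "model_matrix S a \<sigma> (\<lambda>h. \<sigma> (inv h))"
  define T where "T p = (norm_on ?J ((damp ?J \<kappa> (minus_scalar ?A c) ^^ m) (\<lambda>q. if q = p then 1 else 0)))\<^sup>2" for p
  have "d * card Y = (\<Sum>x\<in>Y. d)" by simp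
  also have "\<dots> \<le> (\<Sum>x\<in>Y. T (i0, x))"
  proof (rule sum_mono)
    fix x assume x: "x \<in> Y"
    have "d \<le> (\<Sum>p\<in>I \<times> cayley_ball S (2 * m).
        (cmod ((group_damp I S \<kappa> a c ^^ m) (\<lambda>p. if p = (i0, \<one>) then 1 else 0) p))\<^sup>2)"
      unfolding d_def by (rule group_damp_lower_bound[OF I S nz(1) w_eig bound b])
    also have "\<dots> \<le> T (i0, x)"
      unfolding T_def using x by (intro model_trace_lower_bound[OF I S nz(1) X_fin(1)]) (auto simp: Y_def)
    finally show "d \<le> T (i0, x)" .
  qed
  also have "\<dots> = (\<Sum>p\<in>(\<lambda>x. (i0, x)) ` Y. T p)" by (subst sum.reindex) (auto simp: inj_on_def)
  also have "\<dots> \<le> (\<Sum>p\<in>?J. T p)"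
    using I X_fin nz(1) by (intro sum_mono2) (auto simp: Y_def T_def)
  also have "\<dots> \<le> \<delta> * card ?J"
    unfolding T_def
  proof (rule m)
    show "finite ?J" using I X_fin by simp
    show "bounded_op ?J K (mat_app ?J ?A)" unfolding K_def by (rule model_matrix_bounded_op[OF I X_fin(1) S(1)])
  qed (rule model_matrix_int)
  also have "\<dots> = d * card X / 4" using cI by (simp add: \<delta>_def card_cartesian_product)
  finally have "d * card Y \<le> d * (card X / 4)" by simp
  hence "real (card Y) \<le> card X / 4" using d by simp
  hence "real (card X) / 2 \<le> card X / 4" using cY by linarith
  thus False using X_fin by (simp add: card_gt_0_iff)
qed

end

lemma algebraic_of_int_mult_cancel:
  assumes "algebraic (of_int D * c :: complex)" "D \<noteq> 0"
  shows "algebraic c"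
proof -
  obtain p where p: "\<And>i. coeff p i \<in> \<int>" "p \<noteq> 0" "poly p (of_int D * c) = 0"
    using assms(1) by (rule algebraicE) blast
  let ?q = "pcompose p [:0, of_int D:]"
  have coeff: "coeff ?q i = coeff p i * of_int D ^ i" for i
    by (simp add: coeff_pcompose_linear)
  show ?thesis
  proof (rule algebraicI[of ?q])
    show "coeff ?q i \<in> \<int>" for i unfolding coeff using p(1) by simp
    show "?q \<noteq> 0"
    proof
      assume "?q = 0"
      hence "coeff p i * of_int D ^ i = 0" for i using coeff[of i] by simp
      hence "coeff p i = 0" for i using assms(2) by auto
      thus False using p(2) by (simp add: poly_eq_iff)
    qed
    show "poly ?q c = 0" using p(3) by (simp add: poly_pcompose mult.commute)
  qed
qed

text \<open>
  Every coefficient is replaced by the integer matrix of its multiplication by \<open>D\<close> times the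
  coefficient on the generators \<open>V\<close> of a preserved lattice. The eigenvector is tensored with
  the vector of generators, which turns the eigenvalue \<open>c\<close> into \<open>D c\<close>.
\<close>

lemma sofic_algebraic_eigenvalue_property:
  assumes G: "group G" and sofic: "sofic G"
  shows "algebraic_eigenvalue_property G"
  unfolding algebraic_eigenvalue_property_def
proof (intro allI impI)
  fix d A c
  assume "1 \<le> d" and A: "\<forall>i<d. \<forall>j<d. A i j \<in> group_algebra algebraic_numbers G"
    and ev: "is_eigenvalue G d A c"
  interpret group G by fact
  obtain v where v: "v \<in> l2_vec G d" "v \<noteq> (\<lambda>_ _. 0)" "left_mult G d A v = (\<lambda>i g. c * v i g)"
    using ev by (auto simp: is_eigenvalue_def)
  define supp where "supp i j = {h. A i j h \<noteq> 0}" for i j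
  define S where "S = (\<Union>i<d. \<Union>j<d. supp i j)"
  have supp: "finite (supp i j)" "supp i j \<subseteq> carrier G" "supp i j \<subseteq> S" if "i < d" "j < d" for i j
    using A that by (auto simp: group_algebra_def supp_def S_def)
  have "finite S" unfolding S_def by (intro finite_UN_I finite_lessThan supp(1)) auto
  moreover have "S \<subseteq> carrier G" unfolding S_def by (intro UN_least supp(2)) auto
  ultimately have S: "finite S" "S \<subseteq> carrier G" .
  define E where "E = (\<lambda>(i, j, h). A i j h) ` ({..<d} \<times> {..<d} \<times> S)"
  have "finite E" using S by (simp add: E_def)
  moreover have "algebraic e" if "e \<in> E" for e
    using that A by (auto simp: E_def group_algebra_def algebraic_numbers_def)
  ultimately have "\<exists>(V :: complex set) (D :: int). finite V \<and> (\<exists>v\<in>V. v \<noteq> 0) \<and> D \<noteq> 0 \<and>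
      (\<forall>e\<in>E. \<forall>y\<in>V. of_int D * e * y \<in> zspan V)"
    by (rule algebraic_numbers_preserve_lattice)
  then obtain V and D :: int where V: "finite V" "\<exists>y\<in>V. y \<noteq> 0" "D \<noteq> 0"
    "\<And>e y. e \<in> E \<Longrightarrow> y \<in> V \<Longrightarrow> of_int D * e * y \<in> zspan V" by blast
  have "\<exists>k :: complex \<Rightarrow> int. of_int D * e * y = (\<Sum>z\<in>V. of_int (k z) * z)" if "e \<in> E" "y \<in> V" for e y
    using V(4)[OF that] by (simp add: zspan_def)
  then obtain M :: "complex \<Rightarrow> complex \<Rightarrow> complex \<Rightarrow> int" where
    M: "\<And>e y. e \<in> E \<Longrightarrow> y \<in> V \<Longrightarrow> of_int D * e * y = (\<Sum>z\<in>V. of_int (M e y z) * z)"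
    by metis
  define I where "I = {..<d} \<times> V"
  define a where "a p q h = M (A (fst p) (fst q) h) (snd p) (snd q)" for p q :: "nat \<times> complex" and h
  define w where "w p g = v (fst p) g * snd p" for p :: "nat \<times> complex" and g
  have conv: "(\<Sum>j<d. \<Sum>h\<in>S. A i j h * v j (inv\<^bsub>G\<^esub> h \<otimes>\<^bsub>G\<^esub> g)) = c * v i g"
    if i: "i < d" and g: "g \<in> carrier G" for i g
  proof -
    have "c * v i g = left_mult G d A v i g" using v(3) by (simp add: fun_eq_iff)
    also have "\<dots> = (\<Sum>j<d. \<Sum>h\<in>supp i j. A i j h * v j (inv\<^bsub>G\<^esub> h \<otimes>\<^bsub>G\<^esub> g))"
      using i g by (simp add: left_mult_def convolution_def supp_def)
    also have "\<dots> = (\<Sum>j<d. \<Sum>h\<in>S. A i j h * v j (inv\<^bsub>G\<^esub> h \<otimes>\<^bsub>G\<^esub> g))"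
      using supp(3)[OF i] S(1) by (intro sum.cong refl sum.mono_neutral_left) (auto simp: supp_def)
    finally show ?thesis by simp
  qed
  have eig: "(\<Sum>q\<in>I. \<Sum>h\<in>S. of_int (a p q h) * w q (inv\<^bsub>G\<^esub> h \<otimes>\<^bsub>G\<^esub> g)) = (of_int D * c) * w p g"
    if p: "p \<in> I" and g: "g \<in> carrier G" for p g
  proof -
    obtain i y where iy: "p = (i, y)" "i < d" "y \<in> V" using p by (auto simp: I_def)
    have "(\<Sum>q\<in>I. \<Sum>h\<in>S. of_int (a p q h) * w q (inv\<^bsub>G\<^esub> h \<otimes>\<^bsub>G\<^esub> g))
        = (\<Sum>j<d. \<Sum>z\<in>V. \<Sum>h\<in>S. v j (inv\<^bsub>G\<^esub> h \<otimes>\<^bsub>G\<^esub> g) * (of_int (M (A i j h) y z) * z))"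
    proof -
      have "(\<Sum>q\<in>I. f q) = (\<Sum>j<d. \<Sum>z\<in>V. f (j, z))" for f :: "nat \<times> complex \<Rightarrow> complex"
        unfolding I_def by (simp add: sum.cartesian_product)
      thus ?thesis by (simp add: a_def w_def iy mult_ac)
    qed
    also have "\<dots> = (\<Sum>j<d. \<Sum>h\<in>S. \<Sum>z\<in>V. v j (inv\<^bsub>G\<^esub> h \<otimes>\<^bsub>G\<^esub> g) * (of_int (M (A i j h) y z) * z))"
      by (intro sum.cong refl sum.swap)
    also have "\<dots> = (\<Sum>j<d. \<Sum>h\<in>S. (of_int D * y) * (A i j h * v j (inv\<^bsub>G\<^esub> h \<otimes>\<^bsub>G\<^esub> g)))"
    proof (intro sum.cong refl)
      fix j h assume "j \<in> {..<d}" "h \<in> S"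
      hence "A i j h \<in> E" using iy(2) unfolding E_def by (intro image_eqI[of _ _ "(i, j, h)"]) auto
      from M[OF this iy(3)]
      have "(\<Sum>z\<in>V. v j (inv\<^bsub>G\<^esub> h \<otimes>\<^bsub>G\<^esub> g) * (of_int (M (A i j h) y z) * z))
        = v j (inv\<^bsub>G\<^esub> h \<otimes>\<^bsub>G\<^esub> g) * (of_int D * A i j h * y)" by (simp add: sum_distrib_left)
      thus "(\<Sum>z\<in>V. v j (inv\<^bsub>G\<^esub> h \<otimes>\<^bsub>G\<^esub> g) * (of_int (M (A i j h) y z) * z))
        = (of_int D * y) * (A i j h * v j (inv\<^bsub>G\<^esub> h \<otimes>\<^bsub>G\<^esub> g))" by (simp add: mult_ac)
    qed
    also have "\<dots> = (of_int D * y) * (\<Sum>j<d. \<Sum>h\<in>S. A i j h * v j (inv\<^bsub>G\<^esub> h \<otimes>\<^bsub>G\<^esub> g))"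
      by (simp add: sum_distrib_left)
    finally show ?thesis unfolding conv[OF iy(2) g] by (simp add: w_def iy mult_ac)
  qed
  obtain i g where ig: "v i g \<noteq> 0" using v(2) by (auto simp: fun_eq_iff)
  have i: "i < d"
  proof (rule ccontr)
    assume "\<not> i < d"
    hence "v i = (\<lambda>_. 0)" using v(1) by (simp add: l2_vec_def)
    thus False using ig by simp
  qed
  have l2: "v j \<in> l2 G" if "j < d" for j using v(1) that by (simp add: l2_vec_def)
  have g: "g \<in> carrier G" using l2[OF i] ig by (auto simp: l2_def)
  obtain y where y: "y \<in> V" "y \<noteq> 0" using V by blast
  have "algebraic (of_int D * c)"
  proof (rule sofic_integer_eigenvalue_algebraic[OF sofic _ S eig])
    show "finite I" using V by (simp add: I_def)
    fix p assume "p \<in> I"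
    hence "v (fst p) \<in> l2 G" using l2 by (auto simp: I_def)
    hence "(\<lambda>g. (cmod (v (fst p) g))\<^sup>2 * (cmod (snd p))\<^sup>2) summable_on carrier G"
      unfolding l2_def by (intro summable_on_cmult_left) auto
    thus "(\<lambda>g. (cmod (w p g))\<^sup>2) summable_on carrier G"
      by (simp add: w_def norm_mult power_mult_distrib)
  next
    show "(i, y) \<in> I" using i y by (simp add: I_def)
    show "w (i, y) g \<noteq> 0" using ig y by (simp add: w_def)
  qed (use g in auto)
  thus "algebraic c" using algebraic_of_int_mult_cancel V(3) by blast
qed

section \<open>The algebraic eigenvalue property\<close>

theorem theorem3p7:
  fixes G :: "('a, 'b) monoid_scheme"
  assumes "class_K G"
  shows "algebraic_eigenvalue_property G"
proof (rule sofic_algebraic_eigenvalue_property)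
  show "sofic G" using assms by (rule sofic_of_class_K)
  from assms show "group G"
    by cases (auto simp: free_group_def amenable_def normal_def)
qed

end
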